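(* Let $M=\Gamma\backslash\mathbb{H}^3$ be a convex cocompact hyperbolic 3-manifold. If $\overline M$ has incompressible boundary, then the fundamental group of any geodesic plane $P^*\subset M^*$ that is closed in $M^*$ is nontrivial.
   Context: $M=\Gamma\backslash\mathbb{H}^3$ is a complete oriented hyperbolic 3-manifold, $\Gamma$ a (torsion-free) discrete subgroup of $G=\mathrm{PSL}_2(\mathbb{C})\cong\mathrm{Isom}^+(\mathbb{H}^3)$; $H=\mathrm{PSL}_2(\mathbb{R})$. $\Lambda\subset S^2=\partial\mathbb{H}^3$ is the limit set of $\Gamma$, $\Omega=S^2-\Lambda$, $\overline M=\Gamma\backslash(\mathbb{H}^3\cup\Omega)$, $\mathrm{core}(M)=\Gamma\backslash\mathrm{hull}(\Lambda)$, and $M^*$ is the interior of $\mathrm{core}(M)$. $M$ is convex cocompact if $\mathrm{core}(M)$ is compact and $\Gamma$ has no parabolics (equivalently $\overline M$ is compact). A compact 3-manifold $N$ with boundary has incompressible boundary if every continuous map $(D^2,\partial D^2)\to(N,\partial N)$ from the closed 2-disk can be deformed, as a map of pairs, so that its image lies in $\partial N$ (automatic if $\partial N=\emptyset$). A geodesic plane $P\subset M$ is the image of a totally geodesic immersion of $\mathbb{H}^2$; it is the image of $\mathrm{hull}(C)\subset\mathbb{H}^3$ under $\mathbb{H}^3\to M$ for some oriented circle $C\subset S^2$. A geodesic plane $P^*\subset M^*$ is a nonempty intersection $P^*=P\cap M^*$. The stabilizer of the oriented circle $C$ in $G$ is a conjugate $xHx^{-1}$, and $\Gamma^C=\Gamma\cap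 xHx^{-1}$. The fundamental group of $P$ (and of $P^*$) means $\pi_1(S)\cong\Gamma^C$, where $S=\Gamma^C\backslash\mathrm{hull}(C)$. *)

theory Defs
  imports "HOL-Analysis.Analysis" "HOL-Algebra.Coset"
begin

subsection \<open>Quotient topology\<close>

text \<open>The quotient topology on the image of a map \<open>f\<close>; it is used for \<open>PSL\<^sub>2(\<complex>)\<close> and for orbit
  spaces.\<close>

definition quotient_topology :: "'a topology \<Rightarrow> ('a \<Rightarrow> 'b) \<Rightarrow> 'b topology" where
  "quotient_topology X f =
     topology (\<lambda>U. U \<subseteq> f ` topspace X \<and> openin X {x \<in> topspace X. f x \<in> U})"

lemma openin_quotient_topology:
  "openin (quotient_topology X f) U \<longleftrightarrow>
     U \<subseteq> f ` topspace X \<and> openin X {x \<in> topspace X. f x \<in> U}"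
proof -
  have "istopology (\<lambda>U. U \<subseteq> f ` topspace X \<and> openin X {x \<in> topspace X. f x \<in> U})"
    unfolding istopology_def
  proof (intro conjI allI impI)
    fix S T
    assume S: "S \<subseteq> f ` topspace X \<and> openin X {x \<in> topspace X. f x \<in> S}"
      and T: "T \<subseteq> f ` topspace X \<and> openin X {x \<in> topspace X. f x \<in> T}"
    show "S \<inter> T \<subseteq> f ` topspace X" using S by blast
    have "{x \<in> topspace X. f x \<in> S \<inter> T} =
        {x \<in> topspace X. f x \<in> S} \<inter> {x \<in> topspace X. f x \<in> T}" by blast
    then show "openin X {x \<in> topspace X. f x \<in> S \<inter> T}"
      using S T by (simp add: openin_Int)
  next
    fix K
    assume K: "\<forall>S\<in>K. S \<subseteq> f ` topspace X \<and> openin X {x \<in> topspace X. f x \<in> S}"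
    show "\<Union>K \<subseteq> f ` topspace X" using K by blast
    have "{x \<in> topspace X. f x \<in> \<Union>K} = (\<Union>S\<in>K. {x \<in> topspace X. f x \<in> S})" by blast
    then show "openin X {x \<in> topspace X. f x \<in> \<Union>K}"
      using K by auto
  qed
  then show ?thesis
    by (simp add: quotient_topology_def)
qed

lemma topspace_quotient_topology [simp]:
  "topspace (quotient_topology X f) = f ` topspace X"
proof (rule subset_antisym)
  show "topspace (quotient_topology X f) \<subseteq> f ` topspace X"
    using openin_quotient_topology openin_topspace by metis
  have "{x \<in> topspace X. f x \<in> f ` topspace X} = topspace X" by blast
  then have "openin (quotient_topology X f) (f ` topspace X)"
    by (simp add: openin_quotient_topology)
  then show "f ` topspace X \<subseteq> topspace (quotient_topology X f)"
    by (rule openin_subset)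
qed

lemma quotient_map_quotient_topology: "quotient_map X (quotient_topology X f) f"
  by (auto simp: quotient_map_def openin_quotient_topology)


subsection \<open>The group \<open>PSL\<^sub>2(\<complex>)\<close>\<close>

definition SL2C :: "(complex^2^2) monoid" where
  "SL2C = \<lparr>carrier = {A. det A = 1}, mult = (**), one = mat 1\<rparr>"

definition pm_one :: "(complex^2^2) set" where
  "pm_one = {mat 1, - mat 1}"

definition PSL2C :: "(complex^2^2) set monoid" where
  "PSL2C = SL2C Mod pm_one"

definition to_PSL2C :: "complex^2^2 \<Rightarrow> (complex^2^2) set" where
  "to_PSL2C A = pm_one #>\<^bsub>SL2C\<^esub> A"

definition PSL2C_topology :: "(complex^2^2) set topology" where
  "PSL2C_topology = quotient_topology (top_of_set (carrier SL2C)) to_PSL2C"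

definition PSL2R :: "(complex^2^2) set set" where
  "PSL2R = to_PSL2C ` {A \<in> carrier SL2C. \<forall>i j. A $ i $ j \<in> \<real>}"

definition parabolic :: "(complex^2^2) set \<Rightarrow> bool" where
  "parabolic g \<longleftrightarrow> g \<in> carrier PSL2C \<and> g \<noteq> \<one>\<^bsub>PSL2C\<^esub> \<and> (\<exists>A\<in>g. (trace A)\<^sup>2 = 4)"

definition torsion_free_discrete_subgroup :: "(complex^2^2) set set \<Rightarrow> bool" where
  "torsion_free_discrete_subgroup \<Gamma> \<longleftrightarrow>
     subgroup \<Gamma> PSL2C \<and>
     subtopology PSL2C_topology \<Gamma> = discrete_topology \<Gamma> \<and>
     (\<forall>g\<in>\<Gamma>. \<forall>n::nat. n > 0 \<longrightarrow> g [^]\<^bsub>PSL2C\<^esub> n = \<one>\<^bsub>PSL2C\<^esub> \<longrightarrow> g = \<one>\<^bsub>PSL2C\<^esub>)"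


subsection \<open>Hyperbolic space and its sphere at infinity\<close>

text \<open>The projective (Klein) model: hyperbolic space is the open unit ball of \<open>\<real>\<^sup>3\<close>, its boundary is
  the unit sphere, geodesics are open chords and totally geodesic planes are intersections of
  affine planes with the ball.\<close>

abbreviation H3 :: "(real^3) set" where "H3 \<equiv> ball 0 1"

abbreviation S2 :: "(real^3) set" where "S2 \<equiv> sphere 0 1"

text \<open>The point \<open>v\<close> of the closed ball corresponds to the ray through a nonzero positive
  semidefinite Hermitian matrix \<open>herm v\<close>, whose determinant is \<open>1 - \<bar>v\<bar>\<^sup>2\<close>, and \<open>SL\<^sub>2(\<complex>)\<close> acts on
  these rays by \<open>X \<mapsto> A X A\<^sup>*\<close>. On the unit sphere \<open>herm v\<close> has rank one, and its image is the
  line in \<open>\<complex>\<^sup>2\<close> corresponding to \<open>v\<close> under \<open>S\<^sup>2 = \<complex>\<bbbP>\<^sup>1\<close>; see \<open>SL2C_act_stereo\<close> below.\<close>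

definition herm :: "real^3 \<Rightarrow> complex^2^2" where
  "herm v = vector [vector [of_real (1 + v$3), Complex (v$1) (v$2)],
                    vector [Complex (v$1) (- v$2), of_real (1 - v$3)]]"

definition ball_point :: "complex^2^2 \<Rightarrow> real^3" where
  "ball_point Y = (1 / Re (trace Y)) *\<^sub>R
     vector [2 * Re (Y$1$2), 2 * Im (Y$1$2), Re (Y$1$1) - Re (Y$2$2)]"

definition conj_transpose :: "complex^2^2 \<Rightarrow> complex^2^2" where
  "conj_transpose A = (\<chi> i j. cnj (A $ j $ i))"

definition SL2C_act :: "complex^2^2 \<Rightarrow> real^3 \<Rightarrow> real^3" where
  "SL2C_act A v = ball_point (A ** herm v ** conj_transpose A)"

text \<open>Both representatives of an element of \<open>PSL\<^sub>2(\<complex>)\<close> act in the same way.\<close>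

definition act :: "(complex^2^2) set \<Rightarrow> real^3 \<Rightarrow> real^3" where
  "act g v = the_elem ((\<lambda>A. SL2C_act A v) ` g)"

definition orbit_map :: "(complex^2^2) set set \<Rightarrow> real^3 \<Rightarrow> (real^3) set" where
  "orbit_map \<Gamma> v = (\<lambda>g. act g v) ` \<Gamma>"

text \<open>The orbit space \<open>\<Gamma>\X\<close>.\<close>

definition orbit_space :: "(complex^2^2) set set \<Rightarrow> (real^3) set \<Rightarrow> (real^3) set topology" where
  "orbit_space \<Gamma> X = quotient_topology (top_of_set X) (orbit_map \<Gamma>)"

text \<open>The hyperbolic convex hull of a closed set in the sphere at infinity; in the projective model
  it is the part of the Euclidean convex hull inside the open ball.\<close>

definition hyp_hull :: "(real^3) set \<Rightarrow> (real^3) set" where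
  "hyp_hull E = (convex hull E) \<inter> H3"


subsection \<open>The 3-manifold of a Kleinian group\<close>

definition limit_set :: "(complex^2^2) set set \<Rightarrow> (real^3) set" where
  "limit_set \<Gamma> = {\<xi> \<in> S2. \<exists>v\<in>H3. \<xi> islimpt orbit_map \<Gamma> v}"

definition domain_of_discontinuity :: "(complex^2^2) set set \<Rightarrow> (real^3) set" where
  "domain_of_discontinuity \<Gamma> = S2 - limit_set \<Gamma>"

definition hyp_manifold :: "(complex^2^2) set set \<Rightarrow> (real^3) set topology" where
  "hyp_manifold \<Gamma> = orbit_space \<Gamma> H3"

definition Mbar :: "(complex^2^2) set set \<Rightarrow> (real^3) set topology" where
  "Mbar \<Gamma> = orbit_space \<Gamma> (H3 \<union> domain_of_discontinuity \<Gamma>)"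

definition boundary_Mbar :: "(complex^2^2) set set \<Rightarrow> (real^3) set set" where
  "boundary_Mbar \<Gamma> = orbit_map \<Gamma> ` domain_of_discontinuity \<Gamma>"

definition convex_core :: "(complex^2^2) set set \<Rightarrow> (real^3) set set" where
  "convex_core \<Gamma> = orbit_map \<Gamma> ` hyp_hull (limit_set \<Gamma>)"

definition core_interior :: "(complex^2^2) set set \<Rightarrow> (real^3) set set" where
  "core_interior \<Gamma> = hyp_manifold \<Gamma> interior_of convex_core \<Gamma>"

definition convex_cocompact :: "(complex^2^2) set set \<Rightarrow> bool" where
  "convex_cocompact \<Gamma> \<longleftrightarrow>
     compactin (hyp_manifold \<Gamma>) (convex_core \<Gamma>) \<and> (\<forall>g\<in>\<Gamma>. \<not> parabolic g)"

text \<open>\<open>N\<close> is a manifold with boundary \<open>B\<close>.\<close>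

definition incompressible_boundary :: "'a topology \<Rightarrow> 'a set \<Rightarrow> bool" where
  "incompressible_boundary N B \<longleftrightarrow>
     (\<forall>f. continuous_map (top_of_set (cball (0::complex) 1)) N f \<and> f ` sphere 0 1 \<subseteq> B \<longrightarrow>
        (\<exists>f'. homotopic_with (\<lambda>h. h ` sphere 0 1 \<subseteq> B) (top_of_set (cball 0 1)) N f f' \<and>
              f' ` cball 0 1 \<subseteq> B))"


subsection \<open>Circles and geodesic planes\<close>

text \<open>The extended real line, as a circle on the sphere.\<close>

definition real_circle :: "(real^3) set" where
  "real_circle = {v \<in> S2. v $ 2 = 0}"

text \<open>Every oriented circle is the image of the extended real line, oriented as the boundary of the
  upper half-plane, under some \<open>x \<in> PSL\<^sub>2(\<complex>)\<close>. Here \<open>x\<close> represents this oriented circle; it is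
  determined by the circle up to right multiplication by \<open>PSL\<^sub>2(\<real>)\<close>.\<close>

definition circle :: "(complex^2^2) set \<Rightarrow> (real^3) set" where
  "circle x = act x ` real_circle"

definition circle_stabilizer :: "(complex^2^2) set \<Rightarrow> (complex^2^2) set set" where
  "circle_stabilizer x = {x \<otimes>\<^bsub>PSL2C\<^esub> h \<otimes>\<^bsub>PSL2C\<^esub> inv\<^bsub>PSL2C\<^esub> x | h. h \<in> PSL2R}"

definition geodesic_plane :: "(complex^2^2) set set \<Rightarrow> (complex^2^2) set \<Rightarrow> (real^3) set set" where
  "geodesic_plane \<Gamma> x = orbit_map \<Gamma> ` hyp_hull (circle x)"

text \<open>The surface \<open>S = \<Gamma>\<^sup>C\hull(C)\<close>, whose fundamental group is by definition that of the plane.\<close>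

definition plane_surface ::
    "(complex^2^2) set set \<Rightarrow> (complex^2^2) set \<Rightarrow> (real^3) set topology" where
  "plane_surface \<Gamma> x = orbit_space (\<Gamma> \<inter> circle_stabilizer x) (hyp_hull (circle x))"


subsection \<open>Fundamental group of a topological space\<close>

definition loops :: "'a topology \<Rightarrow> 'a \<Rightarrow> (real \<Rightarrow> 'a) set" where
  "loops X a = {p. pathin X p \<and> p 0 = a \<and> p 1 = a}"

definition loop_homotopy :: "'a topology \<Rightarrow> 'a \<Rightarrow> ((real \<Rightarrow> 'a) \<times> (real \<Rightarrow> 'a)) set" where
  "loop_homotopy X a = {(p, q). p \<in> loops X a \<and> q \<in> loops X a \<and>
     homotopic_with (\<lambda>h. h 0 = a \<and> h 1 = a) (top_of_set {0..1}) X p q}"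

text \<open>The library's \<open>(+++)\<close> requires a topological type class, so it does not apply here.\<close>

definition join_loops :: "(real \<Rightarrow> 'a) \<Rightarrow> (real \<Rightarrow> 'a) \<Rightarrow> real \<Rightarrow> 'a" where
  "join_loops p q = (\<lambda>t. if t \<le> 1/2 then p (2 * t) else q (2 * t - 1))"

definition fundamental_group :: "'a topology \<Rightarrow> 'a \<Rightarrow> (real \<Rightarrow> 'a) set monoid" where
  "fundamental_group X a = \<lparr>
     carrier = loops X a // loop_homotopy X a,
     mult = (\<lambda>\<alpha> \<beta>. \<Union>p\<in>\<alpha>. \<Union>q\<in>\<beta>. loop_homotopy X a `` {join_loops p q}),
     one = loop_homotopy X a `` {\<lambda>_. a}\<rparr>"

lemma equiv_loop_homotopy: "equiv (loops X a) (loop_homotopy X a)"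
proof (rule equivI)
  show "refl_on (loops X a) (loop_homotopy X a)"
    by (auto simp: refl_on_def loop_homotopy_def loops_def pathin_def)
  show "sym (loop_homotopy X a)"
    by (auto simp: sym_def loop_homotopy_def homotopic_with_sym)
  show "trans (loop_homotopy X a)"
    by (auto simp: trans_def loop_homotopy_def intro: homotopic_with_trans)
  show "loop_homotopy X a \<subseteq> loops X a \<times> loops X a"
    by (auto simp: loop_homotopy_def)
qed


subsection \<open>Consistency of the model\<close>

lemma conj_transpose_mult:
  "conj_transpose (A ** B) = conj_transpose B ** conj_transpose A"
  by (simp add: conj_transpose_def matrix_matrix_mult_def vec_eq_iff mult.commute)

lemma det_conj_transpose: "det (conj_transpose A) = cnj (det A)"
  by (simp add: conj_transpose_def det_2)

lemma SL2C_group: "group SL2C"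
proof (rule groupI)
  fix A assume "A \<in> carrier SL2C"
  then have "det A = 1" by (simp add: SL2C_def)
  then obtain B where B: "B ** A = mat 1" "A ** B = mat 1"
    using invertible_det_nz[of A] invertible_def by (metis zero_neq_one)
  have "det B * det A = 1"
    using B det_mul[of B A] by simp
  then have "det B = 1" using \<open>det A = 1\<close> by simp
  then show "\<exists>B\<in>carrier SL2C. B \<otimes>\<^bsub>SL2C\<^esub> A = \<one>\<^bsub>SL2C\<^esub>"
    using B by (auto simp: SL2C_def)
qed (auto simp: SL2C_def det_mul matrix_mul_assoc)

lemma minus_mat_1: "(- mat 1) ** A = - A" "A ** (- mat 1) = - A" for A :: "complex^2^2"
  by (simp_all add: vec_eq_iff matrix_matrix_mult_def mat_def forall_2 sum_2)

lemma det_minus_mat_1: "det (- mat 1 :: complex^2^2) = 1"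
  by (simp add: det_2 mat_def)

lemma pm_one_normal: "pm_one \<lhd> SL2C"
proof -
  interpret group SL2C by (rule SL2C_group)
  have inv: "inv\<^bsub>SL2C\<^esub> (- mat 1) = - mat 1"
    by (rule inv_equality) (simp_all add: SL2C_def minus_mat_1 det_minus_mat_1)
  have sub: "subgroup pm_one SL2C"
  proof
    show "inv\<^bsub>SL2C\<^esub> A \<in> pm_one" if "A \<in> pm_one" for A
    proof (cases "A = mat 1")
      case True
      then show ?thesis using inv_one by (simp add: pm_one_def SL2C_def)
    next
      case False
      then show ?thesis using that inv by (simp add: pm_one_def)
    qed
  qed (auto simp: pm_one_def SL2C_def det_minus_mat_1 minus_mat_1)
  show ?thesis
  proof (rule normalI[OF sub])
    show "\<forall>A\<in>carrier SL2C. pm_one #>\<^bsub>SL2C\<^esub> A = A <#\<^bsub>SL2C\<^esub> pm_one"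
      by (simp add: r_coset_def l_coset_def pm_one_def SL2C_def minus_mat_1)
  qed
qed

lemma PSL2C_group: "group PSL2C"
  unfolding PSL2C_def by (rule normal.factorgroup_is_group[OF pm_one_normal])

lemma to_PSL2C_eq: "to_PSL2C A = {A, - A}"
  by (auto simp: to_PSL2C_def r_coset_def pm_one_def SL2C_def minus_mat_1)

lemma act_to_PSL2C: "act (to_PSL2C A) v = SL2C_act A v"
proof -
  have "(- A) ** X ** conj_transpose (- A) = A ** X ** conj_transpose A" for X
    by (simp add: vec_eq_iff matrix_matrix_mult_def conj_transpose_def forall_2 sum_2 algebra_simps)
  then have "SL2C_act (- A) v = SL2C_act A v"
    by (simp add: SL2C_act_def)
  then show ?thesis
    by (simp add: act_def to_PSL2C_eq)
qed

lemma herm_component [simp]: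
  "herm v $ 1 $ 1 = of_real (1 + v$3)" "herm v $ 1 $ 2 = Complex (v$1) (v$2)"
  "herm v $ 2 $ 1 = Complex (v$1) (- v$2)" "herm v $ 2 $ 2 = of_real (1 - v$3)"
  by (simp_all add: herm_def)

lemma norm_sq_3: "(norm v)\<^sup>2 = (v$1)\<^sup>2 + (v$2)\<^sup>2 + (v$3)\<^sup>2" for v :: "real^3"
  by (subst power2_norm_eq_inner) (simp only: inner_vec_def sum_3 inner_real_def power2_eq_square)

lemma det_herm: "det (herm v) = of_real (1 - (norm v)\<^sup>2)"
  unfolding det_2 norm_sq_3 by (simp add: complex_eq_iff power2_eq_square algebra_simps)

text \<open>Inverse stereographic projection, under which \<open>SL\<^sub>2(\<complex>)\<close> acts on the sphere by Moebius
  transformations.\<close>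

definition stereo :: "complex \<Rightarrow> real^3" where
  "stereo z = (1 / ((norm z)\<^sup>2 + 1)) *\<^sub>R vector [2 * Re z, 2 * Im z, (norm z)\<^sup>2 - 1]"

lemma stereo_component:
  "stereo z $ 1 = 2 * Re z / ((norm z)\<^sup>2 + 1)" "stereo z $ 2 = 2 * Im z / ((norm z)\<^sup>2 + 1)"
  "stereo z $ 3 = ((norm z)\<^sup>2 - 1) / ((norm z)\<^sup>2 + 1)"
  by (simp_all add: stereo_def)

lemma norm_sq_plus_one_pos: "(norm z)\<^sup>2 + 1 > (0::real)" for z :: complex
  by (simp add: add_nonneg_pos)

lemma herm_stereo:
  fixes z :: complex
  defines "k \<equiv> 2 / ((norm z)\<^sup>2 + 1)"
  shows "herm (stereo z) $ 1 $ 1 = of_real k * (z * cnj z)"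
    "herm (stereo z) $ 1 $ 2 = of_real k * z"
    "herm (stereo z) $ 2 $ 1 = of_real k * cnj z"
    "herm (stereo z) $ 2 $ 2 = of_real k"
proof -
  have n: "(norm z)\<^sup>2 + 1 \<noteq> 0" using norm_sq_plus_one_pos[of z] by simp
  have a: "1 + stereo z $ 3 = k * (norm z)\<^sup>2" "1 - stereo z $ 3 = k"
    using n by (simp_all add: stereo_component k_def field_simps)
  show "herm (stereo z) $ 1 $ 1 = of_real k * (z * cnj z)"
    unfolding herm_component a of_real_mult complex_norm_square ..
  show "herm (stereo z) $ 2 $ 2 = of_real k"
    unfolding herm_component a ..
  show "herm (stereo z) $ 1 $ 2 = of_real k * z" "herm (stereo z) $ 2 $ 1 = of_real k * cnj z"
    by (simp_all add: stereo_component k_def complex_eq_iff)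
qed

theorem SL2C_act_stereo:
  assumes "A $ 2 $ 1 * z + A $ 2 $ 2 \<noteq> 0"
  shows "SL2C_act A (stereo z) =
    stereo ((A $ 1 $ 1 * z + A $ 1 $ 2) / (A $ 2 $ 1 * z + A $ 2 $ 2))"
proof -
  define p where "p = A $ 1 $ 1 * z + A $ 1 $ 2"
  define q where "q = A $ 2 $ 1 * z + A $ 2 $ 2"
  define k where "k = 2 / ((norm z)\<^sup>2 + 1)"
  define Y where "Y = A ** herm (stereo z) ** conj_transpose A"
  have k: "k > 0" using norm_sq_plus_one_pos[of z] by (simp add: k_def)
  have q: "q \<noteq> 0" using assms by (simp add: q_def)
  have Y: "Y $ 1 $ 1 = of_real k * (p * cnj p)" "Y $ 1 $ 2 = of_real k * (p * cnj q)"
    "Y $ 2 $ 2 = of_real k * (q * cnj q)"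
    unfolding Y_def p_def q_def k_def
    by (simp_all add: matrix_matrix_mult_def conj_transpose_def sum_2 herm_stereo
        del: herm_component of_real_divide)
      (simp_all add: algebra_simps)
  have Y': "Re (Y $ 1 $ 1) = k * (norm p)\<^sup>2" "Re (Y $ 2 $ 2) = k * (norm q)\<^sup>2"
    "Re (Y $ 1 $ 2) = k * Re (p * cnj q)" "Im (Y $ 1 $ 2) = k * Im (p * cnj q)"
    unfolding Y complex_norm_square[symmetric] by simp_all
  have tr: "Re (trace Y) = k * ((norm p)\<^sup>2 + (norm q)\<^sup>2)"
    by (simp add: trace_def sum_2 Y' distrib_left)
  have pq: "p / q = (p * cnj q) / of_real ((norm q)\<^sup>2)"
    using q by (subst complex_norm_square) (simp add: field_simps)
  have re: "Re (p / q) = Re (p * cnj q) / (norm q)\<^sup>2" "Im (p / q) = Im (p * cnj q) / (norm q)\<^sup>2"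
    unfolding pq Re_divide_of_real Im_divide_of_real by simp_all
  have nq: "(norm q)\<^sup>2 > 0" using q by simp
  have pos: "(norm p)\<^sup>2 + (norm q)\<^sup>2 > 0" using nq by (simp add: add_nonneg_pos)
  have np: "(norm (p / q))\<^sup>2 = (norm p)\<^sup>2 / (norm q)\<^sup>2"
    by (simp add: norm_divide power_divide)
  have sc: "x / b / (a / b + 1) = x / (a + b)" if "b > 0" "a + b > 0" for x a b :: real
    using that by (simp add: field_simps)
  have sc': "(a / b - 1) / (a / b + 1) = (a - b) / (a + b)" if "b > 0" "a + b > 0" for a b :: real
    using that by (simp add: divide_simps)
  have "ball_point Y = stereo (p / q)"
    unfolding vec_eq_iff forall_3
  proof (intro conjI)
    have "ball_point Y $ 1 = (k * (2 * Re (p * cnj q))) / (k * ((norm p)\<^sup>2 + (norm q)\<^sup>2))"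
      by (simp add: ball_point_def Y' tr)
    also have "\<dots> = (2 * Re (p * cnj q)) / ((norm p)\<^sup>2 + (norm q)\<^sup>2)"
      using k by (intro mult_divide_mult_cancel_left) simp
    finally show "ball_point Y $ 1 = stereo (p / q) $ 1"
      unfolding stereo_component np re times_divide_eq_right sc[OF nq pos] .
    have "ball_point Y $ 2 = (k * (2 * Im (p * cnj q))) / (k * ((norm p)\<^sup>2 + (norm q)\<^sup>2))"
      by (simp add: ball_point_def Y' tr)
    also have "\<dots> = (2 * Im (p * cnj q)) / ((norm p)\<^sup>2 + (norm q)\<^sup>2)"
      using k by (intro mult_divide_mult_cancel_left) simp
    finally show "ball_point Y $ 2 = stereo (p / q) $ 2"
      unfolding stereo_component np re times_divide_eq_right sc[OF nq pos] .
    have "ball_point Y $ 3 =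
        (k * (norm p)\<^sup>2 - k * (norm q)\<^sup>2) / (k * ((norm p)\<^sup>2 + (norm q)\<^sup>2))"
      unfolding tr[symmetric] by (simp add: ball_point_def Y' diff_divide_distrib)
    also have "\<dots> = (k * ((norm p)\<^sup>2 - (norm q)\<^sup>2)) / (k * ((norm p)\<^sup>2 + (norm q)\<^sup>2))"
      by (simp only: right_diff_distrib)
    also have "\<dots> = ((norm p)\<^sup>2 - (norm q)\<^sup>2) / ((norm p)\<^sup>2 + (norm q)\<^sup>2)"
      using k by simp
    finally show "ball_point Y $ 3 = stereo (p / q) $ 3"
      unfolding stereo_component np sc'[OF nq pos] .
  qed
  then show ?thesis
    by (simp add: SL2C_act_def Y_def p_def q_def)
qed

lemma ball_point_herm: "c > 0 \<Longrightarrow> ball_point (c *\<^sub>R herm v) = v"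
  by (simp add: ball_point_def trace_def sum_2 vec_eq_iff forall_3 field_simps)

end

theory Submission
  imports Defs
begin

text \<open>
  Suppose that the surface of the plane \<open>P\<close> has trivial fundamental group. Then no nontrivial
  element of \<open>\<Gamma>\<close> preserves \<open>P\<close>, and the limit set \<open>\<Lambda>\<close>
  turns out to be disconnected. Incompressibility of the boundary, on the other hand, makes
  \<open>\<Lambda>\<close> connected.

  Connectedness of \<open>\<Lambda>\<close> (\<open>incompressible_imp_connected_limit_set\<close>): the
  cone over a loop in the domain of discontinuity is a disc in \<open>H3 \<union> \<Omega>\<close>. Its
  image can be deformed into the boundary, and the lift of the deformation shows that the loop is
  null-homotopic in \<open>\<Omega>\<close>. So the components of \<open>\<Omega>\<close> are simply
  connected, which forces the complement \<open>\<Lambda>\<close> to be connected.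

  Disconnectedness of \<open>\<Lambda>\<close> (\<open>limit_set_disconnected\<close>) uses the projective
  model, in which the hull \<open>X\<close> of \<open>\<Lambda>\<close> is a Euclidean convex hull. The
  orbit of \<open>P\<close> is closed in the interior of \<open>X\<close> and \<open>P\<close> has trivial
  stabilizer; by Baire's theorem a limit of different translates of \<open>P\<close> then never meets the
  interior of \<open>X\<close> (\<open>limit_plane_avoids_interior\<close>). Let a point \<open>p\<close> of
  the slice \<open>P \<inter> X\<close> tend to the sphere. By cocompactness elements of
  \<open>\<Gamma>\<close> bring \<open>p\<close> back to a fixed ball, and they move \<open>P\<close> to
  planes which accumulate only at planes with \<open>X\<close> on one side. So far out each point of the
  slice has a well-defined side of \<open>P\<close>, namely the one on which \<open>X\<close> lies
  essentially. The side is locally constant, hence constant near each point \<open>\<xi>\<close> of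
  \<open>\<Lambda>\<close> on the circle \<open>\<partial>P\<close>, because the slice is convex. If points
  \<open>\<eta>\<close> of \<open>\<Lambda>\<close> off the circle accumulate at \<open>\<xi>\<close>, they
  lie on that side (\<open>accumulation_on_same_side\<close>): take the point \<open>p\<close> of the slice
  nearest to \<open>\<eta>\<close> in the sense of horospheres, and bring it back. If \<open>X\<close> were
  on the other side, a chord of \<open>X\<close> from an interior point to the image of
  \<open>\<eta>\<close> would cross the plane arbitrarily near its end, that is, at points of the slice much
  nearer to \<open>\<eta>\<close> than \<open>p\<close>. Hence \<open>\<Lambda>\<close> is the disjoint
  union of two nonempty closed sets, each of which consists of the points of \<open>\<Lambda>\<close> on one
  side of \<open>P\<close> together with the points of \<open>\<Lambda>\<close> on the circle at which the
  slice has that side.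
\<close>

section \<open>The projective action on the closed ball\<close>

text \<open>The Hermitian matrix of a point is affine in the point, and an element of
  \<open>SL\<^sub>2(\<complex>)\<close> acts by a linear map followed by normalization. The weight is the
  normalizing factor.\<close>

definition SL2C_weight :: "complex^2^2 \<Rightarrow> real^3 \<Rightarrow> real" where
  "SL2C_weight A v = Re (trace (A ** herm v ** conj_transpose A)) / 2"

lemma matrix2_eq_iff:
  "A = B \<longleftrightarrow> A$1$1 = B$1$1 \<and> A$1$2 = B$1$2 \<and> A$2$1 = B$2$1 \<and> A$2$2 = B$2$2"
  for A B :: "complex^2^2"
  by (auto simp: vec_eq_iff forall_2)

lemma matrix2_mult_component: "(A ** B) $ i $ j = A$i$1 * B$1$j + A$i$2 * B$2$j"
  for A B :: "complex^2^2"
  by (simp add: matrix_matrix_mult_def sum_2)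

lemma conj_transpose_component [simp]: "conj_transpose A $ i $ j = cnj (A $ j $ i)"
  by (simp add: conj_transpose_def)

lemma conj_transpose_conj_transpose [simp]: "conj_transpose (conj_transpose A) = A"
  by (simp add: matrix2_eq_iff)

lemma conj_transpose_herm [simp]: "conj_transpose (herm v) = herm v"
  by (simp add: matrix2_eq_iff complex_eq_iff)

lemma herm_inj: "herm v = herm w \<longleftrightarrow> v = w"
proof
  assume "herm v = herm w"
  then have "herm v $ 1 $ 1 = herm w $ 1 $ 1" "herm v $ 1 $ 2 = herm w $ 1 $ 2" by simp_all
  then show "v = w" by (simp add: vec_eq_iff forall_3 complex_eq_iff)
qed simp

lemma herm_0 [simp]: "herm 0 = mat 1"
  by (simp add: matrix2_eq_iff mat_def complex_eq_iff)

lemma hermitian_eq_herm: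
  assumes "conj_transpose Y = Y" "Re (trace Y) \<noteq> 0"
  shows "Y = (Re (trace Y) / 2) *\<^sub>R herm (ball_point Y)"
proof -
  have c: "cnj (Y$1$1) = Y$1$1" "cnj (Y$2$2) = Y$2$2" "cnj (Y$1$2) = Y$2$1"
    using assms(1) unfolding matrix2_eq_iff by simp_all
  have im: "Im (Y$1$1) = 0" "Im (Y$2$2) = 0" "Re (Y$2$1) = Re (Y$1$2)" "Im (Y$2$1) = - Im (Y$1$2)"
    using c by (auto simp: complex_eq_iff)
  have t: "Re (Y$1$1) + Re (Y$2$2) \<noteq> 0"
    using assms(2) by (simp add: trace_def sum_2)
  show ?thesis
    using t unfolding matrix2_eq_iff
    by (simp add: ball_point_def trace_def sum_2 complex_eq_iff im field_simps)
qed

lemma trace_scaleR: "trace (c *\<^sub>R A) = c *\<^sub>R trace A" for A :: "complex^2^2"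
  by (simp add: trace_def sum_2 scaleR_add_right)

lemma ball_point_scaleR:
  assumes "c > 0"
  shows "ball_point (c *\<^sub>R Y) = ball_point Y"
proof -
  define V :: "real^3" where "V = vector [2 * Re (Y$1$2), 2 * Im (Y$1$2), Re (Y$1$1) - Re (Y$2$2)]"
  have "vector [2 * Re ((c *\<^sub>R Y)$1$2), 2 * Im ((c *\<^sub>R Y)$1$2), Re ((c *\<^sub>R Y)$1$1) - Re ((c *\<^sub>R Y)$2$2)] = c *\<^sub>R V"
    by (simp add: V_def vec_eq_iff forall_3 right_diff_distrib)
  then show ?thesis
    using assms by (simp add: ball_point_def V_def[symmetric] trace_scaleR)
qed

lemma sandwich_linear:
  "A ** (X + Y) ** B = A ** X ** B + A ** Y ** B" "A ** (X - Y) ** B = A ** X ** B - A ** Y ** B"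
  "A ** (c *\<^sub>R X) ** B = c *\<^sub>R (A ** X ** B)" for A B X Y :: "complex^2^2"
  by (simp_all add: matrix2_eq_iff matrix2_mult_component scaleR_add_right algebra_simps)

lemma hermitian_sandwich:
  "conj_transpose Y = Y \<Longrightarrow> conj_transpose (A ** Y ** conj_transpose A) = A ** Y ** conj_transpose A"
  by (simp add: conj_transpose_mult matrix_mul_assoc)

text \<open>The weight is half of \<open>S + v \<bullet> n\<close> for some \<open>S\<close> and
  \<open>n\<close>. This identity computes the length of \<open>n\<close>: it is less than \<open>S\<close>,
  so the weight is positive on the closed ball.\<close>

lemma lagrange_identity_complex:
  "(norm (a * cnj b + c * cnj d))\<^sup>2 =
     ((norm a)\<^sup>2 + (norm c)\<^sup>2) * ((norm b)\<^sup>2 + (norm d)\<^sup>2) - (norm (a * d - b * c))\<^sup>2"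
  unfolding cmod_power2 by (simp add: power2_eq_square algebra_simps)

lemma SL2C_weight_pos:
  assumes "det A = 1" "v \<in> cball 0 1"
  shows "SL2C_weight A v > 0"
proof -
  define a b c d where abcd: "a = A$1$1" "b = A$1$2" "c = A$2$1" "d = A$2$2"
  define n :: "real^3" where "n = vector [2 * Re (a * cnj b + c * cnj d), - 2 * Im (a * cnj b + c * cnj d),
     (norm a)\<^sup>2 + (norm c)\<^sup>2 - (norm b)\<^sup>2 - (norm d)\<^sup>2]"
  define S where "S = (norm a)\<^sup>2 + (norm b)\<^sup>2 + (norm c)\<^sup>2 + (norm d)\<^sup>2"
  have det: "a * d - b * c = 1" using assms(1) by (simp add: det_2 abcd)
  have w: "2 * SL2C_weight A v = S + v \<bullet> n"
    unfolding SL2C_weight_def trace_def sum_2 matrix2_mult_component abcd S_def n_def inner_vec_def sum_3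
    by (simp add: cmod_power2) (simp add: algebra_simps power2_eq_square)
  have "(norm n)\<^sup>2 = 4 * (norm (a * cnj b + c * cnj d))\<^sup>2 +
      ((norm a)\<^sup>2 + (norm c)\<^sup>2 - (norm b)\<^sup>2 - (norm d)\<^sup>2)\<^sup>2"
    unfolding norm_sq_3 n_def vector_3 cmod_power2[of "a * cnj b + c * cnj d"] by (simp only: power_mult_distrib power2_minus mult_minus_left) simp
  also have "\<dots> = S\<^sup>2 - 4"
    using lagrange_identity_complex[of a b c d] det unfolding S_def by (simp add: power2_eq_square algebra_simps)
  finally have "norm n < S"
    using power_mono[of S "norm n" 2] by (cases "S \<le> norm n") (auto simp: S_def)
  moreover have "\<bar>v \<bullet> n\<bar> \<le> norm n"
    using Cauchy_Schwarz_ineq2[of v n] assms(2) mult_right_mono[of "norm v" 1 "norm n"] by simp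
  ultimately show ?thesis using w by linarith
qed

lemma SL2C_act_herm:
  assumes "det A = 1" "v \<in> cball 0 1"
  shows "A ** herm v ** conj_transpose A = SL2C_weight A v *\<^sub>R herm (SL2C_act A v)"
proof -
  have "Re (trace (A ** herm v ** conj_transpose A)) \<noteq> 0"
    using SL2C_weight_pos[OF assms] by (simp add: SL2C_weight_def)
  then show ?thesis
    unfolding SL2C_weight_def SL2C_act_def
    by (intro hermitian_eq_herm hermitian_sandwich) auto
qed

text \<open>Polarization of the determinant: \<open>1 - v \<bullet> w\<close> is the Minkowski product of
  the matrices of \<open>v\<close> and \<open>w\<close>, which the action preserves up to the
  weights.\<close>

lemma det_herm_comb:
  "det (s *\<^sub>R herm v + t *\<^sub>R herm w) =
     of_real (s\<^sup>2 * (1 - (norm v)\<^sup>2) + t\<^sup>2 * (1 - (norm w)\<^sup>2) + 2 * s * t * (1 - v \<bullet> w))"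
  unfolding det_2 norm_sq_3 inner_vec_def sum_3
  by (simp add: complex_eq_iff power2_eq_square algebra_simps)

lemma SL2C_act_norm:
  assumes "det A = 1" "v \<in> cball 0 1"
  shows "(SL2C_weight A v)\<^sup>2 * (1 - (norm (SL2C_act A v))\<^sup>2) = 1 - (norm v)\<^sup>2"
proof -
  have "det (A ** herm v ** conj_transpose A) = of_real (1 - (norm v)\<^sup>2)"
    by (simp add: det_mul det_conj_transpose assms det_herm)
  moreover have "det (SL2C_weight A v *\<^sub>R herm (SL2C_act A v)) =
     of_real ((SL2C_weight A v)\<^sup>2 * (1 - (norm (SL2C_act A v))\<^sup>2))"
    using det_herm_comb[of "SL2C_weight A v" "SL2C_act A v" 0 0] by simp
  ultimately show ?thesis
    unfolding SL2C_act_herm[OF assms] by (metis of_real_eq_iff)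
qed

lemma SL2C_act_inner:
  assumes "det A = 1" "v \<in> cball 0 1" "w \<in> cball 0 1"
  shows "SL2C_weight A v * SL2C_weight A w * (1 - SL2C_act A v \<bullet> SL2C_act A w) = 1 - v \<bullet> w"
proof -
  define p q where "p = SL2C_weight A v" and "q = SL2C_weight A w"
  define v' w' where "v' = SL2C_act A v" and "w' = SL2C_act A w"
  have "A ** (1 *\<^sub>R herm v + 1 *\<^sub>R herm w) ** conj_transpose A = p *\<^sub>R herm v' + q *\<^sub>R herm w'"
    using SL2C_act_herm[OF assms(1,2)] SL2C_act_herm[OF assms(1,3)]
    by (simp add: sandwich_linear p_def q_def v'_def w'_def)
  then have "det (p *\<^sub>R herm v' + q *\<^sub>R herm w') = det (1 *\<^sub>R herm v + 1 *\<^sub>R herm w)"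
    by (metis assms(1) complex_cnj_one det_conj_transpose det_mul mult.commute mult.left_neutral)
  then have "p\<^sup>2 * (1 - (norm v')\<^sup>2) + q\<^sup>2 * (1 - (norm w')\<^sup>2) + 2 * p * q * (1 - v' \<bullet> w') =
     (1 - (norm v)\<^sup>2) + (1 - (norm w)\<^sup>2) + 2 * (1 - v \<bullet> w)"
    unfolding det_herm_comb of_real_eq_iff by simp
  moreover have "p\<^sup>2 * (1 - (norm v')\<^sup>2) = 1 - (norm v)\<^sup>2" "q\<^sup>2 * (1 - (norm w')\<^sup>2) = 1 - (norm w)\<^sup>2"
    using SL2C_act_norm[OF assms(1,2)] SL2C_act_norm[OF assms(1,3)]
    by (simp_all add: p_def q_def v'_def w'_def)
  ultimately show ?thesis
    by (simp add: p_def q_def v'_def w'_def)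
qed

lemma SL2C_act_mult:
  assumes "det B = 1" "v \<in> cball 0 1"
  shows "SL2C_act (A ** B) v = SL2C_act A (SL2C_act B v)"
proof -
  have "(A ** B) ** herm v ** conj_transpose (A ** B) = A ** (B ** herm v ** conj_transpose B) ** conj_transpose A"
    by (simp add: conj_transpose_mult matrix_mul_assoc)
  also have "\<dots> = SL2C_weight B v *\<^sub>R (A ** herm (SL2C_act B v) ** conj_transpose A)"
    unfolding SL2C_act_herm[OF assms] by (simp add: sandwich_linear)
  finally show ?thesis
    unfolding SL2C_act_def[of "A ** B"] SL2C_act_def[of A]
    by (simp only: ball_point_scaleR[OF SL2C_weight_pos[OF assms]])
qed

lemma conj_transpose_mat_1 [simp]: "conj_transpose (mat 1) = mat 1"
  by (simp add: matrix2_eq_iff mat_def)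

lemma SL2C_act_1: "SL2C_act (mat 1) v = v"
  using ball_point_herm[of 1 v] by (simp add: SL2C_act_def)

lemma herm_affine: "herm ((1 - t) *\<^sub>R u + t *\<^sub>R v) = (1 - t) *\<^sub>R herm u + t *\<^sub>R herm v"
  by (simp add: matrix2_eq_iff complex_eq_iff algebra_simps)

lemma SL2C_act_segment:
  assumes A: "det A = 1" and u: "u \<in> cball 0 1" and v: "v \<in> cball 0 1" and t: "0 \<le> t" "t \<le> 1"
  obtains s where "0 \<le> s" "s \<le> 1"
    "SL2C_act A ((1 - t) *\<^sub>R u + t *\<^sub>R v) = (1 - s) *\<^sub>R SL2C_act A u + s *\<^sub>R SL2C_act A v"
proof -
  define w where "w = (1 - t) *\<^sub>R u + t *\<^sub>R v"
  have w: "w \<in> cball 0 1"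
    unfolding w_def using u v t convexD_alt[OF convex_cball] by blast
  define cu cv cw where c: "cu = SL2C_weight A u" "cv = SL2C_weight A v" "cw = SL2C_weight A w"
  have pos: "cu > 0" "cv > 0" "cw > 0" using SL2C_weight_pos A u v w by (auto simp: c)
  have e: "A ** herm w ** conj_transpose A = (1 - t) *\<^sub>R (A ** herm u ** conj_transpose A) + t *\<^sub>R (A ** herm v ** conj_transpose A)"
    unfolding w_def herm_affine
    by (simp add: sandwich_linear)
  have cw: "cw = (1 - t) * cu + t * cv"
    unfolding c SL2C_weight_def e
    by (simp add: trace_def sum_2 field_simps)
  define s where "s = t * cv / cw"
  have s: "0 \<le> s" "s \<le> 1" using pos t by (auto simp: s_def cw divide_simps)
  have s': "1 - s = (1 - t) * cu / cw" using pos by (simp add: s_def cw divide_simps)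
  have "cw *\<^sub>R herm (SL2C_act A w) = ((1 - t) * cu) *\<^sub>R herm (SL2C_act A u) + (t * cv) *\<^sub>R herm (SL2C_act A v)"
    using e SL2C_act_herm[OF A w] SL2C_act_herm[OF A u] SL2C_act_herm[OF A v] by (simp add: c)
  then have "herm (SL2C_act A w) = (1 / cw) *\<^sub>R (((1 - t) * cu) *\<^sub>R herm (SL2C_act A u) + (t * cv) *\<^sub>R herm (SL2C_act A v))"
    using pos by (metis divide_self_if less_numeral_extra(3) real_vector.scale_scale scaleR_one times_divide_eq_left mult_1)
  also have "\<dots> = (1 - s) *\<^sub>R herm (SL2C_act A u) + s *\<^sub>R herm (SL2C_act A v)"
    unfolding s' by (simp add: s_def scaleR_add_right)
  finally have "SL2C_act A w = (1 - s) *\<^sub>R SL2C_act A u + s *\<^sub>R SL2C_act A v"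
    unfolding herm_affine[symmetric] herm_inj .
  then show ?thesis using that s by (simp add: w_def)
qed

text \<open>Times the weight, the image point is affine in the point. So the action maps planes to planes
  and keeps their sides.\<close>

lemma SL2C_pullback_affine:
  assumes A: "det A = 1"
  shows "\<exists>a' b'. \<forall>w\<in>cball 0 1. a' \<bullet> w + b' = SL2C_weight A w * (a \<bullet> SL2C_act A w + b)"
proof -
  define \<psi> :: "complex^2^2 \<Rightarrow> real" where
    "\<psi> Y = a$1 * Re (Y$1$2) + a$2 * Im (Y$1$2) + a$3 / 2 * (Re (Y$1$1) - Re (Y$2$2)) + b / 2 * Re (trace Y)" for Y
  define f where "f w = \<psi> (A ** (herm w - mat 1) ** conj_transpose A)" for w
  have psi: "\<psi> (X + Y) = \<psi> X + \<psi> Y" "\<psi> (r *\<^sub>R X) = r * \<psi> X" for X Y r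
    by (simp_all add: \<psi>_def trace_def sum_2 algebra_simps add_divide_distrib)
  have hl: "herm (u + w) - mat 1 = (herm u - mat 1) + (herm w - mat 1)"
    "herm (r *\<^sub>R u) - mat 1 = r *\<^sub>R (herm u - mat 1)" for u w r
    by (simp_all add: matrix2_eq_iff mat_def complex_eq_iff algebra_simps)
  have "linear f"
    unfolding f_def
    by (rule linearI)
       (simp_all only: hl sandwich_linear psi real_scaleR_def)
  then obtain a' where a': "f w = a' \<bullet> w" for w
    by (metis inner_commute linear_conv_bounded_linear real_inner_1_left adjoint_works inner_real_def mult_1)
  have "a' \<bullet> w + \<psi> (A ** conj_transpose A) = SL2C_weight A w * (a \<bullet> SL2C_act A w + b)"
    if w: "w \<in> cball 0 1" for w
  proof -
    have "a' \<bullet> w + \<psi> (A ** conj_transpose A) = \<psi> (A ** herm w ** conj_transpose A)"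
      unfolding a'[symmetric] f_def psi(1)[symmetric]
      by (simp add: sandwich_linear)
    also have "\<dots> = SL2C_weight A w * \<psi> (herm (SL2C_act A w))"
      unfolding SL2C_act_herm[OF A w] psi ..
    also have "\<psi> (herm (SL2C_act A w)) = a \<bullet> SL2C_act A w + b"
      by (simp add: \<psi>_def trace_def sum_2 inner_vec_def sum_3)
    finally show ?thesis .
  qed
  then show ?thesis by blast
qed

lemma tendsto_matrix2:
  assumes "\<And>i j. ((\<lambda>x. f x $ i $ j) \<longlongrightarrow> l $ i $ j) F"
  shows "(f \<longlongrightarrow> (l :: complex^2^2)) F"
  using assms by (intro vec_tendstoI)

lemma tendsto_matrix_mult:
  fixes A B :: "complex^2^2"
  shows "(f \<longlongrightarrow> A) F \<Longrightarrow> (g \<longlongrightarrow> B) F \<Longrightarrow> ((\<lambda>x. f x ** g x) \<longlongrightarrow> A ** B) F"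
  by (rule tendsto_matrix2)
     (simp only: matrix2_mult_component, intro tendsto_add tendsto_mult tendsto_vec_nth, assumption+)

lemma tendsto_conj_transpose: "(f \<longlongrightarrow> A) F \<Longrightarrow> ((\<lambda>x. conj_transpose (f x)) \<longlongrightarrow> conj_transpose A) F"
  by (rule tendsto_matrix2) (auto intro!: tendsto_cnj tendsto_vec_nth)

lemma tendsto_herm:
  assumes "(f \<longlongrightarrow> v) F" shows "((\<lambda>x. herm (f x)) \<longlongrightarrow> herm v) F"
proof (rule tendsto_matrix2)
  have c: "((\<lambda>x. f x $ i) \<longlongrightarrow> v $ i) F" for i using assms by (rule tendsto_vec_nth)
  have "\<forall>i j. ((\<lambda>x. herm (f x) $ i $ j) \<longlongrightarrow> herm v $ i $ j) F"
    unfolding forall_2 herm_component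
    by (intro conjI tendsto_Complex tendsto_of_real tendsto_add tendsto_diff tendsto_minus tendsto_const c)
  then show "((\<lambda>x. herm (f x) $ i $ j) \<longlongrightarrow> herm v $ i $ j) F" for i j by blast
qed

lemma tendsto_ball_point:
  assumes "(f \<longlongrightarrow> Y) F" "Re (trace Y) \<noteq> 0"
  shows "((\<lambda>x. ball_point (f x)) \<longlongrightarrow> ball_point Y) F"
proof -
  have c: "((\<lambda>x. f x $ i $ j) \<longlongrightarrow> Y $ i $ j) F" for i j
    using assms by (intro tendsto_vec_nth)
  have t: "Re (Y$1$1) + Re (Y$2$2) \<noteq> 0" using assms(2) by (simp add: trace_def sum_2)
  have "((\<lambda>x. vector [2 * Re (f x$1$2), 2 * Im (f x$1$2), Re (f x$1$1) - Re (f x$2$2)] :: real^3) \<longlongrightarrow>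
      vector [2 * Re (Y$1$2), 2 * Im (Y$1$2), Re (Y$1$1) - Re (Y$2$2)]) F"
    (is "(?V \<longlongrightarrow> ?W) F")
  proof (rule vec_tendstoI)
    have "\<forall>i. ((\<lambda>x. ?V x $ i) \<longlongrightarrow> ?W $ i) F"
      unfolding forall_3 vector_3 by (intro conjI tendsto_intros c)
    then show "((\<lambda>x. ?V x $ i) \<longlongrightarrow> ?W $ i) F" for i by blast
  qed
  moreover have "((\<lambda>x. 1 / Re (trace (f x))) \<longlongrightarrow> 1 / Re (trace Y)) F"
    unfolding trace_def sum_2 using t by (intro tendsto_intros c) auto
  ultimately show ?thesis unfolding ball_point_def by (intro tendsto_scaleR)
qed

lemma tendsto_SL2C_act:
  assumes "(f \<longlongrightarrow> A) F" "(g \<longlongrightarrow> v) F" "Re (trace (A ** herm v ** conj_transpose A)) \<noteq> 0"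
  shows "((\<lambda>x. SL2C_act (f x) (g x)) \<longlongrightarrow> SL2C_act A v) F"
  unfolding SL2C_act_def
  by (intro tendsto_ball_point tendsto_matrix_mult tendsto_conj_transpose tendsto_herm assms)

lemma SL2C_act_continuous:
  assumes "det A = 1" shows "continuous_on (cball 0 1) (SL2C_act A)"
proof -
  have "Re (trace (A ** herm v ** conj_transpose A)) \<noteq> 0" if "v \<in> cball 0 1" for v
    using SL2C_weight_pos[OF assms that] by (simp add: SL2C_weight_def)
  then show ?thesis
    unfolding continuous_on by (intro ballI tendsto_SL2C_act tendsto_const tendsto_ident_at)
qed

lemma carrier_PSL2C: "carrier PSL2C = to_PSL2C ` {A. det A = 1}"
  by (auto simp: PSL2C_def FactGroup_def RCOSETS_def to_PSL2C_def SL2C_def)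

lemma to_PSL2C_mult:
  assumes "det A = 1" "det B = 1"
  shows "to_PSL2C A \<otimes>\<^bsub>PSL2C\<^esub> to_PSL2C B = to_PSL2C (A ** B)"
  using normal.rcos_sum[OF pm_one_normal, of A B] assms
  by (simp add: PSL2C_def FactGroup_def to_PSL2C_def SL2C_def)

lemma one_PSL2C: "\<one>\<^bsub>PSL2C\<^esub> = to_PSL2C (mat 1)"
  by (auto simp: PSL2C_def FactGroup_def to_PSL2C_eq pm_one_def)

definition representative :: "(complex^2^2) set \<Rightarrow> complex^2^2" where
  "representative g = (SOME A. det A = 1 \<and> to_PSL2C A = g)"

lemma representative:
  assumes "g \<in> carrier PSL2C"
  shows "det (representative g) = 1" "to_PSL2C (representative g) = g"
proof -
  have "\<exists>A. det A = 1 \<and> to_PSL2C A = g" using assms by (auto simp: carrier_PSL2C)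
  then show "det (representative g) = 1" "to_PSL2C (representative g) = g"
    unfolding representative_def by (metis (mono_tags, lifting) someI_ex)+
qed

lemma act_representative: "g \<in> carrier PSL2C \<Longrightarrow> act g v = SL2C_act (representative g) v"
  using act_to_PSL2C representative(2) by metis

definition weight :: "(complex^2^2) set \<Rightarrow> real^3 \<Rightarrow> real" where
  "weight g v = SL2C_weight (representative g) v"

lemma weight_pos: "g \<in> carrier PSL2C \<Longrightarrow> v \<in> cball 0 1 \<Longrightarrow> weight g v > 0"
  by (simp add: weight_def SL2C_weight_pos representative)

lemma act_mult:
  assumes "g \<in> carrier PSL2C" "h \<in> carrier PSL2C" "v \<in> cball 0 1"
  shows "act (g \<otimes>\<^bsub>PSL2C\<^esub> h) v = act g (act h v)"
proof -
  have "g \<otimes>\<^bsub>PSL2C\<^esub> h = to_PSL2C (representative g ** representative h)"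
    using to_PSL2C_mult[of "representative g" "representative h"] representative assms by simp
  then show ?thesis
    using assms by (simp add: act_to_PSL2C SL2C_act_mult representative act_representative)
qed

lemma act_one: "act \<one>\<^bsub>PSL2C\<^esub> v = v"
  by (simp add: one_PSL2C act_to_PSL2C SL2C_act_1)

lemma act_norm:
  assumes "g \<in> carrier PSL2C" "v \<in> cball 0 1"
  shows "(weight g v)\<^sup>2 * (1 - (norm (act g v))\<^sup>2) = 1 - (norm v)\<^sup>2"
  using assms by (simp add: weight_def act_representative SL2C_act_norm representative)

lemma act_inner:
  assumes "g \<in> carrier PSL2C" "v \<in> cball 0 1" "w \<in> cball 0 1"
  shows "weight g v * weight g w * (1 - act g v \<bullet> act g w) = 1 - v \<bullet> w"
  using assms by (simp add: weight_def act_representative SL2C_act_inner representative)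

lemma norm_act_less_1_iff:
  assumes "g \<in> carrier PSL2C" "v \<in> cball 0 1"
  shows "norm (act g v) < 1 \<longleftrightarrow> norm v < 1"
proof -
  have "norm (act g v) < 1 \<longleftrightarrow> (norm (act g v))\<^sup>2 < 1" by (simp add: power_less_one_iff)
  also have "\<dots> \<longleftrightarrow> 0 < (weight g v)\<^sup>2 * (1 - (norm (act g v))\<^sup>2)"
    using weight_pos[OF assms] by (simp add: zero_less_mult_iff)
  also have "\<dots> \<longleftrightarrow> (norm v)\<^sup>2 < 1" unfolding act_norm[OF assms] by simp
  finally show ?thesis by (simp add: power_less_one_iff)
qed

lemma norm_act_eq_1_iff:
  assumes "g \<in> carrier PSL2C" "v \<in> cball 0 1"
  shows "norm (act g v) = 1 \<longleftrightarrow> norm v = 1"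
proof -
  have sq: "norm u = 1 \<longleftrightarrow> (norm u)\<^sup>2 = 1" for u :: "real^3"
    using norm_ge_zero[of u] unfolding power2_eq_1_iff by linarith
  then have "norm (act g v) = 1 \<longleftrightarrow> (norm (act g v))\<^sup>2 = 1" .
  also have "\<dots> \<longleftrightarrow> (weight g v)\<^sup>2 * (1 - (norm (act g v))\<^sup>2) = 0"
    using weight_pos[OF assms] by simp
  also have "\<dots> \<longleftrightarrow> (norm v)\<^sup>2 = 1" unfolding act_norm[OF assms] by simp
  finally show ?thesis by (simp add: sq)
qed

lemma act_cball:
  assumes "g \<in> carrier PSL2C" "v \<in> cball 0 1" shows "act g v \<in> cball 0 1"
proof -
  have "norm v < 1 \<or> norm v = 1" using assms by auto
  then show ?thesis
    using norm_act_less_1_iff[OF assms] norm_act_eq_1_iff[OF assms] by auto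
qed

lemma act_H3: "g \<in> carrier PSL2C \<Longrightarrow> v \<in> H3 \<Longrightarrow> act g v \<in> H3"
  using norm_act_less_1_iff[of g v] by simp

lemma act_S2: "g \<in> carrier PSL2C \<Longrightarrow> v \<in> S2 \<Longrightarrow> act g v \<in> S2"
  using norm_act_eq_1_iff[of g v] by simp

lemma act_inv:
  assumes "g \<in> carrier PSL2C" "v \<in> cball 0 1"
  shows "act (inv\<^bsub>PSL2C\<^esub> g) (act g v) = v" "act g (act (inv\<^bsub>PSL2C\<^esub> g) v) = v"
proof -
  interpret group PSL2C by (rule PSL2C_group)
  have i: "inv\<^bsub>PSL2C\<^esub> g \<in> carrier PSL2C" using assms(1) by (rule inv_closed)
  show "act (inv\<^bsub>PSL2C\<^esub> g) (act g v) = v"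
    unfolding act_mult[OF i assms, symmetric] l_inv[OF assms(1)] by (rule act_one)
  show "act g (act (inv\<^bsub>PSL2C\<^esub> g) v) = v"
    unfolding act_mult[OF assms(1) i assms(2), symmetric] r_inv[OF assms(1)] by (rule act_one)
qed

lemma act_continuous:
  assumes "g \<in> carrier PSL2C" shows "continuous_on (cball 0 1) (act g)"
proof -
  have "act g = SL2C_act (representative g)" using act_representative[OF assms] by (rule ext)
  then show ?thesis using SL2C_act_continuous[OF representative(1)[OF assms]] by simp
qed

lemma act_segment:
  assumes "g \<in> carrier PSL2C" "u \<in> cball 0 1" "v \<in> cball 0 1" "w \<in> closed_segment u v"
  shows "act g w \<in> closed_segment (act g u) (act g v)"
proof -
  obtain t where t: "0 \<le> t" "t \<le> 1" "w = (1 - t) *\<^sub>R u + t *\<^sub>R v"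
    using assms(4) by (auto simp: in_segment)
  obtain s where "0 \<le> s" "s \<le> 1" "SL2C_act (representative g) ((1 - t) *\<^sub>R u + t *\<^sub>R v) =
      (1 - s) *\<^sub>R SL2C_act (representative g) u + s *\<^sub>R SL2C_act (representative g) v"
    using SL2C_act_segment[OF representative(1)[OF assms(1)] assms(2,3) t(1,2)] by blast
  then show ?thesis
    unfolding act_representative[OF assms(1)] t(3) in_segment by blast
qed

lemma act_pullback_affine:
  assumes "g \<in> carrier PSL2C"
  shows "\<exists>a' b'. \<forall>w\<in>cball 0 1. a' \<bullet> w + b' = weight g w * (a \<bullet> act g w + b)"
  unfolding weight_def act_representative[OF assms]
  by (rule SL2C_pullback_affine[OF representative(1)[OF assms]])

section \<open>Convergence dynamics of a Kleinian group\<close>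

definition adjugate :: "complex^2^2 \<Rightarrow> complex^2^2" where
  "adjugate A = vector [vector [A$2$2, - A$1$2], vector [- A$2$1, A$1$1]]"

lemma adjugate_component [simp]:
  "adjugate A $ 1 $ 1 = A$2$2" "adjugate A $ 1 $ 2 = - A$1$2" "adjugate A $ 2 $ 1 = - A$2$1" "adjugate A $ 2 $ 2 = A$1$1"
  by (simp_all add: adjugate_def)

lemma det_adjugate [simp]: "det (adjugate A) = det A"
  by (simp add: det_2)

lemma adjugate_mult:
  assumes "det A = 1" shows "A ** adjugate A = mat 1" "adjugate A ** A = mat 1"
  using assms by (simp_all add: matrix2_eq_iff matrix2_mult_component mat_def det_2 algebra_simps)

lemma tendsto_adjugate: "(f \<longlongrightarrow> A) F \<Longrightarrow> ((\<lambda>x. adjugate (f x)) \<longlongrightarrow> adjugate A) F"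
proof (rule tendsto_matrix2)
  assume "(f \<longlongrightarrow> A) F"
  then have "\<forall>i j. ((\<lambda>x. adjugate (f x) $ i $ j) \<longlongrightarrow> adjugate A $ i $ j) F"
    unfolding forall_2 adjugate_component by (intro conjI tendsto_minus tendsto_vec_nth)
  then show "((\<lambda>x. adjugate (f x) $ i $ j) \<longlongrightarrow> adjugate A $ i $ j) F" for i j by blast
qed

lemma tendsto_det2:
  fixes A :: "complex^2^2"
  shows "(f \<longlongrightarrow> A) F \<Longrightarrow> ((\<lambda>x. det (f x)) \<longlongrightarrow> det A) F"
  unfolding det_2 by (intro tendsto_intros tendsto_vec_nth)

lemma inv_to_PSL2C:
  assumes "det A = 1" shows "inv\<^bsub>PSL2C\<^esub> (to_PSL2C A) = to_PSL2C (adjugate A)"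
proof -
  interpret group PSL2C by (rule PSL2C_group)
  show ?thesis
    by (rule inv_equality) (use assms in \<open>simp_all add: to_PSL2C_mult adjugate_mult one_PSL2C carrier_PSL2C\<close>)
qed

lemma norm_ball_point_singular:
  assumes "conj_transpose Y = Y" "Re (trace Y) \<noteq> 0" "det Y = 0"
  shows "norm (ball_point Y) = 1"
proof -
  define c where "c = Re (trace Y) / 2"
  have "det (c *\<^sub>R herm (ball_point Y)) = of_real (c\<^sup>2 * (1 - (norm (ball_point Y))\<^sup>2))"
    using det_herm_comb[of c "ball_point Y" 0 0] by simp
  then have "c\<^sup>2 * (1 - (norm (ball_point Y))\<^sup>2) = 0"
    using hermitian_eq_herm[OF assms(1,2)] assms(3) unfolding c_def by (metis of_real_eq_0_iff)
  then have "(norm (ball_point Y))\<^sup>2 = 1" using assms(2) by (simp add: c_def)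
  then show ?thesis using norm_ge_zero[of "ball_point Y"] unfolding power2_eq_1_iff by linarith
qed

lemma SL2C_act_scaleR: "c \<noteq> 0 \<Longrightarrow> SL2C_act (c *\<^sub>R A) v = SL2C_act A v"
proof -
  assume "c \<noteq> 0"
  have "(c *\<^sub>R A) ** herm v ** conj_transpose (c *\<^sub>R A) = c\<^sup>2 *\<^sub>R (A ** herm v ** conj_transpose A)"
    by (simp add: matrix2_eq_iff matrix2_mult_component power2_eq_square scaleR_add_right algebra_simps)
  then show ?thesis
    unfolding SL2C_act_def using ball_point_scaleR[of "c\<^sup>2"] \<open>c \<noteq> 0\<close> by simp
qed

lemma singular_matrix2_rank_one:
  fixes B :: "complex^2^2"
  assumes "det B = 0" "B \<noteq> 0"
  obtains \<alpha> w :: "2 \<Rightarrow> complex" where "\<And>i j. B $ i $ j = \<alpha> i * w j" "\<alpha> 1 \<noteq> 0 \<or> \<alpha> 2 \<noteq> 0" "w 1 \<noteq> 0 \<or> w 2 \<noteq> 0"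
proof -
  have d: "B$1$1 * B$2$2 = B$1$2 * B$2$1" using assms(1) by (simp add: det_2)
  have nz: "B$1$1 \<noteq> 0 \<or> B$1$2 \<noteq> 0 \<or> B$2$1 \<noteq> 0 \<or> B$2$2 \<noteq> 0"
    using assms(2) by (auto simp: matrix2_eq_iff)
  have "\<exists>\<alpha> w :: 2 \<Rightarrow> complex. \<forall>i j. B $ i $ j = \<alpha> i * w j"
  proof (cases "B$1$1 = 0 \<and> B$1$2 = 0")
    case True
    define \<alpha> :: "2 \<Rightarrow> complex" where "\<alpha> i = (if i = 1 then 0 else 1)" for i
    define w where "w j = B $ 2 $ j" for j
    have "\<forall>i j. B $ i $ j = \<alpha> i * w j"
      using True by (simp add: forall_2 \<alpha>_def w_def)
    then show ?thesis by blast
  next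
    case False
    define \<alpha> where
      "\<alpha> i = (if i = 1 then 1 else if B$1$1 = 0 then B$2$2 / B$1$2 else B$2$1 / B$1$1)" for i :: 2
    define w where "w j = B $ 1 $ j" for j
    have "\<forall>i j. B $ i $ j = \<alpha> i * w j"
      using False d by (auto simp: forall_2 \<alpha>_def w_def field_simps)
    then show ?thesis by blast
  qed
  then obtain \<alpha> w :: "2 \<Rightarrow> complex" where *: "\<And>i j. B $ i $ j = \<alpha> i * w j" by blast
  show ?thesis by (rule that[OF *]) (use nz * in auto)
qed

text \<open>Such a matrix has rank one, \<open>B = \<alpha> w\<^sup>T\<close>, so \<open>B herm v
  B\<^sup>*\<close> is a multiple of \<open>\<alpha> \<alpha>\<^sup>*\<close> and its action is constant.
  The multiple vanishes only at the point \<open>b\<close> of the sphere given by the kernel of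
  \<open>B\<close>, which is the image of the adjugate.\<close>

lemma singular_SL2C_act:
  fixes B :: "complex^2^2"
  assumes "det B = 0" "B \<noteq> 0"
  defines "a \<equiv> SL2C_act B 0" and "b \<equiv> SL2C_act (adjugate B) 0"
  shows "norm a = 1" "norm b = 1" "Re (trace (B ** conj_transpose B)) > 0"
    "Re (trace (adjugate B ** conj_transpose (adjugate B))) > 0"
    "\<And>v. v \<in> cball 0 1 \<Longrightarrow> v \<noteq> b \<Longrightarrow> Re (trace (B ** herm v ** conj_transpose B)) > 0 \<and> SL2C_act B v = a"
proof -
  obtain \<alpha> w :: "2 \<Rightarrow> complex" where B: "\<And>i j. B $ i $ j = \<alpha> i * w j"
    and \<alpha>: "\<alpha> 1 \<noteq> 0 \<or> \<alpha> 2 \<noteq> 0" and w: "w 1 \<noteq> 0 \<or> w 2 \<noteq> 0"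
    using singular_matrix2_rank_one[OF assms(1,2)] by blast
  define n where "n = (norm (\<alpha> 1))\<^sup>2 + (norm (\<alpha> 2))\<^sup>2"
  define m where "m = (norm (w 1))\<^sup>2 + (norm (w 2))\<^sup>2"
  have n: "n > 0" and m: "m > 0"
    using \<alpha> w by (auto simp: n_def m_def add_pos_nonneg add_nonneg_pos)
  define B0 :: "complex^2^2" where "B0 = (\<chi> i j. \<alpha> i * cnj (\<alpha> j))"
  define W :: "complex^2^2" where
    "W = vector [vector [w 2 * cnj (w 2), - w 2 * cnj (w 1)], vector [- w 1 * cnj (w 2), w 1 * cnj (w 1)]]"
  have BB: "B ** conj_transpose B = m *\<^sub>R B0"
    unfolding matrix2_eq_iff matrix2_mult_component vector_scaleR_component scaleR_conv_of_real[where 'a = complex]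
    by (simp add: B B0_def m_def complex_norm_square algebra_simps del: of_real_power)
  have AA: "adjugate B ** conj_transpose (adjugate B) = n *\<^sub>R W"
    unfolding matrix2_eq_iff matrix2_mult_component vector_scaleR_component scaleR_conv_of_real[where 'a = complex]
    by (simp add: B W_def n_def complex_norm_square algebra_simps del: of_real_power)
  have trB0: "trace B0 = of_real n" and trW: "trace W = of_real m"
    by (simp_all add: trace_def sum_2 B0_def W_def n_def m_def complex_norm_square del: of_real_power)
  have a: "a = ball_point B0"
    using ball_point_scaleR[OF m, of B0] by (simp add: a_def SL2C_act_def BB)
  have b: "b = ball_point W"
    using ball_point_scaleR[OF n, of W] by (simp add: b_def SL2C_act_def AA)
  show "norm a = 1"
    unfolding a
  proof (rule norm_ball_point_singular)
    show "conj_transpose B0 = B0" "det B0 = 0" by (auto simp: matrix2_eq_iff B0_def det_2)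
    show "Re (trace B0) \<noteq> 0" using n by (simp add: trB0)
  qed
  show nb: "norm b = 1"
    unfolding b
  proof (rule norm_ball_point_singular)
    show "conj_transpose W = W" "det W = 0" by (auto simp: matrix2_eq_iff W_def det_2)
    show "Re (trace W) \<noteq> 0" using m by (simp add: trW)
  qed
  show "Re (trace (B ** conj_transpose B)) > 0" "Re (trace (adjugate B ** conj_transpose (adjugate B))) > 0"
    using m n by (simp_all add: BB AA trace_scaleR trB0 trW)
  fix v :: "real^3" assume v: "v \<in> cball 0 1" "v \<noteq> b"
  have bc: "b $ 1 = - 2 * Re (w 1 * cnj (w 2)) / m" "b $ 2 = 2 * Im (w 1 * cnj (w 2)) / m"
    "b $ 3 = ((norm (w 2))\<^sup>2 - (norm (w 1))\<^sup>2) / m"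
    unfolding b ball_point_def trW cmod_power2 by (simp_all add: W_def power2_eq_square add_divide_distrib diff_divide_distrib algebra_simps)
  have bv: "m * (1 - b \<bullet> v) = (norm (w 1))\<^sup>2 * (1 + v$3) + (norm (w 2))\<^sup>2 * (1 - v$3)
     + 2 * (Re (w 1 * cnj (w 2)) * v$1 - Im (w 1 * cnj (w 2)) * v$2)"
  proof -
    have "m * (b \<bullet> v) = - 2 * Re (w 1 * cnj (w 2)) * v$1 + 2 * Im (w 1 * cnj (w 2)) * v$2 + ((norm (w 2))\<^sup>2 - (norm (w 1))\<^sup>2) * v$3"
      unfolding inner_vec_def sum_3 bc inner_real_def using m by (simp add: distrib_left)
    then show ?thesis by (simp add: right_diff_distrib m_def algebra_simps)
  qed
  define q where "q = m * (1 - b \<bullet> v)"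
  have qc: "complex_of_real q = w 1 * cnj (w 1) * (1 + of_real (v$3)) + w 2 * cnj (w 2) * (1 - of_real (v$3))
     + w 1 * cnj (w 2) * Complex (v$1) (v$2) + w 2 * cnj (w 1) * Complex (v$1) (- v$2)"
    unfolding q_def bv cmod_power2 by (simp add: complex_eq_iff power2_eq_square algebra_simps)
  have BH: "B ** herm v ** conj_transpose B = q *\<^sub>R B0"
    unfolding matrix2_eq_iff matrix2_mult_component vector_scaleR_component scaleR_conv_of_real[where 'a = complex] qc
    by (simp add: B B0_def) (simp add: algebra_simps)
  have "0 < (norm (v - b))\<^sup>2" using v by simp
  also have "(norm (v - b))\<^sup>2 = (norm v)\<^sup>2 - 2 * (b \<bullet> v) + (norm b)\<^sup>2"
    unfolding power2_norm_eq_inner by (simp add: inner_diff_left inner_diff_right inner_commute[of v b])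
  also have "\<dots> \<le> 2 - 2 * (b \<bullet> v)"
    using v nb power_le_one[of "norm v" 2] by simp
  finally have q: "q > 0" using m by (simp add: q_def)
  show "Re (trace (B ** herm v ** conj_transpose B)) > 0 \<and> SL2C_act B v = a"
    using q n ball_point_scaleR[OF q, of B0] by (simp add: BH trace_scaleR trB0 a SL2C_act_def)
qed

locale kleinian_group =
  fixes \<Gamma> :: "(complex^2^2) set set"
  assumes kleinian: "torsion_free_discrete_subgroup \<Gamma>"
begin

lemma subgroup: "subgroup \<Gamma> PSL2C"
  using kleinian by (simp add: torsion_free_discrete_subgroup_def)

lemma in_PSL2C: "g \<in> \<Gamma> \<Longrightarrow> g \<in> carrier PSL2C"
  using subgroup by (rule subgroup.mem_carrier)

lemma one_mem: "\<one>\<^bsub>PSL2C\<^esub> \<in> \<Gamma>"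
  using subgroup by (rule subgroup.one_closed)

lemma mult_mem: "g \<in> \<Gamma> \<Longrightarrow> h \<in> \<Gamma> \<Longrightarrow> g \<otimes>\<^bsub>PSL2C\<^esub> h \<in> \<Gamma>"
  using subgroup by (rule subgroup.m_closed)

lemma inv_mem: "g \<in> \<Gamma> \<Longrightarrow> inv\<^bsub>PSL2C\<^esub> g \<in> \<Gamma>"
  using subgroup by (rule subgroup.m_inv_closed)

text \<open>Infinitely many bounded matrices would have a convergent sequence of distinct elements, and the
  quotients of successive terms would tend to the identity, contrary to discreteness.\<close>

lemma finite_bounded_representatives:
  "finite {g \<in> \<Gamma>. norm (representative g) \<le> M}"
proof (rule ccontr)
  interpret group PSL2C by (rule PSL2C_group)
  assume "infinite {g \<in> \<Gamma>. norm (representative g) \<le> M}"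
  then obtain g :: "nat \<Rightarrow> (complex^2^2) set" where g: "inj g" "range g \<subseteq> {g \<in> \<Gamma>. norm (representative g) \<le> M}"
    using infinite_countable_subset by blast
  have gG: "g n \<in> \<Gamma>" for n using g by auto
  have "representative (g n) \<in> cball 0 M" for n using g by auto
  then obtain A k where k: "strict_mono (k :: nat \<Rightarrow> nat)" and A: "((\<lambda>n. representative (g n)) \<circ> k) \<longlonglongrightarrow> A"
    using compact_cball unfolding compact_def by metis
  define C where "C n = representative (g (k n))" for n
  have C: "C \<longlonglongrightarrow> A" using A by (simp add: C_def[abs_def] comp_def)
  have dC: "det (C n) = 1" "to_PSL2C (C n) = g (k n)" for n
    using representative in_PSL2C[OF gG] by (simp_all add: C_def)
  have "(\<lambda>n. det (C n)) \<longlonglongrightarrow> det A" using C by (rule tendsto_det2)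
  then have "det A = 1" by (simp add: dC LIMSEQ_const_iff)
  have lim: "(\<lambda>n. C n ** adjugate (C (Suc n))) \<longlonglongrightarrow> mat 1"
    using tendsto_matrix_mult[OF C tendsto_adjugate[OF LIMSEQ_Suc[OF C]]] adjugate_mult[OF \<open>det A = 1\<close>] by simp
  have sub1: "subtopology PSL2C_topology \<Gamma> = discrete_topology \<Gamma>"
    using kleinian by (simp add: torsion_free_discrete_subgroup_def)
  have "openin (subtopology PSL2C_topology \<Gamma>) {\<one>\<^bsub>PSL2C\<^esub>}"
    unfolding sub1 using one_mem by simp
  then obtain U where U: "openin PSL2C_topology U" "{\<one>\<^bsub>PSL2C\<^esub>} = U \<inter> \<Gamma>"
    unfolding openin_subtopology by blast
  have "openin (top_of_set (carrier SL2C)) {x \<in> carrier SL2C. to_PSL2C x \<in> U}"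
    using U(1) unfolding PSL2C_topology_def openin_quotient_topology by simp
  then obtain V where V: "open V" "{x \<in> carrier SL2C. to_PSL2C x \<in> U} = carrier SL2C \<inter> V"
    unfolding openin_open by blast
  have "\<one>\<^bsub>PSL2C\<^esub> \<in> U" using U(2) by blast
  moreover have "mat 1 \<in> carrier SL2C" by (simp add: SL2C_def)
  ultimately have "mat 1 \<in> {x \<in> carrier SL2C. to_PSL2C x \<in> U}" by (simp add: one_PSL2C)
  then have "mat 1 \<in> V" unfolding V(2) by (rule IntD2)
  then have "eventually (\<lambda>n. C n ** adjugate (C (Suc n)) \<in> V) sequentially"
    using topological_tendstoD[OF lim V(1)] by simp
  then have "\<exists>n. C n ** adjugate (C (Suc n)) \<in> V"
    by (rule eventually_happens'[OF trivial_limit_sequentially])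
  then obtain n where n: "C n ** adjugate (C (Suc n)) \<in> V" ..
  have "C n ** adjugate (C (Suc n)) \<in> carrier SL2C \<inter> V" using n by (simp add: SL2C_def det_mul dC)
  then have "to_PSL2C (C n ** adjugate (C (Suc n))) \<in> U"
    unfolding V(2)[symmetric] by simp
  moreover have eq: "to_PSL2C (C n ** adjugate (C (Suc n))) = g (k n) \<otimes>\<^bsub>PSL2C\<^esub> inv\<^bsub>PSL2C\<^esub> g (k (Suc n))"
    by (simp add: dC to_PSL2C_mult[symmetric] inv_to_PSL2C[symmetric])
  ultimately have "g (k n) \<otimes>\<^bsub>PSL2C\<^esub> inv\<^bsub>PSL2C\<^esub> g (k (Suc n)) = \<one>\<^bsub>PSL2C\<^esub>"
    using U(2) mult_mem[OF gG inv_mem[OF gG], of "k n" "k (Suc n)"] by (metis IntI singletonD)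
  then have "g (k n) = g (k (Suc n))"
    using inv_equality[of "g (k n)" "inv\<^bsub>PSL2C\<^esub> g (k (Suc n))"] in_PSL2C[OF gG] by simp
  then have "k n = k (Suc n)" using g(1) by (simp add: inj_eq)
  then show False using k by (metis lessI less_irrefl strict_mono_less)
qed

text \<open>The matrices are unbounded; divided by their norms they accumulate at a singular matrix, whose
  constant action is the limit. The constant \<open>a\<close> is a limit of \<open>\<beta>\<^sub>n
  0\<close>, and \<open>b\<close> of \<open>\<beta>\<^sub>n\<^sup>-\<^sup>1 0\<close>, so both belong to the
  limit set.\<close>

theorem convergence_dynamics:
  fixes \<beta> :: "nat \<Rightarrow> (complex^2^2) set"
  assumes \<beta>: "\<And>n. \<beta> n \<in> \<Gamma>" and fin: "\<And>g. finite {n. \<beta> n = g}"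
  obtains k a b where "strict_mono (k :: nat \<Rightarrow> nat)" "a \<in> limit_set \<Gamma>" "b \<in> limit_set \<Gamma>"
    "\<forall>u v. (\<forall>n. u n \<in> cball 0 1) \<longrightarrow> u \<longlonglongrightarrow> v \<longrightarrow> v \<noteq> b \<longrightarrow> (\<lambda>n. act (\<beta> (k n)) (u n)) \<longlonglongrightarrow> a"
proof -
  define A where "A n = representative (\<beta> n)" for n
  have A: "det (A n) = 1" "to_PSL2C (A n) = \<beta> n" for n
    using representative in_PSL2C[OF \<beta>] by (simp_all add: A_def)
  have A0: "A n \<noteq> 0" for n using A(1)[of n] by (auto simp: det_2)
  have "filterlim (\<lambda>n. norm (A n)) at_top sequentially"
    unfolding filterlim_at_top_gt[where c = 0]
  proof (intro allI impI)
    fix M :: real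
    have "{n. norm (A n) \<le> M} \<subseteq> (\<Union>g\<in>{g \<in> \<Gamma>. norm (representative g) \<le> M}. {n. \<beta> n = g})"
      using \<beta> by (auto simp: A_def)
    then have "finite {n. norm (A n) \<le> M}"
      using fin finite_bounded_representatives finite_subset by blast
    then have "eventually (\<lambda>n. \<not> norm (A n) \<le> M) sequentially"
      unfolding cofinite_eq_sequentially[symmetric] eventually_cofinite by simp
    then show "eventually (\<lambda>n. M \<le> norm (A n)) sequentially"
      by (rule eventually_mono) simp
  qed
  then have inf: "(\<lambda>n. inverse (norm (A n))) \<longlonglongrightarrow> 0" by (rule tendsto_inverse_0_at_top)
  define C where "C n = inverse (norm (A n)) *\<^sub>R A n" for n
  have "C n \<in> sphere 0 1" for n using A0[of n] by (simp add: C_def)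
  then obtain B k where k: "strict_mono (k :: nat \<Rightarrow> nat)" and B1: "B \<in> sphere 0 1" and B: "(C \<circ> k) \<longlonglongrightarrow> B"
    using compact_sphere unfolding compact_def by metis
  have detC: "det (C n) = of_real ((inverse (norm (A n)))\<^sup>2)" for n
    using A(1)[of n] unfolding C_def det_2
    by (simp add: scaleR_conv_of_real[where 'a = complex] power2_eq_square algebra_simps)
  have "(\<lambda>n. det ((C \<circ> k) n)) \<longlonglongrightarrow> of_real (0\<^sup>2)"
    unfolding comp_def detC
    by (intro tendsto_of_real tendsto_power LIMSEQ_subseq_LIMSEQ[OF inf k, unfolded comp_def])
  then have detB: "det B = 0"
    using LIMSEQ_unique[OF tendsto_det2[OF B]] by simp
  have B0: "B \<noteq> 0" using B1 by auto
  define a b where "a = SL2C_act B 0" and "b = SL2C_act (adjugate B) 0"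
  note sing = singular_SL2C_act[OF detB B0, folded a_def b_def]
  have actC: "act (\<beta> n) v = SL2C_act (C n) v" for n v
    using act_to_PSL2C[of "A n" v] A0[of n] by (simp add: A C_def SL2C_act_scaleR)
  have main: "(\<lambda>n. act (\<beta> (k n)) (u n)) \<longlonglongrightarrow> a"
    if u: "\<And>n. u n \<in> cball 0 1" "u \<longlonglongrightarrow> v" "v \<noteq> b" for u v
  proof -
    have v: "v \<in> cball 0 1"
      using closed_sequentially[OF closed_cball u(1,2)] .
    have "(\<lambda>n. SL2C_act ((C \<circ> k) n) (u n)) \<longlonglongrightarrow> SL2C_act B v"
      using sing(5)[OF v u(3)] by (intro tendsto_SL2C_act B u) simp
    then show ?thesis using sing(5)[OF v u(3)] by (simp add: actC)
  qed
  have adjA: "act (inv\<^bsub>PSL2C\<^esub> \<beta> n) 0 = SL2C_act (adjugate (C n)) 0" for n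
  proof -
    have "adjugate (C n) = inverse (norm (A n)) *\<^sub>R adjugate (A n)"
      by (simp add: C_def matrix2_eq_iff)
    then show ?thesis
      using act_to_PSL2C[of "adjugate (A n)" 0] A0[of n] inv_to_PSL2C[of "A n"] by (simp add: A SL2C_act_scaleR)
  qed
  have limb: "(\<lambda>n. act (inv\<^bsub>PSL2C\<^esub> \<beta> (k n)) 0) \<longlonglongrightarrow> b"
  proof -
    have "(\<lambda>n. SL2C_act (adjugate ((C \<circ> k) n)) 0) \<longlonglongrightarrow> SL2C_act (adjugate B) 0"
      using sing(4) by (intro tendsto_SL2C_act tendsto_adjugate B tendsto_const) simp
    then show ?thesis by (simp add: adjA b_def)
  qed
  have lima: "(\<lambda>n. act (\<beta> (k n)) 0) \<longlonglongrightarrow> a"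
    using main[of "\<lambda>_. 0" 0] sing(2) by fastforce
  have limit_in_limit_set: "\<xi> \<in> limit_set \<Gamma>"
    if "\<And>n. h n \<in> \<Gamma>" "(\<lambda>n. act (h n) 0) \<longlonglongrightarrow> \<xi>" "norm \<xi> = 1" for h :: "nat \<Rightarrow> (complex^2^2) set" and \<xi>
  proof -
    have "act (h n) 0 \<in> orbit_map \<Gamma> 0 - {\<xi>}" for n
      using that(1,3) act_H3[OF in_PSL2C[OF that(1)], of 0 n] by (auto simp: orbit_map_def)
    then have "\<xi> islimpt orbit_map \<Gamma> 0"
      unfolding islimpt_sequential using that(2) by (intro exI[of _ "\<lambda>n. act (h n) 0"]) simp
    moreover have "(0 :: real^3) \<in> H3" by simp
    ultimately show ?thesis using that(3) unfolding limit_set_def by auto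
  qed
  show ?thesis
  proof (rule that[OF k])
    show "\<forall>u v. (\<forall>n. u n \<in> cball 0 1) \<longrightarrow> u \<longlonglongrightarrow> v \<longrightarrow> v \<noteq> b \<longrightarrow> (\<lambda>n. act (\<beta> (k n)) (u n)) \<longlonglongrightarrow> a"
      using main by blast
    show "a \<in> limit_set \<Gamma>" by (rule limit_in_limit_set[OF _ lima sing(1)]) (rule \<beta>)
    show "b \<in> limit_set \<Gamma>" by (rule limit_in_limit_set[OF _ limb sing(2)]) (intro inv_mem \<beta>)
  qed
qed

lemma limit_set_subset: "limit_set \<Gamma> \<subseteq> S2"
  by (auto simp: limit_set_def)

lemma act_mem_limit_set:
  assumes g: "g \<in> \<Gamma>" and \<xi>: "\<xi> \<in> limit_set \<Gamma>"
  shows "act g \<xi> \<in> limit_set \<Gamma>"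
proof -
  obtain v where v: "v \<in> H3" "\<xi> islimpt orbit_map \<Gamma> v" and xi: "\<xi> \<in> S2"
    using \<xi> by (auto simp: limit_set_def)
  obtain f where f: "\<And>n :: nat. f n \<in> orbit_map \<Gamma> v" "f \<longlonglongrightarrow> \<xi>"
    using v(2) unfolding islimpt_sequential by blast
  have orb: "orbit_map \<Gamma> v \<subseteq> H3"
    using act_H3[OF in_PSL2C v(1)] by (auto simp: orbit_map_def)
  have gx: "act g \<xi> \<in> S2" using act_S2[OF in_PSL2C[OF g] xi] .
  have fc: "f n \<in> cball 0 1" for n using f(1)[of n] orb by (meson ball_subset_cball subset_iff)
  have lim: "(\<lambda>n. act g (f n)) \<longlonglongrightarrow> act g \<xi>"
    by (rule continuous_on_tendsto_compose[OF act_continuous[OF in_PSL2C[OF g]] f(2)]) (use xi fc in auto)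
  have "act g (f n) \<in> orbit_map \<Gamma> v - {act g \<xi>}" for n
  proof -
    obtain h where h: "h \<in> \<Gamma>" "f n = act h v" using f(1)[of n] by (auto simp: orbit_map_def)
    have "act g (f n) = act (g \<otimes>\<^bsub>PSL2C\<^esub> h) v"
      using act_mult[OF in_PSL2C[OF g] in_PSL2C[OF h(1)], of v] v(1) h(2) by simp
    then have "act g (f n) \<in> orbit_map \<Gamma> v" using mult_mem[OF g h(1)] by (auto simp: orbit_map_def)
    moreover then have "act g (f n) \<in> H3" using orb by blast
    then have "act g (f n) \<noteq> act g \<xi>" using gx by auto
    ultimately show ?thesis by blast
  qed
  then have "act g \<xi> islimpt orbit_map \<Gamma> v"
    unfolding islimpt_sequential using lim by (intro exI[of _ "\<lambda>n. act g (f n)"]) simp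
  then show ?thesis using gx v(1) by (auto simp: limit_set_def)
qed

text \<open>By convergence dynamics all orbits have the same accumulation points on the sphere. With a
  single orbit the limit set is visibly closed.\<close>

lemma limit_set_eq: "limit_set \<Gamma> = {\<xi> \<in> S2. \<xi> islimpt orbit_map \<Gamma> 0}"
proof (intro equalityI subsetI)
  fix \<xi> assume "\<xi> \<in> limit_set \<Gamma>"
  then obtain v where v: "v \<in> H3" "\<xi> islimpt orbit_map \<Gamma> v" and xi: "\<xi> \<in> S2"
    by (auto simp: limit_set_def)
  obtain f where f: "\<And>n :: nat. f n \<in> orbit_map \<Gamma> v - {\<xi>}" "f \<longlonglongrightarrow> \<xi>"
    using v(2) unfolding islimpt_sequential by blast
  have "\<forall>n. \<exists>g. g \<in> \<Gamma> \<and> f n = act g v"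
    using f(1) unfolding orbit_map_def by blast
  then have "\<exists>\<beta>. \<forall>n. \<beta> n \<in> \<Gamma> \<and> f n = act (\<beta> n) v" by (rule choice)
  then obtain \<beta> where \<beta>: "\<And>n. \<beta> n \<in> \<Gamma>" "\<And>n. f n = act (\<beta> n) v" by blast
  have fin: "finite {n. \<beta> n = g}" for g
  proof (rule ccontr)
    assume "infinite {n. \<beta> n = g}"
    then obtain r where r: "strict_mono (r :: nat \<Rightarrow> nat)" "\<And>n. \<beta> (r n) = g"
      using infinite_enumerate[of "{n. \<beta> n = g}"] by auto
    have "(\<lambda>n. f (r n)) \<longlonglongrightarrow> \<xi>" using LIMSEQ_subseq_LIMSEQ[OF f(2) r(1)] by (simp add: comp_def)
    then have "act g v = \<xi>" by (simp add: \<beta>(2) r(2) LIMSEQ_const_iff)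
    then show False using f(1)[of "r 0"] \<beta>(2) r(2) by auto
  qed
  obtain k a b where k: "strict_mono (k :: nat \<Rightarrow> nat)" and ab: "a \<in> limit_set \<Gamma>" "b \<in> limit_set \<Gamma>"
    and dyn: "\<forall>u v. (\<forall>n. u n \<in> cball 0 1) \<longrightarrow> u \<longlonglongrightarrow> v \<longrightarrow> v \<noteq> b \<longrightarrow> (\<lambda>n. act (\<beta> (k n)) (u n)) \<longlonglongrightarrow> a"
    by (rule convergence_dynamics[OF \<beta>(1) fin])
  have bS: "norm b = 1" using ab limit_set_subset by auto
  have c: "(\<lambda>n. act (\<beta> (k n)) w) \<longlonglongrightarrow> a" if "w \<in> H3" for w
  proof -
    have "w \<noteq> b" using that bS by auto
    then show ?thesis using dyn[rule_format, of "\<lambda>_. w" w] that by simp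
  qed
  have "(\<lambda>n. f (k n)) \<longlonglongrightarrow> \<xi>" using LIMSEQ_subseq_LIMSEQ[OF f(2) k] by (simp add: comp_def)
  moreover have "(\<lambda>n. f (k n)) \<longlonglongrightarrow> a" using c[OF v(1)] by (simp add: \<beta>(2))
  ultimately have "a = \<xi>" by (rule LIMSEQ_unique[symmetric])
  have "act (\<beta> (k n)) 0 \<in> orbit_map \<Gamma> 0 - {\<xi>}" for n
    using act_H3[OF in_PSL2C[OF \<beta>(1)], of 0 "k n"] \<beta>(1) xi by (auto simp: orbit_map_def)
  then have "\<xi> islimpt orbit_map \<Gamma> 0"
    unfolding islimpt_sequential using c[of 0] \<open>a = \<xi>\<close>
    by (intro exI[of _ "\<lambda>n. act (\<beta> (k n)) 0"]) simp
  then show "\<xi> \<in> {\<xi> \<in> S2. \<xi> islimpt orbit_map \<Gamma> 0}" using xi by simp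
next
  fix \<xi> assume "\<xi> \<in> {\<xi> \<in> S2. \<xi> islimpt orbit_map \<Gamma> 0}"
  moreover have "(0 :: real^3) \<in> H3" by simp
  ultimately show "\<xi> \<in> limit_set \<Gamma>" unfolding limit_set_def by blast
qed

lemma compact_limit_set: "compact (limit_set \<Gamma>)"
proof -
  have "closed {\<xi>. \<xi> islimpt orbit_map \<Gamma> 0}"
    by (rule closed_limpts)
  then have "closed (S2 \<inter> {\<xi>. \<xi> islimpt orbit_map \<Gamma> 0})" by (intro closed_Int) auto
  moreover have "limit_set \<Gamma> = S2 \<inter> {\<xi>. \<xi> islimpt orbit_map \<Gamma> 0}"
    by (auto simp: limit_set_eq)
  moreover have "bounded (limit_set \<Gamma>)"
    using limit_set_subset bounded_sphere bounded_subset by blast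
  ultimately show ?thesis by (simp add: compact_eq_bounded_closed)
qed

text \<open>Infinitely many elements would push points of the ball of radius \<open>r\<close> to the
  sphere.\<close>

lemma finite_returns:
  assumes "r < 1"
  shows "finite {g \<in> \<Gamma>. \<exists>u. norm u \<le> r \<and> norm (act g u) \<le> r}"
proof (rule ccontr)
  assume "infinite {g \<in> \<Gamma>. \<exists>u. norm u \<le> r \<and> norm (act g u) \<le> r}"
  then obtain \<beta> :: "nat \<Rightarrow> (complex^2^2) set" where inj: "inj \<beta>"
    and \<beta>: "range \<beta> \<subseteq> {g \<in> \<Gamma>. \<exists>u. norm u \<le> r \<and> norm (act g u) \<le> r}"
    using infinite_countable_subset by blast
  then have "\<exists>u. norm u \<le> r \<and> norm (act (\<beta> n) u) \<le> r" for n by auto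
  then obtain u where u: "\<And>n. u n \<in> cball 0 r" "\<And>n. norm (act (\<beta> n) (u n)) \<le> r" 
    by (metis mem_cball_0)
  obtain v l where l: "strict_mono (l :: nat \<Rightarrow> nat)" and v: "v \<in> cball 0 r" "(u \<circ> l) \<longlonglongrightarrow> v"
    using compact_cball u(1) unfolding compact_def by metis
  have G: "\<beta> (l n) \<in> \<Gamma>" for n using \<beta> by auto
  have fin: "finite {n. \<beta> (l n) = g}" for g
  proof -
    have "inj (\<lambda>n. \<beta> (l n))"
      using inj_compose[OF inj strict_mono_imp_inj_on[OF l]] by (simp add: comp_def)
    then show ?thesis using finite_vimageI[of "{g}" "\<lambda>n. \<beta> (l n)"] by (simp add: vimage_def)
  qed
  obtain k a b where k: "strict_mono (k :: nat \<Rightarrow> nat)" and ab: "a \<in> limit_set \<Gamma>" "b \<in> limit_set \<Gamma>"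
    and dyn: "\<forall>u v. (\<forall>n. u n \<in> cball 0 1) \<longrightarrow> u \<longlonglongrightarrow> v \<longrightarrow> v \<noteq> b \<longrightarrow> (\<lambda>n. act (\<beta> (l (k n))) (u n)) \<longlonglongrightarrow> a"
    by (rule convergence_dynamics[OF G fin])
  have S: "norm a = 1" "norm b = 1" using ab limit_set_subset by auto
  have "(\<lambda>n. u (l (k n))) \<longlonglongrightarrow> v" using LIMSEQ_subseq_LIMSEQ[OF v(2) k] by (simp add: comp_def)
  moreover have "u (l (k n)) \<in> cball 0 1" for n using u(1)[of "l (k n)"] assms by simp
  moreover have "v \<noteq> b" using v(1) S assms by auto
  ultimately have lim: "(\<lambda>n. act (\<beta> (l (k n))) (u (l (k n)))) \<longlonglongrightarrow> a"
    using dyn[rule_format, of "\<lambda>n. u (l (k n))" v] by blast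
  have "act (\<beta> (l (k n))) (u (l (k n))) \<in> cball 0 r" for n using u(2) by simp
  then have "a \<in> cball 0 r" by (rule closed_sequentially[OF closed_cball _ lim])
  then show False using S assms by simp
qed

text \<open>Otherwise nontrivial elements move points tending to \<open>v\<close> to points tending to
  \<open>v\<close>. If no element recurs infinitely often, convergence dynamics puts \<open>v\<close> into
  the limit set. If one does, it fixes \<open>v\<close>, and its powers, which are distinct because the
  group is torsion-free, lead to the same contradiction.\<close>

lemma wandering_neighbourhood:
  assumes v: "v \<in> H3 \<union> domain_of_discontinuity \<Gamma>"
  obtains e where "e > 0"
    "\<And>g u. g \<in> \<Gamma> \<Longrightarrow> u \<in> cball 0 1 \<Longrightarrow> u \<in> ball v e \<Longrightarrow> act g u \<in> ball v e \<Longrightarrow> g = \<one>\<^bsub>PSL2C\<^esub>"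
proof (rule ccontr)
  interpret group PSL2C by (rule PSL2C_group)
  note witness = that
  assume contra: "\<not> thesis"
  have vL: "v \<notin> limit_set \<Gamma>" and vc: "v \<in> cball 0 1"
    using v limit_set_subset by (auto simp: domain_of_discontinuity_def)
  have escape: False
    if \<beta>: "\<And>n. \<beta> n \<in> \<Gamma>" and fin: "\<And>g. finite {n. \<beta> n = g}" and u: "\<And>n. u n \<in> cball 0 1"
      and lim: "u \<longlonglongrightarrow> v" "(\<lambda>n. act (\<beta> n) (u n)) \<longlonglongrightarrow> v" for \<beta> u
  proof -
    obtain k a b where k: "strict_mono (k :: nat \<Rightarrow> nat)" and ab: "a \<in> limit_set \<Gamma>" "b \<in> limit_set \<Gamma>"
      and dyn: "\<forall>u v. (\<forall>n. u n \<in> cball 0 1) \<longrightarrow> u \<longlonglongrightarrow> v \<longrightarrow> v \<noteq> b \<longrightarrow> (\<lambda>n. act (\<beta> (k n)) (u n)) \<longlonglongrightarrow> a"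
      by (rule convergence_dynamics[OF \<beta> fin])
    have "(\<lambda>n. u (k n)) \<longlonglongrightarrow> v" using LIMSEQ_subseq_LIMSEQ[OF lim(1) k] by (simp add: comp_def)
    then have "(\<lambda>n. act (\<beta> (k n)) (u (k n))) \<longlonglongrightarrow> a" 
      using dyn[rule_format, of "\<lambda>n. u (k n)" v] u vL ab by blast
    moreover have "(\<lambda>n. act (\<beta> (k n)) (u (k n))) \<longlonglongrightarrow> v"
      using LIMSEQ_subseq_LIMSEQ[OF lim(2) k] by (simp add: comp_def)
    ultimately show False using LIMSEQ_unique ab vL by blast
  qed
  have "\<exists>g u. g \<in> \<Gamma> \<and> g \<noteq> \<one>\<^bsub>PSL2C\<^esub> \<and> u \<in> cball 0 1 \<and> u \<in> ball v e \<and> act g u \<in> ball v e" if "e > 0" for e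
    using contra witness[OF that] by blast
  then have "\<exists>g u. g \<in> \<Gamma> \<and> g \<noteq> \<one>\<^bsub>PSL2C\<^esub> \<and> u \<in> cball 0 1 \<and> u \<in> ball v (inverse (real (Suc n)))
      \<and> act g u \<in> ball v (inverse (real (Suc n)))" for n by simp
  then obtain \<beta> u where \<beta>: "\<And>n. \<beta> n \<in> \<Gamma>" "\<And>n. \<beta> n \<noteq> \<one>\<^bsub>PSL2C\<^esub>" and u: "\<And>n. u n \<in> cball 0 1"
    and d: "\<And>n. dist v (u n) < inverse (real (Suc n))" "\<And>n. dist v (act (\<beta> n) (u n)) < inverse (real (Suc n))"
    unfolding mem_ball by metis
  have lim: "f \<longlonglongrightarrow> v" if "\<And>n. dist v (f n) < inverse (real (Suc n))" for f
  proof (rule metric_tendsto_imp_tendsto[OF LIMSEQ_inverse_real_of_nat])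
    show "eventually (\<lambda>n. dist (f n) v \<le> dist (inverse (real (Suc n))) 0) sequentially"
      using that by (intro always_eventually) (auto simp: dist_commute less_imp_le)
  qed
  show False
  proof (cases "\<forall>g. finite {n. \<beta> n = g}")
    case True
    then show ?thesis using escape[of \<beta> u] \<beta>(1) u lim[OF d(1)] lim[OF d(2)] by blast
  next
    case False
    then obtain g where "infinite {n. \<beta> n = g}" by blast
    then obtain r where r: "strict_mono (r :: nat \<Rightarrow> nat)" "\<And>n. \<beta> (r n) = g"
      using infinite_enumerate[of "{n. \<beta> n = g}"] by auto
    have g: "g \<in> \<Gamma>" "g \<noteq> \<one>\<^bsub>PSL2C\<^esub>" using \<beta>[of "r 0"] r(2) by auto
    have gc: "g \<in> carrier PSL2C" using in_PSL2C[OF g(1)] .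
    have "(\<lambda>n. act g (u (r n))) \<longlonglongrightarrow> act g v"
      using continuous_on_tendsto_compose[OF act_continuous[OF gc] LIMSEQ_subseq_LIMSEQ[OF lim[OF d(1)] r(1)]] vc u
      by (simp add: comp_def)
    moreover have "(\<lambda>n. act g (u (r n))) \<longlonglongrightarrow> v"
      using LIMSEQ_subseq_LIMSEQ[OF lim[OF d(2)] r(1)] by (simp add: comp_def r(2))
    ultimately have fixed: "act g v = v" by (rule LIMSEQ_unique)
    have pow: "g [^]\<^bsub>PSL2C\<^esub> n \<in> \<Gamma> \<and> act (g [^]\<^bsub>PSL2C\<^esub> n) v = v" for n :: nat
    proof (induction n)
      case 0 show ?case using one_mem act_one by simp
    next
      case (Suc n)
      then show ?case using mult_mem g(1) act_mult[OF in_PSL2C gc vc] fixed by simp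
    qed
    have inj: "inj (\<lambda>n :: nat. g [^]\<^bsub>PSL2C\<^esub> n)"
    proof (rule linorder_injI)
      fix m n :: nat assume "m < n"
      show "g [^]\<^bsub>PSL2C\<^esub> m \<noteq> g [^]\<^bsub>PSL2C\<^esub> n"
      proof
        assume "g [^]\<^bsub>PSL2C\<^esub> m = g [^]\<^bsub>PSL2C\<^esub> n"
        then have "g [^]\<^bsub>PSL2C\<^esub> (n - m) = \<one>\<^bsub>PSL2C\<^esub>"
          by (rule pow_eq_div2[OF gc, OF sym])
        then show False
          using kleinian g \<open>m < n\<close> unfolding torsion_free_discrete_subgroup_def by (metis zero_less_diff)
      qed
    qed
    have "finite {n. g [^]\<^bsub>PSL2C\<^esub> (n::nat) = h}" for h
      using finite_vimageI[OF _ inj, of "{h}"] by (simp add: vimage_def)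
    then show ?thesis
      using escape[of "\<lambda>n. g [^]\<^bsub>PSL2C\<^esub> (n::nat)" "\<lambda>_. v"] pow vc by simp
  qed
qed

end

section \<open>Lifting through the orbit map\<close>

text \<open>These conditions make the orbit map a covering. They hold for hyperbolic space, for its union
  with the domain of discontinuity, and for a plane with the stabilizer of its circle.\<close>

locale covering_action =
  fixes G :: "(complex^2^2) set set" and Y :: "(real^3) set"
  assumes subgroup: "subgroup G PSL2C"
    and Y_cball: "Y \<subseteq> cball 0 1"
    and act_mem: "\<And>g v. g \<in> G \<Longrightarrow> v \<in> Y \<Longrightarrow> act g v \<in> Y"
    and wandering: "\<And>v. v \<in> Y \<Longrightarrow>
      \<exists>U. open U \<and> v \<in> U \<and> (\<forall>g\<in>G. \<forall>u\<in>U \<inter> Y. act g u \<in> U \<longrightarrow> g = \<one>\<^bsub>PSL2C\<^esub>)"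
begin

lemma in_PSL2C: "g \<in> G \<Longrightarrow> g \<in> carrier PSL2C"
  using subgroup by (rule subgroup.mem_carrier)

lemma inv_mem: "g \<in> G \<Longrightarrow> inv\<^bsub>PSL2C\<^esub> g \<in> G"
  using subgroup by (rule subgroup.m_inv_closed)

lemma mult_mem: "g \<in> G \<Longrightarrow> h \<in> G \<Longrightarrow> g \<otimes>\<^bsub>PSL2C\<^esub> h \<in> G"
  using subgroup by (rule subgroup.m_closed)

lemma in_cball: "v \<in> Y \<Longrightarrow> v \<in> cball 0 1"
  using Y_cball by blast

lemma act_inv_left: "g \<in> G \<Longrightarrow> v \<in> Y \<Longrightarrow> act (inv\<^bsub>PSL2C\<^esub> g) (act g v) = v"
  using act_inv(1) in_PSL2C in_cball by blast

lemma act_inv_right: "g \<in> G \<Longrightarrow> v \<in> Y \<Longrightarrow> act g (act (inv\<^bsub>PSL2C\<^esub> g) v) = v"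
  using act_inv(2) in_PSL2C in_cball by blast

lemma mem_orbit: "v \<in> orbit_map G v"
  using subgroup.one_closed[OF subgroup] act_one unfolding orbit_map_def by (metis imageI)

lemma orbit_map_eq_iff:
  assumes "v \<in> Y" "w \<in> Y"
  shows "orbit_map G v = orbit_map G w \<longleftrightarrow> (\<exists>g\<in>G. w = act g v)"
proof
  assume "orbit_map G v = orbit_map G w"
  then have "w \<in> orbit_map G v" using mem_orbit by simp
  then show "\<exists>g\<in>G. w = act g v" by (auto simp: orbit_map_def)
next
  have sub: "orbit_map G (act g u) \<subseteq> orbit_map G u" if "g \<in> G" "u \<in> Y" for g u
    using that mult_mem act_mult[OF in_PSL2C in_PSL2C in_cball]
    by (auto simp: orbit_map_def image_iff) (metis)
  assume "\<exists>g\<in>G. w = act g v"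
  then obtain g where g: "g \<in> G" "w = act g v" by blast
  then have "v = act (inv\<^bsub>PSL2C\<^esub> g) w" using act_inv_left assms by simp
  then show "orbit_map G v = orbit_map G w"
    using sub[OF g(1) assms(1)] sub[OF inv_mem[OF g(1)] assms(2)] g(2) by auto
qed

lemma orbit_map_act: "g \<in> G \<Longrightarrow> v \<in> Y \<Longrightarrow> orbit_map G (act g v) = orbit_map G v"
  using orbit_map_eq_iff act_mem by metis

lemma continuous_act: "g \<in> G \<Longrightarrow> continuous_on Y (act g)"
  using act_continuous[OF in_PSL2C] Y_cball continuous_on_subset by blast

lemma continuous_map_orbit_map: "continuous_map (top_of_set Y) (orbit_space G Y) (orbit_map G)"
  unfolding orbit_space_def
  by (rule quotient_imp_continuous_map[OF quotient_map_quotient_topology])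

lemma topspace_orbit_space: "topspace (orbit_space G Y) = orbit_map G ` Y"
  by (simp add: orbit_space_def)

lemma open_orbit_map:
  assumes W: "openin (top_of_set Y) W"
  shows "openin (orbit_space G Y) (orbit_map G ` W)"
proof -
  have WY: "W \<subseteq> Y" using W by (metis openin_subset topspace_euclidean_subtopology)
  have "{x \<in> Y. orbit_map G x \<in> orbit_map G ` W} = (\<Union>g\<in>G. Y \<inter> act g -` W)"
  proof (intro equalityI subsetI)
    fix x assume "x \<in> {x \<in> Y. orbit_map G x \<in> orbit_map G ` W}"
    then obtain w where "x \<in> Y" "w \<in> W" "orbit_map G x = orbit_map G w" by blast
    then show "x \<in> (\<Union>g\<in>G. Y \<inter> act g -` W)" using orbit_map_eq_iff[of x w] WY by blast
  next
    fix x assume "x \<in> (\<Union>g\<in>G. Y \<inter> act g -` W)"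
    then obtain g where g: "g \<in> G" "x \<in> Y" "act g x \<in> W" by blast
    then have "orbit_map G x = orbit_map G (act g x)" by (simp add: orbit_map_act)
    then show "x \<in> {x \<in> Y. orbit_map G x \<in> orbit_map G ` W}" using g by blast
  qed
  moreover have "openin (top_of_set Y) (\<Union>g\<in>G. Y \<inter> act g -` W)"
  proof (rule openin_Union, clarify)
    fix g assume "g \<in> G"
    then show "openin (top_of_set Y) (Y \<inter> act g -` W)"
      using continuous_openin_preimage[OF continuous_act _ W] act_mem by blast
  qed
  ultimately show ?thesis
    using WY unfolding orbit_space_def openin_quotient_topology by auto
qed

lemma lift_unique:
  fixes f1 f2 :: "'a :: real_normed_vector \<Rightarrow> real^3"
  assumes K: "connected K" and f: "continuous_on K f1" "continuous_on K f2" "f1 \<in> K \<rightarrow> Y" "f2 \<in> K \<rightarrow> Y"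
    and eq: "\<And>k. k \<in> K \<Longrightarrow> orbit_map G (f1 k) = orbit_map G (f2 k)"
    and k0: "k0 \<in> K" "f1 k0 = f2 k0" and k: "k \<in> K"
  shows "f1 k = f2 k"
proof -
  define Z where "Z = {k \<in> K. f1 k = f2 k}"
  have "closedin (top_of_set K) (K \<inter> (\<lambda>k. f1 k - f2 k) -` {0})"
    by (intro continuous_closedin_preimage continuous_on_diff f closed_singleton)
  moreover have "K \<inter> (\<lambda>k. f1 k - f2 k) -` {0} = Z" by (auto simp: Z_def)
  ultimately have cl: "closedin (top_of_set K) Z" by simp
  have op: "openin (top_of_set K) Z"
  proof (subst openin_subopen, intro ballI)
    fix z assume z: "z \<in> Z"
    then have fz: "f1 z \<in> Y" using f by (auto simp: Z_def)
    obtain U where U: "open U" "f1 z \<in> U" "\<And>g u. g \<in> G \<Longrightarrow> u \<in> U \<inter> Y \<Longrightarrow> act g u \<in> U \<Longrightarrow> g = \<one>\<^bsub>PSL2C\<^esub>"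
      using wandering[OF fz] by blast
    have "openin (top_of_set K) ((K \<inter> f1 -` U) \<inter> (K \<inter> f2 -` U))"
      using f U(1) by (intro openin_Int continuous_openin_preimage_gen)
    moreover have "z \<in> (K \<inter> f1 -` U) \<inter> (K \<inter> f2 -` U)" using z U(2) by (auto simp: Z_def)
    moreover have "(K \<inter> f1 -` U) \<inter> (K \<inter> f2 -` U) \<subseteq> Z"
    proof clarify
      fix x assume x: "x \<in> K" "f1 x \<in> U" "f2 x \<in> U"
      then have "f1 x \<in> Y" "f2 x \<in> Y" using f by auto
      then obtain g where g: "g \<in> G" "f2 x = act g (f1 x)" using orbit_map_eq_iff eq[OF x(1)] by blast
      then have "g = \<one>\<^bsub>PSL2C\<^esub>" using U(3)[of g "f1 x"] x \<open>f1 x \<in> Y\<close> by simp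
      then show "x \<in> Z" using g x(1) act_one by (simp add: Z_def)
    qed
    ultimately show "\<exists>T. openin (top_of_set K) T \<and> z \<in> T \<and> T \<subseteq> Z" by blast
  qed
  have "k0 \<in> Z" using k0 by (simp add: Z_def)
  then have "Z = K" using K op cl unfolding connected_clopen by blast
  then show ?thesis using k by (auto simp: Z_def)
qed

lemma lift_unique_up_to_group:
  fixes f1 f2 :: "'a :: real_normed_vector \<Rightarrow> real^3"
  assumes K: "connected K" "K \<noteq> {}" and f: "continuous_on K f1" "continuous_on K f2" "f1 \<in> K \<rightarrow> Y" "f2 \<in> K \<rightarrow> Y"
    and eq: "\<And>k. k \<in> K \<Longrightarrow> orbit_map G (f1 k) = orbit_map G (f2 k)"
  obtains g where "g \<in> G" "\<And>k. k \<in> K \<Longrightarrow> f2 k = act g (f1 k)"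
proof -
  obtain k0 where k0: "k0 \<in> K" using K(2) by blast
  then obtain g where g: "g \<in> G" "f2 k0 = act g (f1 k0)"
    using orbit_map_eq_iff eq[OF k0] f by (metis Pi_iff)
  have "act g (f1 k) = f2 k" if "k \<in> K" for k
  proof (rule lift_unique[OF K(1) _ f(2) _ f(4) _ k0 _ that])
    show "continuous_on K (\<lambda>x. act g (f1 x))"
      using continuous_on_compose2[OF continuous_act[OF g(1)] f(1)] f(3) by blast
    show "(\<lambda>x. act g (f1 x)) \<in> K \<rightarrow> Y" using f(3) act_mem[OF g(1)] by auto
    show "orbit_map G (act g (f1 x)) = orbit_map G (f2 x)" if "x \<in> K" for x
      using f(3) that by (simp add: orbit_map_act[OF g(1)] eq Pi_iff)
    show "act g (f1 k0) = f2 k0" using g by simp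
  qed
  then show ?thesis using that[OF g(1)] by simp
qed

text \<open>The orbit space does not lie in a normed space, but the fibre product \<open>E\<close> of
  \<open>K\<close> and \<open>Y\<close> over it does. \<open>E\<close> is a covering of \<open>K\<close>,
  and a section over the simply connected set \<open>K\<close> is a lift.\<close>

theorem lift:
  fixes F :: "'a :: real_normed_vector \<Rightarrow> (real^3) set"
  assumes K: "convex K" and F: "continuous_map (top_of_set K) (orbit_space G Y) F"
  obtains f where "continuous_on K f" "f \<in> K \<rightarrow> Y" "\<And>k. k \<in> K \<Longrightarrow> orbit_map G (f k) = F k"
proof -
  define E where "E = {(k, v). k \<in> K \<and> v \<in> Y \<and> F k = orbit_map G v}"
  have FY: "F k \<in> orbit_map G ` Y" if "k \<in> K" for k
    using continuous_map_image_subset_topspace[OF F] that unfolding topspace_orbit_space by auto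
  have preim: "openin (top_of_set K) {k \<in> K. F k \<in> orbit_map G ` W}" if "openin (top_of_set Y) W" for W
    using openin_continuous_map_preimage[OF F open_orbit_map[OF that]] by simp
  have "covering_space E fst K"
  proof (rule covering_spaceI)
    show "continuous_on E fst" by (intro continuous_intros)
    show "fst ` E = K"
    proof (intro equalityI subsetI)
      fix k assume "k \<in> K"
      then obtain v where "v \<in> Y" "F k = orbit_map G v" using FY by blast
      then have "(k, v) \<in> E" using \<open>k \<in> K\<close> by (simp add: E_def)
      then show "k \<in> fst ` E" by force
    qed (auto simp: E_def)
    fix k0 assume k0: "k0 \<in> K"
    then obtain v0 where v0: "v0 \<in> Y" "F k0 = orbit_map G v0" using FY by blast
    obtain U where U: "open U" "v0 \<in> U" "\<And>g u. g \<in> G \<Longrightarrow> u \<in> U \<inter> Y \<Longrightarrow> act g u \<in> U \<Longrightarrow> g = \<one>\<^bsub>PSL2C\<^esub>"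
      using wandering[OF v0(1)] by blast
    define T where "T = {k \<in> K. F k \<in> orbit_map G ` (Y \<inter> U)}"
    have T: "openin (top_of_set K) T" unfolding T_def by (intro preim openin_open_Int U(1))
    have uniq: "u = u'" if uu: "u \<in> U \<inter> Y" "u' \<in> U \<inter> Y" "orbit_map G u = orbit_map G u'" for u u'
    proof -
      obtain g where g: "g \<in> G" "u' = act g u" using uu orbit_map_eq_iff[of u u'] by blast
      then have "g = \<one>\<^bsub>PSL2C\<^esub>" using U(3) uu by blast
      then show ?thesis using g act_one by simp
    qed
    have "\<forall>k\<in>T. \<exists>u. u \<in> U \<inter> Y \<and> orbit_map G u = F k" by (auto simp: T_def)
    then obtain \<sigma> where \<sigma>: "\<And>k. k \<in> T \<Longrightarrow> \<sigma> k \<in> U \<inter> Y" "\<And>k. k \<in> T \<Longrightarrow> orbit_map G (\<sigma> k) = F k"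
      by metis
    have cont\<sigma>: "continuous_on T \<sigma>"
      unfolding continuous_openin_preimage_eq
    proof (intro allI impI)
      fix W :: "(real^3) set" assume W: "open W"
      have "T \<inter> \<sigma> -` W = T \<inter> {k \<in> K. F k \<in> orbit_map G ` (Y \<inter> (U \<inter> W))}"
      proof (intro equalityI subsetI)
        fix k assume "k \<in> T \<inter> \<sigma> -` W"
        then show "k \<in> T \<inter> {k \<in> K. F k \<in> orbit_map G ` (Y \<inter> (U \<inter> W))}"
          using \<sigma>[of k] by (auto simp: T_def)
      next
        fix k assume k: "k \<in> T \<inter> {k \<in> K. F k \<in> orbit_map G ` (Y \<inter> (U \<inter> W))}"
        then obtain u where "u \<in> Y \<inter> (U \<inter> W)" "F k = orbit_map G u" by blast
        then have "\<sigma> k = u" using \<sigma>[of k] k uniq[of "\<sigma> k" u] by auto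
        then show "k \<in> T \<inter> \<sigma> -` W" using \<open>u \<in> Y \<inter> (U \<inter> W)\<close> k by simp
      qed
      moreover have "openin (top_of_set T) (T \<inter> {k \<in> K. F k \<in> orbit_map G ` (Y \<inter> (U \<inter> W))})"
      proof (rule openin_subset_trans)
        show "openin (top_of_set K) (T \<inter> {k \<in> K. F k \<in> orbit_map G ` (Y \<inter> (U \<inter> W))})"
          by (intro openin_Int T preim openin_open_Int open_Int U(1) W)
      qed (auto simp: T_def)
      ultimately show "openin (top_of_set T) (T \<inter> \<sigma> -` W)" by simp
    qed
    define S where "S g = {p \<in> E. fst p \<in> T \<and> act g (snd p) \<in> U}" for g
    have act_snd: "continuous_on E (\<lambda>p. act g (snd p))" if "g \<in> G" for g
      by (rule continuous_on_compose2[OF continuous_act[OF that] continuous_on_snd[OF continuous_on_id]])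
         (auto simp: E_def)
    have "\<Union>(S ` G) = E \<inter> fst -` T"
    proof (intro equalityI subsetI)
      fix p assume p: "p \<in> E \<inter> fst -` T"
      obtain k v where kv: "p = (k, v)" by (cases p)
      have v: "v \<in> Y" "F k = orbit_map G v" "k \<in> T" using p by (auto simp: E_def kv)
      then have "orbit_map G v = orbit_map G (\<sigma> k)" using \<sigma>(2)[of k] by simp
      then obtain g where g: "g \<in> G" "\<sigma> k = act g v" using v \<sigma>(1)[of k] orbit_map_eq_iff by blast
      then have "p \<in> S g" using p v \<sigma>(1)[of k] by (auto simp: S_def kv)
      then show "p \<in> \<Union>(S ` G)" using g(1) by blast
    qed (auto simp: S_def)
    moreover have "openin (top_of_set E) (S g)" if "g \<in> G" for g
    proof -
      have "openin (top_of_set E) ((E \<inter> fst -` T) \<inter> (E \<inter> (\<lambda>p. act g (snd p)) -` U))"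
        by (intro openin_Int continuous_openin_preimage_gen[OF act_snd[OF that] U(1)]
            continuous_openin_preimage[OF _ _ T] continuous_on_fst continuous_on_id)
          (auto simp: E_def)
      moreover have "(E \<inter> fst -` T) \<inter> (E \<inter> (\<lambda>p. act g (snd p)) -` U) = S g" by (auto simp: S_def)
      ultimately show ?thesis by simp
    qed
    moreover have "pairwise disjnt (S ` G)"
    proof (rule pairwise_imageI)
      fix g h assume gh: "g \<in> G" "h \<in> G" "g \<noteq> h"
      show "disjnt (S g) (S h)"
        unfolding disjnt_iff
      proof (intro allI notI)
        interpret group PSL2C by (rule PSL2C_group)
        fix p assume p: "p \<in> S g \<and> p \<in> S h"
        then have v: "snd p \<in> Y" "act g (snd p) \<in> U" "act h (snd p) \<in> U" by (auto simp: S_def E_def)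
        have "act (h \<otimes>\<^bsub>PSL2C\<^esub> inv\<^bsub>PSL2C\<^esub> g) (act g (snd p)) = act h (snd p)"
          using act_mult[of h "inv\<^bsub>PSL2C\<^esub> g" "act g (snd p)"] gh v act_inv_left act_mem in_cball in_PSL2C inv_mem by simp
        then have "h \<otimes>\<^bsub>PSL2C\<^esub> inv\<^bsub>PSL2C\<^esub> g = \<one>\<^bsub>PSL2C\<^esub>"
          using U(3)[of "h \<otimes>\<^bsub>PSL2C\<^esub> inv\<^bsub>PSL2C\<^esub> g" "act g (snd p)"] v gh mult_mem inv_mem act_mem by simp
        then have "h = g" using gh in_PSL2C inv_equality[of h "inv\<^bsub>PSL2C\<^esub> g"] by simp
        then show False using gh by simp
      qed
    qed
    moreover have "\<exists>q. homeomorphism (S g) T fst q" if g: "g \<in> G" for g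
    proof (rule exI[of _ "\<lambda>k. (k, act (inv\<^bsub>PSL2C\<^esub> g) (\<sigma> k))"], rule homeomorphismI)
      show "continuous_on (S g) fst" by (intro continuous_intros)
      show "continuous_on T (\<lambda>k. (k, act (inv\<^bsub>PSL2C\<^esub> g) (\<sigma> k)))"
        by (intro continuous_on_Pair continuous_on_id
            continuous_on_compose2[OF continuous_act[OF inv_mem[OF g]] cont\<sigma>]) (use \<sigma>(1) in auto)
      show "fst ` S g \<subseteq> T" by (auto simp: S_def)
      show "(\<lambda>k. (k, act (inv\<^bsub>PSL2C\<^esub> g) (\<sigma> k))) ` T \<subseteq> S g"
      proof (rule image_subsetI)
        fix k assume k: "k \<in> T"
        then show "(k, act (inv\<^bsub>PSL2C\<^esub> g) (\<sigma> k)) \<in> S g"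
          using \<sigma>[OF k] act_mem[OF inv_mem[OF g]] orbit_map_act[OF inv_mem[OF g]] act_inv_right[OF g]
          by (auto simp: S_def E_def T_def)
      qed
      fix p assume p: "p \<in> S g"
      obtain k v where kv: "p = (k, v)" by (cases p)
      have v: "v \<in> Y" "F k = orbit_map G v" "k \<in> T" "act g v \<in> U" using p by (auto simp: S_def E_def kv)
      have "\<sigma> k = act g v"
        using v \<sigma>[of k] uniq[of "\<sigma> k" "act g v"] orbit_map_act[OF g] act_mem[OF g] by auto
      then show "(fst p, act (inv\<^bsub>PSL2C\<^esub> g) (\<sigma> (fst p))) = p"
        using act_inv_left[OF g] v(1) by (simp add: kv)
    qed simp
    ultimately show "\<exists>T. k0 \<in> T \<and> openin (top_of_set K) T \<and>
          (\<exists>v. \<Union>v = E \<inter> fst -` T \<and> (\<forall>u\<in>v. openin (top_of_set E) u) \<and> pairwise disjnt v \<and>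
               (\<forall>u\<in>v. \<exists>q. homeomorphism u T fst q))"
      using T k0 v0 U(2) by (intro exI[of _ T] conjI exI[of _ "S ` G"]) (auto simp: T_def)
  qed
  then obtain h where h: "continuous_on K h" "h \<in> K \<rightarrow> E" "\<And>y. y \<in> K \<Longrightarrow> fst (h y) = y"
    using covering_space_lift[of E fst K K "\<lambda>x. x"] convex_imp_simply_connected[OF K]
      convex_imp_locally_path_connected[OF K] continuous_on_id[of K] by blast
  show ?thesis
  proof (rule that[of "snd \<circ> h"])
    show "continuous_on K (snd \<circ> h)" using h(1) by (auto intro: continuous_intros simp: comp_def)
    show "snd \<circ> h \<in> K \<rightarrow> Y" using h(2) by (auto simp: E_def Pi_iff)
    show "orbit_map G ((snd \<circ> h) k) = F k" if "k \<in> K" for k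
      using h(2,3) that by (force simp: E_def Pi_iff)
  qed
qed

end

section \<open>The fundamental group of the plane and the stabilizer of its circle\<close>

context covering_action
begin

text \<open>The segment from \<open>v\<close> to \<open>g v\<close> maps to a loop. A null-homotopy lifts to
  a square that is constant on three sides, so the lift of its fourth side is closed; it is a translate of
  the segment, whence \<open>g v = v\<close>.\<close>

theorem trivial_fundamental_group_imp_trivial_group:
  assumes Y: "convex Y" and s: "s \<in> topspace (orbit_space G Y)"
    and triv: "carrier (fundamental_group (orbit_space G Y) s) = {\<one>\<^bsub>fundamental_group (orbit_space G Y) s\<^esub>}"
  shows "G = {\<one>\<^bsub>PSL2C\<^esub>}"
proof -
  let ?X = "orbit_space G Y"
  obtain v where v: "v \<in> Y" "s = orbit_map G v" using s unfolding topspace_orbit_space by blast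
  have "g = \<one>\<^bsub>PSL2C\<^esub>" if g: "g \<in> G" for g
  proof -
    define c where "c = linepath v (act g v)"
    define p where "p t = orbit_map G (c t)" for t
    have c: "continuous_on {0..1} c" "c \<in> {0..1} \<rightarrow> Y" "c 0 = v" "c 1 = act g v"
    proof -
      show "continuous_on {0..1} c" by (simp add: c_def continuous_on_linepath)
      have "path_image c \<subseteq> Y"
        unfolding c_def path_image_linepath
        by (rule closed_segment_subset) (use v act_mem[OF g] Y in auto)
      then show "c \<in> {0..1} \<rightarrow> Y" by (auto simp: path_image_def)
    qed (simp_all add: c_def linepath_def)
    have "continuous_map (top_of_set {0..1}) (top_of_set Y) c"
      using c by (auto simp: continuous_map_in_subtopology)
    then have "continuous_map (top_of_set {0..1}) ?X (orbit_map G \<circ> c)"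
      by (rule continuous_map_compose[OF _ continuous_map_orbit_map])
    moreover have "orbit_map G \<circ> c = p" by (simp add: p_def fun_eq_iff)
    ultimately have "pathin ?X p" by (simp add: pathin_def)
    then have loop: "p \<in> loops ?X s"
      using c orbit_map_act[OF g v(1)] v(2) by (simp add: loops_def p_def)
    let ?R = "loop_homotopy ?X s"
    have "?R `` {p} \<in> carrier (fundamental_group ?X s)"
      using loop by (simp add: fundamental_group_def quotientI)
    then have "?R `` {p} = ?R `` {\<lambda>_. s}"
      unfolding triv by (simp add: fundamental_group_def)
    moreover have "p \<in> ?R `` {p}"
      using equiv_class_self[OF equiv_loop_homotopy loop] .
    ultimately have "(\<lambda>_. s, p) \<in> ?R" by blast
    then have "homotopic_with (\<lambda>h. h 0 = s \<and> h 1 = s) (top_of_set {0..1}) ?X (\<lambda>_. s) p"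
      by (simp add: loop_homotopy_def)
    then obtain H where H: "continuous_map (top_of_set ({0..1::real} \<times> {0..1})) ?X H"
      and H0: "\<And>x. H (0, x) = s" and H1: "\<And>x. H (1, x) = p x"
      and Hs: "\<And>t. t \<in> {0..1} \<Longrightarrow> H (t, 0) = s \<and> H (t, 1) = s"
      unfolding homotopic_with_def prod_topology_subtopology_eu by blast
    obtain h where h: "continuous_on ({0..1::real} \<times> {0..1}) h" "h \<in> ({0..1} \<times> {0..1}) \<rightarrow> Y"
      and hH: "\<And>k. k \<in> {0..1} \<times> {0..1} \<Longrightarrow> orbit_map G (h k) = H k"
      by (rule lift[OF convex_Times[OF convex_real_interval(5) convex_real_interval(5)] H]) blast
    \<comment> \<open>on the three sides where \<open>H\<close> is constant, so is its lift\<close>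
    have const: "h (q t) = h (q 0)"
      if q: "continuous_on {0..1} q" "q ` {0..1::real} \<subseteq> {0..1} \<times> {0..1}"
        and Hq: "\<And>t. t \<in> {0..1} \<Longrightarrow> H (q t) = s" and t: "t \<in> {0..1}" for q t
    proof (rule lift_unique[of "{0..1}" "\<lambda>t. h (q t)" "\<lambda>_. h (q 0)" 0 t])
      show "continuous_on {0..1} (\<lambda>t. h (q t))"
        by (rule continuous_on_compose2[OF h(1) q(1)]) (rule q(2))
      have q': "q t \<in> {0..1} \<times> {0..1}" if "t \<in> {0..1}" for t using q(2) that by blast
      show "(\<lambda>t. h (q t)) \<in> {0..1} \<rightarrow> Y" "(\<lambda>_. h (q 0)) \<in> {0..1} \<rightarrow> Y"
        using q' h(2) by auto
      show "orbit_map G (h (q k)) = orbit_map G (h (q 0))" if "k \<in> {0..1}" for k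
        using hH[OF q'[OF that]] hH[OF q'[of 0]] Hq[OF that] Hq[of 0] by simp
    qed (use t in auto)
    have "h (0, 1) = h (0, 0)" by (rule const[of "\<lambda>t. (0, t)" 1]) (auto intro!: continuous_intros simp: H0)
    moreover have "h (1, 0) = h (0, 0)" by (rule const[of "\<lambda>t. (t, 0)" 1]) (auto intro!: continuous_intros simp: Hs)
    moreover have "h (1, 1) = h (0, 1)" by (rule const[of "\<lambda>t. (t, 1)" 1]) (auto intro!: continuous_intros simp: Hs)
    ultimately have closed: "h (1, 0) = h (1, 1)" by simp
    have top: "continuous_on {0..1} (\<lambda>t. h (1, t))"
      by (rule continuous_on_compose2[OF h(1)]) (auto intro!: continuous_intros)
    obtain g' where g': "g' \<in> G" "\<And>t. t \<in> {0..1} \<Longrightarrow> h (1, t) = act g' (c t)"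
    proof (rule lift_unique_up_to_group[of "{0..1}" c "\<lambda>t. h (1, t)"])
      show "(\<lambda>t. h (1, t)) \<in> {0..1} \<rightarrow> Y" using h(2) by auto
      show "orbit_map G (c k) = orbit_map G (h (1, k))" if "k \<in> {0..1}" for k
        using hH[of "(1, k)"] that H1 by (simp add: p_def)
    qed (use c top in auto)
    have "act g' v = act g' (act g v)" using g'(2)[of 0] g'(2)[of 1] closed c by simp
    then have "act (inv\<^bsub>PSL2C\<^esub> g') (act g' v) = act (inv\<^bsub>PSL2C\<^esub> g') (act g' (act g v))" by simp
    then have fixed: "act g v = v"
      using act_inv_left[OF g'(1) v(1)] act_inv_left[OF g'(1) act_mem[OF g v(1)]] by simp
    obtain U where "v \<in> U" "\<forall>g\<in>G. \<forall>u\<in>U \<inter> Y. act g u \<in> U \<longrightarrow> g = \<one>\<^bsub>PSL2C\<^esub>"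
      using wandering[OF v(1)] by blast
    then show ?thesis using g v(1) fixed by (metis IntI)
  qed
  then show ?thesis using subgroup.one_closed[OF subgroup] by blast
qed

end

lemma act_convex_hull:
  assumes "g \<in> carrier PSL2C" "E \<subseteq> cball 0 1"
  shows "act g ` (convex hull E) \<subseteq> convex hull (act g ` E)"
proof -
  have "convex {w \<in> cball 0 1. act g w \<in> convex hull (act g ` E)}"
  proof (rule iffD2[OF convex_contains_segment], intro ballI subsetI)
    fix u v w assume uv: "u \<in> {w \<in> cball 0 1. act g w \<in> convex hull (act g ` E)}"
      "v \<in> {w \<in> cball 0 1. act g w \<in> convex hull (act g ` E)}" and w: "w \<in> closed_segment u v"
    have "act g w \<in> closed_segment (act g u) (act g v)"
      using act_segment[OF assms(1) _ _ w] uv by simp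
    moreover have "closed_segment (act g u) (act g v) \<subseteq> convex hull (act g ` E)"
      using uv by (intro closed_segment_subset) auto
    moreover have "closed_segment u v \<subseteq> cball 0 1"
      using uv by (intro closed_segment_subset) auto
    ultimately show "w \<in> {w \<in> cball 0 1. act g w \<in> convex hull (act g ` E)}" using w by blast
  qed
  moreover have "E \<subseteq> {w \<in> cball 0 1. act g w \<in> convex hull (act g ` E)}"
    using assms(2) by (auto intro: hull_inc)
  ultimately have "convex hull E \<subseteq> {w \<in> cball 0 1. act g w \<in> convex hull (act g ` E)}"
    by (intro hull_minimal)
  then show ?thesis by blast
qed

lemma hyp_hull_real_circle: "hyp_hull real_circle = {v \<in> H3. v $ 2 = 0}"
proof (intro equalityI subsetI)
  fix v assume v: "v \<in> hyp_hull real_circle"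
  have "convex {v :: real^3. v $ 2 = 0}"
    using convex_hyperplane[of "axis 2 1 :: real^3" 0] by (simp add: inner_axis' )
  then have "convex hull real_circle \<subseteq> {v. v $ 2 = 0}"
    by (intro hull_minimal) (auto simp: real_circle_def)
  then show "v \<in> {v \<in> H3. v $ 2 = 0}" using v by (auto simp: hyp_hull_def)
next
  fix v :: "real^3" assume v: "v \<in> {v \<in> H3. v $ 2 = 0}"
  then have "(norm v)\<^sup>2 < 1" by (simp add: power_less_one_iff)
  then have n: "(v$1)\<^sup>2 + (v$3)\<^sup>2 < 1" using v by (simp add: norm_sq_3)
  define r where "r = sqrt (1 - (v$3)\<^sup>2)"
  have "(v$3)\<^sup>2 < 1" using n zero_le_power2[of "v$1"] by linarith
  then have r: "r > 0" "r\<^sup>2 = 1 - (v$3)\<^sup>2" by (simp_all add: r_def)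
  have "(v$1)\<^sup>2 < r\<^sup>2" using n r by simp
  then have v1: "\<bar>v$1\<bar> < r" using r(1) by (intro power2_less_imp_less[of "\<bar>v$1\<bar>" r]) auto
  define a b :: "real^3" where "a = vector [- r, 0, v$3]" and "b = vector [r, 0, v$3]"
  have ab: "a \<in> real_circle" "b \<in> real_circle"
    using r(2) by (auto simp: real_circle_def a_def b_def norm_eq_sqrt_inner inner_vec_def sum_3 power2_eq_square)
  define t where "t = (v$1 + r) / (2 * r)"
  have "v = (1 - t) *\<^sub>R a + t *\<^sub>R b"
    using v r(1) by (simp add: vec_eq_iff forall_3 a_def b_def t_def field_simps)
  moreover have "0 \<le> t" "t \<le> 1" using v1 r(1) by (auto simp: t_def field_simps)
  ultimately have "v \<in> closed_segment a b" by (auto simp: in_segment)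
  moreover have "closed_segment a b \<subseteq> convex hull real_circle"
    using ab by (intro closed_segment_subset) (auto intro: hull_inc)
  ultimately show "v \<in> hyp_hull real_circle" using v by (auto simp: hyp_hull_def)
qed

lemma real_circle_subset: "real_circle \<subseteq> cball 0 1"
  by (auto simp: real_circle_def)

lemma circle_subset_S2: "x \<in> carrier PSL2C \<Longrightarrow> circle x \<subseteq> S2"
  unfolding circle_def real_circle_def using act_S2 by blast

lemma circle_subset: "x \<in> carrier PSL2C \<Longrightarrow> circle x \<subseteq> cball 0 1"
  using circle_subset_S2[of x] sphere_cball by blast

lemma mem_hyp_hull_circle_iff:
  assumes x: "x \<in> carrier PSL2C"
  shows "w \<in> hyp_hull (circle x) \<longleftrightarrow> w \<in> H3 \<and> act (inv\<^bsub>PSL2C\<^esub> x) w $ 2 = 0"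
proof -
  interpret group PSL2C by (rule PSL2C_group)
  have ix: "inv\<^bsub>PSL2C\<^esub> x \<in> carrier PSL2C" using x by simp
  have unmove: "act (inv\<^bsub>PSL2C\<^esub> x) ` circle x = real_circle"
    unfolding circle_def image_image using act_inv(1)[OF x] real_circle_subset by (simp add: subset_iff)
  show ?thesis
  proof (intro iffI conjI)
    assume w: "w \<in> hyp_hull (circle x)"
    then show wH: "w \<in> H3" by (simp add: hyp_hull_def)
    have "act (inv\<^bsub>PSL2C\<^esub> x) w \<in> convex hull real_circle"
      using act_convex_hull[OF ix circle_subset[OF x]] w by (auto simp: unmove hyp_hull_def)
    then have "act (inv\<^bsub>PSL2C\<^esub> x) w \<in> hyp_hull real_circle"
      using act_H3[OF ix wH] by (simp add: hyp_hull_def)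
    then show "act (inv\<^bsub>PSL2C\<^esub> x) w $ 2 = 0" by (simp add: hyp_hull_real_circle)
  next
    assume w: "w \<in> H3 \<and> act (inv\<^bsub>PSL2C\<^esub> x) w $ 2 = 0"
    then have "act (inv\<^bsub>PSL2C\<^esub> x) w \<in> hyp_hull real_circle"
      using act_H3[OF ix] by (simp add: hyp_hull_real_circle)
    then have "act x (act (inv\<^bsub>PSL2C\<^esub> x) w) \<in> convex hull (circle x)"
      using act_convex_hull[OF x real_circle_subset] by (auto simp: hyp_hull_def circle_def)
    moreover have "act x (act (inv\<^bsub>PSL2C\<^esub> x) w) = w"
      using w by (intro act_inv(2)[OF x]) simp
    ultimately show "w \<in> hyp_hull (circle x)" using w by (simp add: hyp_hull_def)
  qed
qed

lemma convex_hyp_hull: "convex (hyp_hull E)"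
  unfolding hyp_hull_def by (intro convex_Int convex_convex_hull convex_ball)

lemma to_PSL2C_real: "det A = 1 \<Longrightarrow> (\<And>i j. A $ i $ j \<in> \<real>) \<Longrightarrow> to_PSL2C A \<in> PSL2R"
  by (auto simp: PSL2R_def SL2C_def)

lemma PSL2R_obtain:
  assumes "h \<in> PSL2R"
  obtains A where "det A = 1" "h = to_PSL2C A" "\<forall>i j. A $ i $ j \<in> \<real>"
  using assms by (auto simp: PSL2R_def SL2C_def)

lemma PSL2R_subgroup: "subgroup PSL2R PSL2C"
proof -
  interpret group PSL2C by (rule PSL2C_group)
  show ?thesis
  proof (rule subgroupI)
    show "PSL2R \<subseteq> carrier PSL2C"
      by (auto elim!: PSL2R_obtain simp: carrier_PSL2C)
    have "to_PSL2C (mat 1) \<in> PSL2R"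
      by (rule to_PSL2C_real) (simp, auto simp: mat_def)
    then show "PSL2R \<noteq> {}" by blast
  next
    fix h assume "h \<in> PSL2R"
    then obtain A where A: "det A = 1" "h = to_PSL2C A" "\<forall>i j. A $ i $ j \<in> \<real>" by (rule PSL2R_obtain)
    have "\<forall>i j. adjugate A $ i $ j \<in> \<real>" using A(3) by (simp add: forall_2)
    then show "inv\<^bsub>PSL2C\<^esub> h \<in> PSL2R" unfolding A(2) inv_to_PSL2C[OF A(1)] using A(1) by (intro to_PSL2C_real) auto
  next
    fix h k assume "h \<in> PSL2R" "k \<in> PSL2R"
    then obtain A B where "det A = 1" "h = to_PSL2C A" "\<forall>i j. A $ i $ j \<in> \<real>"
      "det B = 1" "k = to_PSL2C B" "\<forall>i j. B $ i $ j \<in> \<real>" by (metis PSL2R_obtain)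
    then show "h \<otimes>\<^bsub>PSL2C\<^esub> k \<in> PSL2R"
      by (simp add: to_PSL2C_mult) (intro to_PSL2C_real; simp add: det_mul matrix2_mult_component)
  qed
qed

lemma act_PSL2R:
  assumes "h \<in> PSL2R" "v $ 2 = 0"
  shows "act h v $ 2 = 0"
proof -
  obtain A where A: "det A = 1" "h = to_PSL2C A" "\<forall>i j. A $ i $ j \<in> \<real>" using assms(1) by (rule PSL2R_obtain)
  have im: "Im (A $ i $ j) = 0" for i j using A(3) by (simp add: complex_is_Real_iff)
  have "Im ((A ** herm v ** conj_transpose A) $ 1 $ 2) = 0"
    using assms(2) by (simp add: matrix2_mult_component im)
  then show ?thesis by (simp add: A(2) act_to_PSL2C SL2C_act_def ball_point_def)
qed

lemma circle_stabilizer_iff: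
  assumes x: "x \<in> carrier PSL2C"
  shows "g \<in> circle_stabilizer x \<longleftrightarrow> g \<in> carrier PSL2C \<and> inv\<^bsub>PSL2C\<^esub> x \<otimes>\<^bsub>PSL2C\<^esub> g \<otimes>\<^bsub>PSL2C\<^esub> x \<in> PSL2R"
proof -
  interpret group PSL2C by (rule PSL2C_group)
  have sub: "h \<in> PSL2R \<Longrightarrow> h \<in> carrier PSL2C" for h using subgroup.mem_carrier[OF PSL2R_subgroup] .
  have ix: "inv\<^bsub>PSL2C\<^esub> x \<in> carrier PSL2C" using x by simp
  show ?thesis
  proof
    assume "g \<in> circle_stabilizer x"
    then obtain h where h: "h \<in> PSL2R" "g = x \<otimes>\<^bsub>PSL2C\<^esub> h \<otimes>\<^bsub>PSL2C\<^esub> inv\<^bsub>PSL2C\<^esub> x"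
      by (auto simp: circle_stabilizer_def)
    have "inv\<^bsub>PSL2C\<^esub> x \<otimes>\<^bsub>PSL2C\<^esub> g \<otimes>\<^bsub>PSL2C\<^esub> x = h"
      using sub[OF h(1)] x by (simp add: h(2) m_assoc inv_solve_left l_inv)
         (simp add: m_assoc[symmetric])
    then show "g \<in> carrier PSL2C \<and> inv\<^bsub>PSL2C\<^esub> x \<otimes>\<^bsub>PSL2C\<^esub> g \<otimes>\<^bsub>PSL2C\<^esub> x \<in> PSL2R"
      using h sub x by simp
  next
    assume g: "g \<in> carrier PSL2C \<and> inv\<^bsub>PSL2C\<^esub> x \<otimes>\<^bsub>PSL2C\<^esub> g \<otimes>\<^bsub>PSL2C\<^esub> x \<in> PSL2R"
    have "x \<otimes>\<^bsub>PSL2C\<^esub> (inv\<^bsub>PSL2C\<^esub> x \<otimes>\<^bsub>PSL2C\<^esub> g \<otimes>\<^bsub>PSL2C\<^esub> x) \<otimes>\<^bsub>PSL2C\<^esub> inv\<^bsub>PSL2C\<^esub> x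
       = (x \<otimes>\<^bsub>PSL2C\<^esub> inv\<^bsub>PSL2C\<^esub> x) \<otimes>\<^bsub>PSL2C\<^esub> g \<otimes>\<^bsub>PSL2C\<^esub> (x \<otimes>\<^bsub>PSL2C\<^esub> inv\<^bsub>PSL2C\<^esub> x)"
      using g x ix by (simp only: m_assoc m_closed)
    then have "g = x \<otimes>\<^bsub>PSL2C\<^esub> (inv\<^bsub>PSL2C\<^esub> x \<otimes>\<^bsub>PSL2C\<^esub> g \<otimes>\<^bsub>PSL2C\<^esub> x) \<otimes>\<^bsub>PSL2C\<^esub> inv\<^bsub>PSL2C\<^esub> x"
      using g x by (simp add: r_inv)
    then show "g \<in> circle_stabilizer x" unfolding circle_stabilizer_def using g by blast
  qed
qed

text \<open>Let \<open>J\<close> be the skew-symmetric matrix with \<open>B\<^sup>T J B = det B J\<close>.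
  The plane \<open>v\<^sub>2 = 0\<close> is orthogonal to the Hermitian matrix \<open>\<i> J\<close>, so if
  \<open>B\<close> preserves the plane, \<open>B\<^sup>* J B = k J\<close> with a real number
  \<open>k\<close>, and therefore \<open>B\<^sup>* = k B\<^sup>T\<close> and \<open>k =
  \<plusminus>1\<close>. The two signs mean that \<open>B\<close> keeps or exchanges the sides of the
  plane.\<close>

lemma real_or_imaginary_matrix:
  fixes B :: "complex^2^2"
  assumes det: "det B = 1"
    and B: "\<And>v. v \<in> H3 \<Longrightarrow> v $ 2 = 0 \<Longrightarrow> Im ((B ** herm v ** conj_transpose B) $ 1 $ 2) = 0"
  shows "(\<forall>i j. Im (B $ i $ j) = 0) \<or> (\<forall>i j. Re (B $ i $ j) = 0)"
proof -
  define p q r s where pqrs: "p = B$1$1" "q = B$1$2" "r = B$2$1" "s = B$2$2"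
  have d: "p * s - q * r = 1" using det by (simp add: det_2 pqrs)
  have H: "vector [a, 0, c] \<in> H3" if "a\<^sup>2 + c\<^sup>2 < 1" for a c :: real
  proof -
    have "(norm (vector [a, 0, c] :: real^3))\<^sup>2 < 1" using that by (simp add: norm_sq_3)
    then show ?thesis by (simp add: power_less_one_iff)
  qed
  have e: "Im (p * (1 + of_real c) * cnj r + p * of_real a * cnj s + q * of_real a * cnj r + q * (1 - of_real c) * cnj s) = 0"
    if "a\<^sup>2 + c\<^sup>2 < 1" for a c :: real
  proof -
    have "Complex a 0 = of_real a" by (simp add: complex_of_real_def)
    then show ?thesis
      using B[OF H[OF that]] by (simp add: matrix2_mult_component pqrs algebra_simps)
  qed
  have e0: "Im (p * cnj r) + Im (q * cnj s) = 0" using e[of 0 0] by simp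
  have "Im (p * cnj r) * 3 / 2 + Im (q * cnj s) / 2 = 0"
    using e[of 0 "1/2"] by (simp add: power2_eq_square field_simps)
  with e0 have pr: "Im (p * cnj r) = 0" and qs: "Im (q * cnj s) = 0" by linarith+
  have "Im (p * cnj s) / 2 + Im (q * cnj r) / 2 = 0"
    using e[of "1/2" 0] e0 by (simp add: power2_eq_square field_simps)
  then have ps: "Im (p * cnj s) + Im (q * cnj r) = 0" by linarith
  have pr': "cnj p * r = cnj r * p" and qs': "cnj q * s = cnj s * q"
    using pr qs by (auto simp: complex_eq_iff algebra_simps)
  \<comment> \<open>the off-diagonal entry of \<open>B\<^sup>* J B\<close>; the diagonal entries vanish by \<open>pr'\<close> and \<open>qs'\<close>\<close>
  define k where "k = cnj p * s - cnj r * q"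
  have kr: "cnj k = k" using ps by (simp add: k_def complex_eq_iff algebra_simps)
  have kc: "k = p * cnj s - r * cnj q" using kr by (simp add: k_def)
  have "k * p = cnj p * (p * s - q * r)"
    unfolding k_def using pr' by algebra
  moreover have "k * r = cnj r * (p * s - q * r)"
    unfolding k_def using pr' by algebra
  moreover have "k * q = cnj q * (p * s - q * r)"
    unfolding kc using qs' by algebra
  moreover have "k * s = cnj s * (p * s - q * r)"
    unfolding kc using qs' by algebra
  ultimately have kz: "k * p = cnj p" "k * r = cnj r" "k * q = cnj q" "k * s = cnj s" by (simp_all add: d)
  obtain \<kappa> where \<kappa>: "k = of_real \<kappa>" using kr by (metis Reals_cases Reals_cnj_iff)
  have "p \<noteq> 0 \<or> q \<noteq> 0" using d by auto
  then have "norm k = 1"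
    using kz(1,3) by (metis complex_mod_cnj mult_cancel_right1 norm_eq_zero norm_mult)
  then have "\<kappa> = 1 \<or> \<kappa> = - 1" by (simp add: \<kappa>) linarith
  then show ?thesis
    using kz by (auto simp: \<kappa> forall_2 complex_eq_iff pqrs)
qed

context kleinian_group
begin

lemma covering_action_subgroup:
  assumes "subgroup G PSL2C" "G \<subseteq> \<Gamma>" "Y \<subseteq> H3 \<union> domain_of_discontinuity \<Gamma>"
    "\<And>g v. g \<in> G \<Longrightarrow> v \<in> Y \<Longrightarrow> act g v \<in> Y"
  shows "covering_action G Y"
proof (rule covering_action.intro)
  have Yc: "Y \<subseteq> cball 0 1"
    using assms(3) by (auto simp: domain_of_discontinuity_def)
  then show "Y \<subseteq> cball 0 1" .
  fix v assume "v \<in> Y"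
  then have "v \<in> H3 \<union> domain_of_discontinuity \<Gamma>" using assms(3) by blast
  then obtain e where e: "e > 0"
    "\<And>g u. g \<in> \<Gamma> \<Longrightarrow> u \<in> cball 0 1 \<Longrightarrow> u \<in> ball v e \<Longrightarrow> act g u \<in> ball v e \<Longrightarrow> g = \<one>\<^bsub>PSL2C\<^esub>"
    using wandering_neighbourhood by blast
  have "\<forall>g\<in>G. \<forall>u\<in>ball v e \<inter> Y. act g u \<in> ball v e \<longrightarrow> g = \<one>\<^bsub>PSL2C\<^esub>"
    using e(2) assms(2) Yc by blast
  then show "\<exists>U. open U \<and> v \<in> U \<and> (\<forall>g\<in>G. \<forall>u\<in>U \<inter> Y. act g u \<in> U \<longrightarrow> g = \<one>\<^bsub>PSL2C\<^esub>)"
    using e(1) by (intro exI[of _ "ball v e"]) simp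
qed (use assms in auto)

lemma subgroup_circle_stabilizer:
  assumes x: "x \<in> carrier PSL2C"
  shows "subgroup (\<Gamma> \<inter> circle_stabilizer x) PSL2C"
proof -
  interpret group PSL2C by (rule PSL2C_group)
  have ix: "inv\<^bsub>PSL2C\<^esub> x \<in> carrier PSL2C" using x by simp
  note iff = circle_stabilizer_iff[OF x]
  note R = PSL2R_subgroup
  have conj_mult: "inv\<^bsub>PSL2C\<^esub> x \<otimes>\<^bsub>PSL2C\<^esub> (g \<otimes>\<^bsub>PSL2C\<^esub> h) \<otimes>\<^bsub>PSL2C\<^esub> x =
     (inv\<^bsub>PSL2C\<^esub> x \<otimes>\<^bsub>PSL2C\<^esub> g \<otimes>\<^bsub>PSL2C\<^esub> x) \<otimes>\<^bsub>PSL2C\<^esub> (inv\<^bsub>PSL2C\<^esub> x \<otimes>\<^bsub>PSL2C\<^esub> h \<otimes>\<^bsub>PSL2C\<^esub> x)"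
    if "g \<in> carrier PSL2C" "h \<in> carrier PSL2C" for g h
    using that x ix r_inv[OF x] by (metis (no_types, opaque_lifting) m_assoc m_closed r_one)
  show ?thesis
  proof (rule subgroupI)
    show "\<Gamma> \<inter> circle_stabilizer x \<subseteq> carrier PSL2C" using in_PSL2C by blast
    have "\<one>\<^bsub>PSL2C\<^esub> \<in> \<Gamma> \<inter> circle_stabilizer x"
      using one_mem subgroup.one_closed[OF R] x by (simp add: iff)
    then show "\<Gamma> \<inter> circle_stabilizer x \<noteq> {}" by blast
  next
    fix g h assume gh: "g \<in> \<Gamma> \<inter> circle_stabilizer x" "h \<in> \<Gamma> \<inter> circle_stabilizer x"
    then show "g \<otimes>\<^bsub>PSL2C\<^esub> h \<in> \<Gamma> \<inter> circle_stabilizer x"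
      using conj_mult[of g h] subgroup.m_closed[OF R] mult_mem by (auto simp: iff)
  next
    fix g assume g: "g \<in> \<Gamma> \<inter> circle_stabilizer x"
    then have gc: "g \<in> carrier PSL2C" using in_PSL2C by blast
    have "inv\<^bsub>PSL2C\<^esub> x \<otimes>\<^bsub>PSL2C\<^esub> (inv\<^bsub>PSL2C\<^esub> g) \<otimes>\<^bsub>PSL2C\<^esub> x = inv\<^bsub>PSL2C\<^esub> (inv\<^bsub>PSL2C\<^esub> x \<otimes>\<^bsub>PSL2C\<^esub> g \<otimes>\<^bsub>PSL2C\<^esub> x)"
      using gc x ix by (simp add: inv_mult_group m_assoc)
    then show "inv\<^bsub>PSL2C\<^esub> g \<in> \<Gamma> \<inter> circle_stabilizer x"
      using g gc subgroup.m_inv_closed[OF R] inv_mem by (auto simp: iff)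
  qed
qed

lemma act_circle_stabilizer:
  assumes x: "x \<in> carrier PSL2C" and g: "g \<in> circle_stabilizer x" and w: "w \<in> hyp_hull (circle x)"
  shows "act g w \<in> hyp_hull (circle x)"
proof -
  interpret group PSL2C by (rule PSL2C_group)
  have ix: "inv\<^bsub>PSL2C\<^esub> x \<in> carrier PSL2C" using x by simp
  have gc: "g \<in> carrier PSL2C" and gR: "inv\<^bsub>PSL2C\<^esub> x \<otimes>\<^bsub>PSL2C\<^esub> g \<otimes>\<^bsub>PSL2C\<^esub> x \<in> PSL2R"
    using g by (simp_all add: circle_stabilizer_iff[OF x])
  have wH: "w \<in> H3" and w2: "act (inv\<^bsub>PSL2C\<^esub> x) w $ 2 = 0"
    using w by (simp_all add: mem_hyp_hull_circle_iff[OF x])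
  define u where "u = act (inv\<^bsub>PSL2C\<^esub> x) w"
  have uH: "u \<in> H3" unfolding u_def by (rule act_H3[OF ix wH])
  have uc: "u \<in> cball 0 1" using uH by simp
  have xu: "act x u = w" unfolding u_def using wH by (intro act_inv(2)[OF x]) simp
  have wc: "w \<in> cball 0 1" using wH by simp
  have "act (inv\<^bsub>PSL2C\<^esub> x \<otimes>\<^bsub>PSL2C\<^esub> g \<otimes>\<^bsub>PSL2C\<^esub> x) u = act (inv\<^bsub>PSL2C\<^esub> x) (act g w)"
    unfolding act_mult[OF m_closed[OF ix gc] x uc] xu act_mult[OF ix gc wc] ..
  then have "act (inv\<^bsub>PSL2C\<^esub> x) (act g w) $ 2 = 0" using act_PSL2R[OF gR, of u] w2 by (simp add: u_def)
  then show ?thesis using act_H3[OF gc wH] by (simp add: mem_hyp_hull_circle_iff[OF x])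
qed

theorem trivial_fundamental_group_imp_trivial_stabilizer:
  assumes x: "x \<in> carrier PSL2C" and s: "s \<in> topspace (plane_surface \<Gamma> x)"
    and triv: "carrier (fundamental_group (plane_surface \<Gamma> x) s) = {\<one>\<^bsub>fundamental_group (plane_surface \<Gamma> x) s\<^esub>}"
  shows "\<Gamma> \<inter> circle_stabilizer x = {\<one>\<^bsub>PSL2C\<^esub>}"
proof -
  interpret covering_action "\<Gamma> \<inter> circle_stabilizer x" "hyp_hull (circle x)"
  proof (rule covering_action_subgroup[OF subgroup_circle_stabilizer[OF x]])
    show "hyp_hull (circle x) \<subseteq> H3 \<union> domain_of_discontinuity \<Gamma>" by (auto simp: hyp_hull_def)
    show "act g v \<in> hyp_hull (circle x)" if "g \<in> \<Gamma> \<inter> circle_stabilizer x" "v \<in> hyp_hull (circle x)" for g v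
      using that act_circle_stabilizer[OF x] by blast
  qed blast
  show ?thesis
    using trivial_fundamental_group_imp_trivial_group[OF convex_hyp_hull] s triv by (simp add: plane_surface_def)
qed

text \<open>An element that preserves the plane and its sides stabilizes the oriented circle. The square of
  one that exchanges the sides does, so this element is trivial because the group is torsion-free.\<close>

lemma plane_stabilizer_trivial:
  assumes x: "x \<in> carrier PSL2C" and triv: "\<Gamma> \<inter> circle_stabilizer x = {\<one>\<^bsub>PSL2C\<^esub>}"
    and g: "g \<in> \<Gamma>" and inv: "\<And>w. w \<in> hyp_hull (circle x) \<Longrightarrow> act g w \<in> hyp_hull (circle x)"
  shows "g = \<one>\<^bsub>PSL2C\<^esub>"
proof -
  interpret group PSL2C by (rule PSL2C_group)
  have ix: "inv\<^bsub>PSL2C\<^esub> x \<in> carrier PSL2C" using x by simp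
  have gc: "g \<in> carrier PSL2C" using in_PSL2C[OF g] .
  define k where "k = inv\<^bsub>PSL2C\<^esub> x \<otimes>\<^bsub>PSL2C\<^esub> g \<otimes>\<^bsub>PSL2C\<^esub> x"
  have kc: "k \<in> carrier PSL2C" using x ix gc by (simp add: k_def)
  define B where "B = representative k"
  have B: "det B = 1" "to_PSL2C B = k" using representative[OF kc] by (simp_all add: B_def)
  have "Im ((B ** herm v ** conj_transpose B) $ 1 $ 2) = 0" if v: "v \<in> H3" "v $ 2 = 0" for v
  proof -
    have vc: "v \<in> cball 0 1" using v by simp
    have xv: "act x v \<in> H3" using act_H3[OF x v(1)] .
    have xvc: "act x v \<in> cball 0 1" using xv by simp
    have "act x v \<in> hyp_hull (circle x)"
      using xv v act_inv(1)[OF x vc] by (simp add: mem_hyp_hull_circle_iff[OF x])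
    then have "act g (act x v) \<in> hyp_hull (circle x)" by (rule inv)
    then have "act (inv\<^bsub>PSL2C\<^esub> x) (act g (act x v)) $ 2 = 0" by (simp add: mem_hyp_hull_circle_iff[OF x])
    then have "act k v $ 2 = 0"
      unfolding k_def act_mult[OF m_closed[OF ix gc] x vc] act_mult[OF ix gc xvc] .
    then have "SL2C_act B v $ 2 = 0" using act_to_PSL2C[of B v] by (simp add: B)
    then have "Im ((SL2C_weight B v *\<^sub>R herm (SL2C_act B v)) $ 1 $ 2) = 0" by simp
    then show ?thesis unfolding SL2C_act_herm[OF B(1) vc] .
  qed
  from real_or_imaginary_matrix[OF B(1) this] have "(\<forall>i j. Im (B $ i $ j) = 0) \<or> (\<forall>i j. Re (B $ i $ j) = 0)" .
  then show ?thesis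
  proof
    assume "\<forall>i j. Im (B $ i $ j) = 0"
    then have "k \<in> PSL2R" unfolding B(2)[symmetric] by (intro to_PSL2C_real B(1)) (simp add: complex_is_Real_iff)
    then have "g \<in> \<Gamma> \<inter> circle_stabilizer x" using g gc by (simp add: circle_stabilizer_iff[OF x] k_def)
    then show ?thesis by (simp add: triv)
  next
    assume im: "\<forall>i j. Re (B $ i $ j) = 0"
    have "to_PSL2C (B ** B) \<in> PSL2R"
    proof (rule to_PSL2C_real)
      show "det (B ** B) = 1" by (simp add: det_mul B)
      show "(B ** B) $ i $ j \<in> \<real>" for i j
        using im by (simp add: matrix2_mult_component complex_is_Real_iff)
    qed
    then have "k \<otimes>\<^bsub>PSL2C\<^esub> k \<in> PSL2R" using to_PSL2C_mult[OF B(1) B(1)] B(2) by simp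
    moreover have "k \<otimes>\<^bsub>PSL2C\<^esub> k = inv\<^bsub>PSL2C\<^esub> x \<otimes>\<^bsub>PSL2C\<^esub> (g \<otimes>\<^bsub>PSL2C\<^esub> g) \<otimes>\<^bsub>PSL2C\<^esub> x"
      unfolding k_def using x ix gc r_inv[OF x] by (metis (no_types, opaque_lifting) m_assoc m_closed r_one)
    ultimately have "g \<otimes>\<^bsub>PSL2C\<^esub> g \<in> \<Gamma> \<inter> circle_stabilizer x"
      using g gc mult_mem by (simp add: circle_stabilizer_iff[OF x])
    then have "g [^]\<^bsub>PSL2C\<^esub> (2::nat) = \<one>\<^bsub>PSL2C\<^esub>"
      using gc by (simp add: triv numeral_2_eq_2)
    then show ?thesis
      using kleinian g unfolding torsion_free_discrete_subgroup_def by (metis zero_less_numeral)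
  qed
qed

end

section \<open>Incompressible boundary and connectedness of the limit set\<close>

lemma continuous_logarithm_componentwise:
  fixes f :: "'a :: real_normed_vector \<Rightarrow> complex"
  assumes f: "continuous_on S f" "\<And>x. x \<in> S \<Longrightarrow> f x \<noteq> 0"
    and S: "locally path_connected S" "\<And>C. C \<in> components S \<Longrightarrow> simply_connected C"
  obtains g where "continuous_on S g" "\<And>x. x \<in> S \<Longrightarrow> f x = exp (g x)"
proof -
  have lc: "locally connected S"
    using S(1) by (rule locally_path_connected_imp_locally_connected)
  have "\<exists>g. continuous_on C g \<and> (\<forall>x\<in>C. f x = exp (g x))" if C: "C \<in> components S" for C
  proof -
    have CS: "C \<subseteq> S" using C by (rule in_components_subset)
    have "locally path_connected C"
      using locally_open_subset[OF S(1) openin_components_locally_connected[OF lc C]] .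
    then obtain g where "continuous_on C g" "\<And>x. x \<in> C \<Longrightarrow> f x = exp (g x)"
      using continuous_logarithm_on_simply_connected[OF continuous_on_subset[OF f(1) CS] S(2)[OF C]] f(2) CS by blast
    then show ?thesis by blast
  qed
  then have "\<forall>C\<in>components S. \<exists>g. continuous_on C g \<and> (\<forall>x\<in>C. f x = exp (g x))" by blast
  then obtain G where G: "\<And>C. C \<in> components S \<Longrightarrow> continuous_on C (G C)"
    "\<And>C x. C \<in> components S \<Longrightarrow> x \<in> C \<Longrightarrow> f x = exp (G C x)"
    using bchoice[of "components S" "\<lambda>C g. continuous_on C g \<and> (\<forall>x\<in>C. f x = exp (g x))"] by blast
  define g where "g x = G (connected_component_set S x) x" for x
  have gG: "g x = G C x" if "C \<in> components S" "x \<in> C" for C x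
  proof -
    have "connected_component_set S x = C"
      using that by (metis components_iff connected_component_eq)
    then show ?thesis by (simp add: g_def)
  qed
  show ?thesis
  proof (rule that)
    show "continuous_on S g"
      using continuous_on_components[OF lc] G(1) gG by (metis continuous_on_cong)
    fix x assume "x \<in> S"
    then obtain C where "C \<in> components S" "x \<in> C" by (metis Union_components UnionE)
    then show "f x = exp (g x)" using G(2) gG by simp
  qed
qed

text \<open>The exponential of a logarithm of \<open>z - b\<close> times a cut-off function extends to a
  nonvanishing function on the plane that is \<open>z - b\<close> near \<open>A\<close> and near infinity
  and \<open>1\<close> near \<open>B\<close>. Its normalization retracts a large disc to its
  boundary.\<close>

lemma no_logarithm_on_separating_complement:
  fixes A B :: "complex set"
  assumes A: "closed A" and B: "compact B" and AB: "A \<inter> B = {}" and b: "b \<in> B"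
  shows "\<not> (\<exists>g. continuous_on (- (A \<union> B)) g \<and> (\<forall>z\<in>- (A \<union> B). z - b = exp (g z)))"
proof
  assume "\<exists>g. continuous_on (- (A \<union> B)) g \<and> (\<forall>z\<in>- (A \<union> B). z - b = exp (g z))"
  then obtain g where g: "continuous_on (- (A \<union> B)) g" "\<And>z. z \<in> - (A \<union> B) \<Longrightarrow> z - b = exp (g z)" by blast
  obtain R where R: "R > 0" "B \<subseteq> ball b R"
    using compact_imp_bounded[OF B] bounded_subset_ballD[of B b] by metis
  define A' where "A' = A \<union> {z. R \<le> dist b z}"
  have "closed {z. R \<le> dist b z}"
    by (intro closed_Collect_le continuous_intros)
  then have A': "closed A'" unfolding A'_def by (intro closed_Un A)
  have A'B: "A' \<inter> B = {}" using AB R(2) by (auto simp: A'_def)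
  \<comment> \<open>between the levels \<open>1\<close> and \<open>2\<close> of \<open>f\<close>, away from \<open>A'\<close> and \<open>B\<close>, the function \<open>h\<close> interpolates with the logarithm\<close>
  obtain f :: "complex \<Rightarrow> real" where f: "continuous_on UNIV f"
    and fA: "\<And>z. z \<in> A' \<Longrightarrow> f z = 3" and fB: "\<And>z. z \<in> B \<Longrightarrow> f z = 0"
    using Urysohn_local[of UNIV A' B "3::real" 0] A' A'B compact_imp_closed[OF B] by (metis closed_closedin subtopology_UNIV)
  define h where "h z = (if f z \<le> 1 then 1 else if f z \<le> 2 then exp (of_real (f z - 1) * g z) else z - b)" for z
  have cl: "closed {z. f z \<le> 1}" "closed {z. 1 \<le> f z \<and> f z \<le> 2}" "closed {z. 2 \<le> f z}"
    "closed {z. 1 \<le> f z}"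
    by (intro closed_Collect_le closed_Collect_conj f continuous_intros)+
  have mid: "{z. 1 \<le> f z \<and> f z \<le> 2} \<subseteq> - (A \<union> B)"
  proof
    fix z assume "z \<in> {z. 1 \<le> f z \<and> f z \<le> 2}"
    then show "z \<in> - (A \<union> B)" using fA[of z] fB[of z] by (auto simp: A'_def)
  qed
  have "continuous_on {z. 1 \<le> f z \<and> f z \<le> 2} (\<lambda>z. exp (of_real (f z - 1) * g z))"
    by (intro continuous_intros continuous_on_subset[OF f] continuous_on_subset[OF g(1)] mid) auto
  moreover have "continuous_on {z. 2 \<le> f z} (\<lambda>z. z - b)" by (intro continuous_intros)
  ultimately have gl: "continuous_on ({z. 1 \<le> f z \<and> f z \<le> 2} \<union> {z. 2 \<le> f z})
     (\<lambda>z. if f z \<le> 2 then exp (of_real (f z - 1) * g z) else z - b)"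
    using mid by (intro continuous_on_cases[OF cl(2,3)]) (auto simp: subset_iff g(2))
  moreover have "{z. 1 \<le> f z \<and> f z \<le> 2} \<union> {z. 2 \<le> f z} = {z. 1 \<le> f z}" by auto
  ultimately have "continuous_on {z. 1 \<le> f z} (\<lambda>z. if f z \<le> 2 then exp (of_real (f z - 1) * g z) else z - b)"
    by simp
  then have "continuous_on ({z. f z \<le> 1} \<union> {z. 1 \<le> f z}) h"
    unfolding h_def by (intro continuous_on_cases[OF cl(1,4) continuous_on_const]) auto
  moreover have "{z. f z \<le> 1} \<union> {z. 1 \<le> f z} = UNIV" by auto
  ultimately have h: "continuous_on UNIV h" by simp
  have h0: "h z \<noteq> 0" for z using fB[OF b] by (auto simp: h_def)
  have hR: "h z = z - b" if "R \<le> dist b z" for z using fA[of z] that by (simp add: h_def A'_def)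
  have "retraction (cball b R) (frontier (cball b R)) (\<lambda>z. b + (of_real R / of_real (norm (h z))) * h z)"
    unfolding retraction_def
  proof (intro conjI)
    show "continuous_on (cball b R) (\<lambda>z. b + (of_real R / of_real (norm (h z))) * h z)"
      by (intro continuous_intros continuous_on_subset[OF h]) (auto simp: h0)
    show "(\<lambda>z. b + (of_real R / of_real (norm (h z))) * h z) \<in> cball b R \<rightarrow> frontier (cball b R)"
      using R(1) h0 by (auto simp: dist_norm norm_mult norm_divide)
    show "\<forall>z\<in>frontier (cball b R). b + (of_real R / of_real (norm (h z))) * h z = z"
    proof
      fix z assume "z \<in> frontier (cball b R)"
      then have z: "dist b z = R" using R(1) by simp
      then have "norm (h z) = R" "h z = z - b" using hR[of z] by (simp_all add: dist_norm norm_minus_commute)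
      then show "b + (of_real R / of_real (norm (h z))) * h z = z" using R(1) by simp
    qed
  qed auto
  then show False using no_retraction_cball[OF R(1), of b] by (auto simp: retract_of_def)
qed

text \<open>If \<open>L\<close> is the disjoint union of nonempty closed sets \<open>A\<close> and
  \<open>B\<close>, send a point of \<open>A\<close> to infinity. The difference of the resulting coordinate
  and its value at a point of \<open>B\<close> has a logarithm on each simply connected component.\<close>

theorem connected_complement_of_simply_connected_components:
  fixes L :: "(real^3) set"
  assumes L: "compact L" "L \<subseteq> S2" and sc: "\<And>C. C \<in> components (S2 - L) \<Longrightarrow> simply_connected C"
  shows "connected L"
proof (rule ccontr)
  assume "\<not> connected L"
  then obtain A B where AB: "closed A" "closed B" "A \<noteq> {}" "B \<noteq> {}" "A \<union> B = L" "A \<inter> B = {}"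
    using connected_closed_set[OF compact_imp_closed[OF L(1)]] by auto
  obtain a b where a: "a \<in> A" and b: "b \<in> B" using AB by blast
  have AL: "A \<subseteq> L" "B \<subseteq> L" using AB(5) by blast+
  have LAB: "w \<in> L \<longleftrightarrow> w \<in> A \<or> w \<in> B" for w using AB(5) by blast
  have aS: "a \<in> S2" and aL: "a \<in> L" "b \<in> L" using a b AL L(2) by blast+
  have ab: "a \<notin> B" "b \<notin> A" using a b AB(6) by blast+
  have "S2 - {a} homeomorphic (UNIV :: complex set)"
    by (rule homeomorphic_punctured_sphere_affine) (use aS in auto)
  then obtain \<phi> \<psi> where hom: "homeomorphism (S2 - {a}) (UNIV :: complex set) \<phi> \<psi>"
    by (auto simp: homeomorphic_def)
  have \<phi>: "continuous_on (S2 - {a}) \<phi>" and \<psi>: "continuous_on UNIV \<psi>" and im: "\<psi> ` UNIV = S2 - {a}"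
    and \<phi>\<psi>: "\<And>z. \<phi> (\<psi> z) = z" and \<psi>\<phi>: "\<And>w. w \<in> S2 - {a} \<Longrightarrow> \<psi> (\<phi> w) = w"
    using hom unfolding homeomorphism_def by blast+
  have \<psi>S: "\<psi> z \<in> S2 - {a}" for z using im by blast
  have bS: "b \<in> S2 - {a}"
  proof
    show "b \<in> S2" by (rule subsetD[OF L(2) aL(2)])
    show "b \<notin> {a}" using a ab(2) by (metis singletonD)
  qed
  have op: "openin (top_of_set S2) (S2 - L)"
    unfolding Diff_eq by (intro openin_open_Int open_Compl compact_imp_closed L(1))
  have lpc: "locally path_connected (S2 - L)"
    by (rule locally_open_subset[OF locally_path_connected_sphere op])
  have "continuous_on (S2 - L) (\<lambda>w. \<phi> w - \<phi> b)"
    using aL by (intro continuous_intros continuous_on_subset[OF \<phi>]) auto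
  moreover have "\<phi> w - \<phi> b \<noteq> 0" if "w \<in> S2 - L" for w
  proof
    assume "\<phi> w - \<phi> b = 0"
    then have "w = b" using \<psi>\<phi>[of w] \<psi>\<phi>[OF bS] that aL by auto
    then show False using that aL by simp
  qed
  ultimately obtain g where g: "continuous_on (S2 - L) g" "\<And>w. w \<in> S2 - L \<Longrightarrow> \<phi> w - \<phi> b = exp (g w)"
    using continuous_logarithm_componentwise[OF _ _ lpc sc] by blast
  define A' B' where "A' = \<psi> -` A" and "B' = \<psi> -` B"
  have A': "closed A'" unfolding A'_def by (rule closed_vimage[OF AB(1) \<psi>])
  have BS: "B \<subseteq> S2 - {a}" using AL L(2) ab by blast
  have "B' = \<phi> ` B"
  proof (intro equalityI subsetI)
    fix z assume "z \<in> B'"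
    then show "z \<in> \<phi> ` B" using \<phi>\<psi>[of z] unfolding B'_def by force
  next
    fix z assume "z \<in> \<phi> ` B"
    then obtain w where w: "w \<in> B" "z = \<phi> w" by blast
    then have "\<psi> z = w" using \<psi>\<phi>[of w] BS by blast
    then show "z \<in> B'" using w(1) by (simp add: B'_def)
  qed
  moreover have "B = B \<inter> L" using AB by blast
  then have "compact B" using closed_Int_compact[OF AB(2) L(1)] by simp
  ultimately have B': "compact B'" using compact_continuous_image[OF continuous_on_subset[OF \<phi> BS]] by simp
  have c: "\<psi> z \<in> S2 - L" if "z \<in> - (A' \<union> B')" for z
    using that \<psi>S[of z] by (auto simp: A'_def B'_def LAB)
  have "continuous_on (- (A' \<union> B')) (\<lambda>z. g (\<psi> z))"
    by (rule continuous_on_compose2[OF g(1) continuous_on_subset[OF \<psi>]]) (use c in auto)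
  moreover have "z - \<phi> b = exp (g (\<psi> z))" if "z \<in> - (A' \<union> B')" for z
    using g(2)[OF c[OF that]] \<phi>\<psi> by simp
  moreover have "A' \<inter> B' = {}" using AB(6) unfolding A'_def B'_def by blast
  moreover have "\<phi> b \<in> B'" using \<psi>\<phi>[OF bS] b by (simp add: B'_def)
  ultimately show False
    using no_logarithm_on_separating_complement[OF A' B', of "\<phi> b"] by blast
qed

context kleinian_group
begin

lemma act_mem_domain:
  assumes "g \<in> \<Gamma>" "v \<in> H3 \<union> domain_of_discontinuity \<Gamma>"
  shows "act g v \<in> H3 \<union> domain_of_discontinuity \<Gamma>"
proof -
  note gc = in_PSL2C[OF assms(1)]
  show ?thesis
  proof (cases "v \<in> H3")
    case True then show ?thesis using act_H3[OF gc] by blast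
  next
    case False
    then have v: "v \<in> S2" "v \<notin> limit_set \<Gamma>" using assms(2) by (auto simp: domain_of_discontinuity_def)
    have vc: "v \<in> cball 0 1" using v(1) by auto
    have "act g v \<notin> limit_set \<Gamma>"
      using act_mem_limit_set[OF inv_mem[OF assms(1)], of "act g v"] act_inv(1)[OF gc vc] v(2) by auto
    then show ?thesis using act_S2[OF gc v(1)] by (simp add: domain_of_discontinuity_def)
  qed
qed

lemma covering_action_Mbar: "covering_action \<Gamma> (H3 \<union> domain_of_discontinuity \<Gamma>)"
  by (rule covering_action_subgroup[OF subgroup]) (use act_mem_domain in auto)

text \<open>It suffices to contract a loop \<open>f\<close> in a component of the domain of discontinuity.
  The cone over \<open>f\<close> with apex \<open>0\<close> is a disc with boundary in the domain. A
  deformation of its image into the boundary of \<open>Mbar\<close> lifts, and the lift first moves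
  \<open>f\<close> inside the domain and then bounds a disc there.\<close>

theorem incompressible_imp_connected_limit_set:
  assumes inc: "incompressible_boundary (Mbar \<Gamma>) (boundary_Mbar \<Gamma>)"
  shows "connected (limit_set \<Gamma>)"
proof (rule connected_complement_of_simply_connected_components[OF compact_limit_set limit_set_subset])
  let ?\<Omega> = "domain_of_discontinuity \<Gamma>"
  let ?Y = "H3 \<union> ?\<Omega>"
  interpret covering_action \<Gamma> ?Y by (rule covering_action_Mbar)
  fix C assume "C \<in> components (S2 - limit_set \<Gamma>)"
  then have C: "C \<in> components ?\<Omega>" by (simp add: domain_of_discontinuity_def)
  have CO: "C \<subseteq> ?\<Omega>" using C by (rule in_components_subset)
  have op: "openin (top_of_set S2) ?\<Omega>"
    unfolding domain_of_discontinuity_def Diff_eq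
    by (intro openin_open_Int open_Compl compact_imp_closed compact_limit_set)
  have lpc: "locally path_connected ?\<Omega>"
    by (rule locally_open_subset[OF locally_path_connected_sphere op])
  obtain x where "C = connected_component_set ?\<Omega> x" using C by (auto simp: components_def)
  then have "C = path_component_set ?\<Omega> x"
    using path_component_eq_connected_component_set[OF lpc] by simp
  then have pc: "path_connected C" by simp
  have boundary: "v \<in> ?\<Omega>" if v: "v \<in> ?Y" "orbit_map \<Gamma> v \<in> boundary_Mbar \<Gamma>" for v
  proof -
    obtain w where w: "w \<in> ?\<Omega>" "orbit_map \<Gamma> v = orbit_map \<Gamma> w" using v(2) by (auto simp: boundary_Mbar_def)
    then obtain g where g: "g \<in> \<Gamma>" "v = act g w" using orbit_map_eq_iff[of w v] v(1) by auto
    have "w \<in> S2" using w by (simp add: domain_of_discontinuity_def)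
    then have "v \<in> S2" using act_S2[OF in_PSL2C[OF g(1)]] g(2) by simp
    then show ?thesis using v(1) by auto
  qed
  have "\<exists>c. homotopic_with_canon (\<lambda>h. True) (sphere 0 1) C f (\<lambda>x. c)"
    if f: "continuous_on (sphere 0 1) f" "f ` sphere 0 1 \<subseteq> C" for f :: "complex \<Rightarrow> real^3"
  proof -
    have f\<Omega>: "f z \<in> ?\<Omega>" if "z \<in> sphere 0 1" for z using f(2) CO that by blast
    \<comment> \<open>the cone over \<open>f\<close> with apex \<open>0\<close>\<close>
    have "homotopic_with_canon (\<lambda>h. True) (sphere 0 1) ?Y f (\<lambda>_. 0)"
    proof (rule homotopic_with_linear[OF f(1) continuous_on_const])
      fix z :: complex assume z: "z \<in> sphere 0 1"
      show "closed_segment (f z) 0 \<subseteq> ?Y"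
      proof
        fix w assume "w \<in> closed_segment (f z) 0"
        then obtain t where t: "0 \<le> t" "t \<le> 1" "w = (1 - t) *\<^sub>R f z" by (auto simp: in_segment)
        have "norm (f z) = 1" using f\<Omega>[OF z] by (simp add: domain_of_discontinuity_def)
        then show "w \<in> ?Y" using t f\<Omega>[OF z] by (cases "t = 0") auto
      qed
    qed
    then obtain F0 where F0: "continuous_on (cball 0 1) F0" "F0 ` cball 0 1 \<subseteq> ?Y" "\<And>z. z \<in> sphere 0 1 \<Longrightarrow> F0 z = f z"
      using nullhomotopic_from_sphere_extension[of 0 1 ?Y f] by blast
    have "continuous_map (top_of_set (cball 0 1)) (top_of_set ?Y) F0"
      using F0 by (auto simp: continuous_map_in_subtopology)
    then have "continuous_map (top_of_set (cball 0 1)) (Mbar \<Gamma>) (orbit_map \<Gamma> \<circ> F0)"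
      unfolding Mbar_def by (rule continuous_map_compose[OF _ continuous_map_orbit_map])
    moreover have "(orbit_map \<Gamma> \<circ> F0) ` sphere 0 1 \<subseteq> boundary_Mbar \<Gamma>"
      using F0(3) f\<Omega> by (auto simp: boundary_Mbar_def)
    ultimately obtain f' where "homotopic_with (\<lambda>h. h ` sphere 0 1 \<subseteq> boundary_Mbar \<Gamma>) (top_of_set (cball 0 1)) (Mbar \<Gamma>) (orbit_map \<Gamma> \<circ> F0) f'"
      and f': "f' ` cball 0 1 \<subseteq> boundary_Mbar \<Gamma>"
      using inc unfolding incompressible_boundary_def by blast
    then have "\<exists>H. continuous_map (top_of_set ({0..1::real} \<times> cball (0::complex) 1)) (Mbar \<Gamma>) H \<and>
        (\<forall>z. H (0, z) = (orbit_map \<Gamma> \<circ> F0) z) \<and> (\<forall>z. H (1, z) = f' z) \<and>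
        (\<forall>t\<in>{0..1}. (\<lambda>z. H (t, z)) ` sphere 0 1 \<subseteq> boundary_Mbar \<Gamma>)"
      by (simp only: homotopic_with_def prod_topology_subtopology_eu)
    then obtain H where HH: "continuous_map (top_of_set ({0..1::real} \<times> cball (0::complex) 1)) (Mbar \<Gamma>) H \<and>
        (\<forall>z. H (0, z) = (orbit_map \<Gamma> \<circ> F0) z) \<and> (\<forall>z. H (1, z) = f' z) \<and>
        (\<forall>t\<in>{0..1}. (\<lambda>z. H (t, z)) ` sphere 0 1 \<subseteq> boundary_Mbar \<Gamma>)" ..
    then have H: "continuous_map (top_of_set ({0..1::real} \<times> cball (0::complex) 1)) (Mbar \<Gamma>) H"
      and H0: "\<And>z. H (0, z) = orbit_map \<Gamma> (F0 z)" and H1: "\<And>z. H (1, z) = f' z" by simp_all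
    have Hs: "(\<lambda>z. H (t, z)) ` sphere 0 1 \<subseteq> boundary_Mbar \<Gamma>" if "t \<in> {0..1}" for t
      using HH[THEN conjunct2, THEN conjunct2, THEN conjunct2] that by (rule bspec)
    obtain K where K: "continuous_on ({0..1::real} \<times> cball (0::complex) 1) K" "K \<in> ({0..1} \<times> cball 0 1) \<rightarrow> ?Y"
      and KH: "\<And>k. k \<in> {0..1} \<times> cball 0 1 \<Longrightarrow> orbit_map \<Gamma> (K k) = H k"
      by (rule lift[OF convex_Times[OF convex_real_interval(5) convex_cball] H[unfolded Mbar_def]]) blast
    have K0: "continuous_on (cball 0 1) (\<lambda>z. K (0, z))" "continuous_on (cball 0 1) (\<lambda>z. K (1, z))"
      by (rule continuous_on_compose2[OF K(1)]; auto intro!: continuous_intros)+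
    obtain g where g: "g \<in> \<Gamma>" "\<And>z. z \<in> cball 0 1 \<Longrightarrow> F0 z = act g (K (0, z))"
    proof (rule lift_unique_up_to_group[of "cball 0 1" "\<lambda>z. K (0, z)" F0])
      show "(\<lambda>z. K (0, z)) \<in> cball 0 1 \<rightarrow> ?Y" using K(2) by auto
      show "orbit_map \<Gamma> (K (0, z)) = orbit_map \<Gamma> (F0 z)" if "z \<in> cball 0 1" for z
        using KH[of "(0, z)"] that H0 by simp
      show "F0 \<in> cball 0 1 \<rightarrow> ?Y" using F0(2) by blast
    qed (use K0 F0 in auto)
    define K' where "K' k = act g (K k)" for k
    have K': "continuous_on ({0..1} \<times> cball 0 1) K'"
      unfolding K'_def by (rule continuous_on_compose2[OF continuous_act[OF g(1)] K(1)]) (use K(2) in auto)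
    have K'Y: "K' k \<in> ?Y" "orbit_map \<Gamma> (K' k) = H k" if "k \<in> {0..1} \<times> cball 0 1" for k
    proof -
      have "K k \<in> ?Y" using K(2) that by blast
      then show "K' k \<in> ?Y" "orbit_map \<Gamma> (K' k) = H k"
        using act_mem_domain[OF g(1)] orbit_map_act[OF g(1)] KH[OF that] by (simp_all add: K'_def)
    qed
    have side: "K' (t, z) \<in> ?\<Omega>" if "t \<in> {0..1}" "z \<in> sphere 0 1" for t z
    proof -
      have "(t, z) \<in> {0..1} \<times> cball 0 1" using that by auto
      then show ?thesis using boundary[of "K' (t, z)"] K'Y[of "(t, z)"] Hs[OF that(1)] that(2) by blast
    qed
    have top: "K' (1, z) \<in> ?\<Omega>" if "z \<in> cball 0 1" for z
    proof -
      have "(1::real, z) \<in> {0..1} \<times> cball 0 1" using that by simp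
      moreover have "f' z \<in> boundary_Mbar \<Gamma>" using f' that by blast
      ultimately show ?thesis using boundary[OF K'Y(1)] K'Y(2) H1 by metis
    qed
    \<comment> \<open>the lifted homotopy moves \<open>f\<close> inside the domain of discontinuity to a loop that bounds a disc there\<close>
    have "homotopic_with_canon (\<lambda>h. True) (sphere 0 1) ?\<Omega> (\<lambda>z. K' (0, z)) (\<lambda>z. K' (1, z))"
      unfolding homotopic_with_def prod_topology_subtopology_eu
    proof (intro exI[of _ K'] conjI allI)
      show "continuous_map (top_of_set ({0..1} \<times> sphere 0 1)) (top_of_set ?\<Omega>) K'"
        unfolding continuous_map_in_subtopology
        using side by (auto intro: continuous_on_subset[OF K'])
    qed auto
    then have "homotopic_with_canon (\<lambda>h. True) (sphere 0 1) ?\<Omega> f (\<lambda>z. K' (1, z))"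
      by (rule homotopic_with_eq) (auto simp: K'_def g(2)[symmetric] F0(3))
    moreover have "\<exists>c. homotopic_with_canon (\<lambda>h. True) (sphere 0 1) ?\<Omega> (\<lambda>z. K' (1, z)) (\<lambda>_. c)"
      unfolding nullhomotopic_from_sphere_extension
    proof (intro exI[of _ "\<lambda>z. K' (1, z)"] conjI)
      show "continuous_on (cball 0 1) (\<lambda>z. K' (1, z))"
        by (rule continuous_on_compose2[OF K']) (auto intro!: continuous_intros)
    qed (use top in auto)
    ultimately obtain c where "homotopic_with_canon (\<lambda>h. True) (sphere 0 1) ?\<Omega> f (\<lambda>_. c)"
      using homotopic_with_trans by blast
    then obtain J where J: "continuous_on ({0..1::real} \<times> sphere 0 1) J" "J ` ({0..1} \<times> sphere 0 1) \<subseteq> ?\<Omega>"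
      and J0: "\<And>z. J (0, z) = f z" and J1: "\<And>z. J (1, z) = c"
      unfolding homotopic_with_def prod_topology_subtopology_eu continuous_map_in_subtopology by auto
    have "connected ({0..1::real} \<times> sphere (0::complex) 1)"
      by (intro connected_Times connected_sphere) auto
    then have conn: "connected (J ` ({0..1} \<times> sphere 0 1))" using J(1) by (rule connected_continuous_image[rotated])
    have "f 1 \<in> J ` ({0..1} \<times> sphere 0 1)" by (rule image_eqI[of _ _ "(0, 1)"]) (simp_all add: J0)
    moreover have "f 1 \<in> C" using f(2) by auto
    ultimately have "J ` ({0..1} \<times> sphere 0 1) \<subseteq> C"
      using components_maximal[OF C conn J(2)] by blast
    then have "homotopic_with_canon (\<lambda>h. True) (sphere 0 1) C f (\<lambda>_. c)"
      unfolding homotopic_with_def prod_topology_subtopology_eu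
      using J J0 J1 by (intro exI[of _ J]) (auto simp: continuous_map_in_subtopology)
    then show ?thesis by blast
  qed
  then show "simply_connected C" unfolding simply_connected_eq_contractible_circlemap using pc by blast
qed

end

section \<open>The convex core in the ball\<close>

context kleinian_group
begin

abbreviation limit_hull where "limit_hull \<equiv> convex hull (limit_set \<Gamma>)"

lemma hull_subset_cball: "limit_hull \<subseteq> cball 0 1"
  using limit_set_subset sphere_cball by (intro hull_minimal convex_cball) blast

lemma interior_hull_subset: "interior limit_hull \<subseteq> H3"
  using interior_mono[OF hull_subset_cball] by simp

lemma act_mem_hull: "g \<in> \<Gamma> \<Longrightarrow> v \<in> limit_hull \<Longrightarrow> act g v \<in> limit_hull"
proof -
  assume g: "g \<in> \<Gamma>" and v: "v \<in> limit_hull"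
  have "act g v \<in> convex hull (act g ` limit_set \<Gamma>)"
    using act_convex_hull[OF in_PSL2C[OF g]] limit_set_subset sphere_cball v by blast
  moreover have "convex hull (act g ` limit_set \<Gamma>) \<subseteq> limit_hull"
    using act_mem_limit_set[OF g] by (intro hull_mono) blast
  ultimately show ?thesis by blast
qed

lemma act_mem_interior_hull:
  assumes g: "g \<in> \<Gamma>" and v: "v \<in> interior limit_hull"
  shows "act g v \<in> interior limit_hull"
proof -
  let ?i = "inv\<^bsub>PSL2C\<^esub> g"
  note gc = in_PSL2C[OF g] and ic = in_PSL2C[OF inv_mem[OF g]]
  define W where "W = H3 \<inter> act ?i -` interior limit_hull"
  have "open W"
    unfolding W_def
    by (rule continuous_open_preimage[OF continuous_on_subset[OF act_continuous[OF ic]]]) auto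
  moreover have "W \<subseteq> limit_hull"
  proof
    fix w assume w: "w \<in> W"
    then have "act g (act ?i w) \<in> limit_hull" using act_mem_hull[OF g] interior_subset by (auto simp: W_def)
    moreover have "act g (act ?i w) = w" using w by (intro act_inv(2)[OF gc]) (simp add: W_def)
    ultimately show "w \<in> limit_hull" by simp
  qed
  moreover have "act g v \<in> W"
  proof -
    have vH: "v \<in> H3" using v interior_hull_subset by blast
    then have "act ?i (act g v) = v" by (intro act_inv(1)[OF gc]) simp
    then show ?thesis using act_H3[OF gc vH] v by (simp add: W_def)
  qed
  ultimately show ?thesis by (meson interiorI)
qed

lemma covering_action_H3: "covering_action \<Gamma> H3"
  by (rule covering_action_subgroup[OF subgroup]) (use act_H3[OF in_PSL2C] in auto)

lemma hyp_hull_limit_set: "hyp_hull (limit_set \<Gamma>) = limit_hull \<inter> H3"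
  by (simp add: hyp_hull_def)

lemma orbit_mem_convex_core_iff:
  assumes "v \<in> H3"
  shows "orbit_map \<Gamma> v \<in> convex_core \<Gamma> \<longleftrightarrow> v \<in> limit_hull"
proof -
  interpret covering_action \<Gamma> H3 by (rule covering_action_H3)
  show ?thesis
  proof
    assume "orbit_map \<Gamma> v \<in> convex_core \<Gamma>"
    then obtain w where w: "w \<in> limit_hull" "w \<in> H3" "orbit_map \<Gamma> v = orbit_map \<Gamma> w"
      unfolding convex_core_def hyp_hull_limit_set by blast
    then obtain g where "g \<in> \<Gamma>" "v = act g w" using orbit_map_eq_iff[of w v] assms by auto
    then show "v \<in> limit_hull" using act_mem_hull w(1) by blast
  next
    assume "v \<in> limit_hull"
    then show "orbit_map \<Gamma> v \<in> convex_core \<Gamma>"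
      using assms unfolding convex_core_def hyp_hull_limit_set by blast
  qed
qed

lemma orbit_mem_core_interior_iff:
  assumes v: "v \<in> H3"
  shows "orbit_map \<Gamma> v \<in> core_interior \<Gamma> \<longleftrightarrow> v \<in> interior limit_hull"
proof -
  interpret covering_action \<Gamma> H3 by (rule covering_action_H3)
  have op: "openin (hyp_manifold \<Gamma>) (core_interior \<Gamma>)" unfolding core_interior_def by simp
  have sub: "core_interior \<Gamma> \<subseteq> convex_core \<Gamma>" unfolding core_interior_def by (rule interior_of_subset)
  show ?thesis
  proof
    assume in_core: "orbit_map \<Gamma> v \<in> core_interior \<Gamma>"
    define W where "W = {u \<in> H3. orbit_map \<Gamma> u \<in> core_interior \<Gamma>}"
    have "openin (top_of_set H3) W"
      using openin_continuous_map_preimage[OF continuous_map_orbit_map op[unfolded hyp_manifold_def]]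
      by (simp add: W_def)
    then have "open W" by (simp add: openin_open_eq)
    moreover have "W \<subseteq> limit_hull" using orbit_mem_convex_core_iff sub unfolding W_def by blast
    moreover have "v \<in> W" using in_core v by (simp add: W_def)
    ultimately show "v \<in> interior limit_hull" by (meson interiorI)
  next
    assume v: "v \<in> interior limit_hull"
    have "openin (top_of_set H3) (interior limit_hull)"
      using interior_hull_subset by (simp add: openin_open_eq)
    then have "openin (hyp_manifold \<Gamma>) (orbit_map \<Gamma> ` interior limit_hull)"
      unfolding hyp_manifold_def by (rule open_orbit_map)
    moreover have "orbit_map \<Gamma> ` interior limit_hull \<subseteq> convex_core \<Gamma>"
      using orbit_mem_convex_core_iff interior_hull_subset interior_subset by blast
    ultimately have "orbit_map \<Gamma> ` interior limit_hull \<subseteq> core_interior \<Gamma>"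
      unfolding core_interior_def by (rule interior_of_maximal[rotated])
    then show "orbit_map \<Gamma> v \<in> core_interior \<Gamma>" using v by blast
  qed
qed

text \<open>The images of the balls \<open>ball 0 s\<close> with \<open>s < 1\<close> form an open cover of
  the core.\<close>

lemma cocompact_on_hull:
  assumes "compactin (hyp_manifold \<Gamma>) (convex_core \<Gamma>)"
  obtains r where "0 \<le> r" "r < 1" "\<forall>p\<in>limit_hull \<inter> H3. \<exists>g\<in>\<Gamma>. norm (act g p) \<le> r"
proof -
  interpret covering_action \<Gamma> H3 by (rule covering_action_H3)
  define U where "U s = orbit_map \<Gamma> ` ball 0 s" for s :: real
  have "\<forall>V\<in>U ` {0<..<1}. openin (hyp_manifold \<Gamma>) V"
  proof clarify
    fix s :: real assume "s \<in> {0<..<1}"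
    then have "openin (top_of_set H3) (ball 0 s)" by (simp add: openin_open_eq subset_ball)
    then show "openin (hyp_manifold \<Gamma>) (U s)" unfolding U_def hyp_manifold_def by (rule open_orbit_map)
  qed
  moreover have "convex_core \<Gamma> \<subseteq> \<Union>(U ` {0<..<1})"
  proof
    fix q assume "q \<in> convex_core \<Gamma>"
    then obtain w where w: "w \<in> H3" "q = orbit_map \<Gamma> w"
      unfolding convex_core_def hyp_hull_limit_set by blast
    then have "norm w < 1" by simp
    then obtain s where "norm w < s" "s < 1" using dense by blast
    then have "s \<in> {0<..<1}" "w \<in> ball 0 s" using order.strict_trans1[OF norm_ge_zero, of w s] by auto
    then show "q \<in> \<Union>(U ` {0<..<1})" using w(2) unfolding U_def by blast
  qed
  ultimately obtain \<F> where \<F>: "finite \<F>" "\<F> \<subseteq> U ` {0<..<1}" "convex_core \<Gamma> \<subseteq> \<Union>\<F>"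
    using assms unfolding compactin_def by meson
  obtain S where S: "S \<subseteq> {0<..<1}" "finite S" "\<F> = U ` S"
    using finite_subset_image[OF \<F>(1,2)] by blast
  define r where "r = Max (insert 0 S)"
  have r: "0 \<le> r" "r < 1" "\<And>s. s \<in> S \<Longrightarrow> s \<le> r"
    using S(1,2) by (auto simp: r_def)
  have "\<exists>g\<in>\<Gamma>. norm (act g p) \<le> r" if p: "p \<in> limit_hull \<inter> H3" for p
  proof -
    have "orbit_map \<Gamma> p \<in> convex_core \<Gamma>" using p orbit_mem_convex_core_iff by blast
    then obtain s where s: "s \<in> S" "orbit_map \<Gamma> p \<in> U s" using \<F>(3) S(3) by blast
    then obtain w where w: "norm w < s" "orbit_map \<Gamma> p = orbit_map \<Gamma> w" by (auto simp: U_def)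
    have "s < 1" using s(1) S(1) by auto
    then have "w \<in> H3" using w(1) by simp
    then obtain g where "g \<in> \<Gamma>" "w = act g p" using orbit_map_eq_iff[of p w] w(2) p by auto
    then show ?thesis using w(1) r(3)[OF s(1)] by (metis less_le_not_le less_trans not_le order.trans)
  qed
  then show ?thesis using that r by blast
qed

lemma orbit_mem_geodesic_plane_iff:
  assumes v: "v \<in> H3"
  shows "orbit_map \<Gamma> v \<in> geodesic_plane \<Gamma> x \<longleftrightarrow> (\<exists>g\<in>\<Gamma>. act g v \<in> hyp_hull (circle x))"
proof -
  interpret covering_action \<Gamma> H3 by (rule covering_action_H3)
  show ?thesis
  proof
    assume "orbit_map \<Gamma> v \<in> geodesic_plane \<Gamma> x"
    then obtain w where w: "w \<in> hyp_hull (circle x)" "orbit_map \<Gamma> v = orbit_map \<Gamma> w"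
      unfolding geodesic_plane_def by blast
    then have "w \<in> H3" by (simp add: hyp_hull_def)
    then obtain g where "g \<in> \<Gamma>" "w = act g v" using orbit_map_eq_iff[OF v] w(2) by blast
    then show "\<exists>g\<in>\<Gamma>. act g v \<in> hyp_hull (circle x)" using w(1) by blast
  next
    assume "\<exists>g\<in>\<Gamma>. act g v \<in> hyp_hull (circle x)"
    then obtain g where "g \<in> \<Gamma>" "act g v \<in> hyp_hull (circle x)" by blast
    then show "orbit_map \<Gamma> v \<in> geodesic_plane \<Gamma> x"
      using orbit_map_act[OF _ v] unfolding geodesic_plane_def by (metis imageI)
  qed
qed

text \<open>The closedness of the plane in the interior of the core, expressed in the universal
  cover.\<close>

lemma closedin_plane_orbit:
  assumes "closedin (subtopology (hyp_manifold \<Gamma>) (core_interior \<Gamma>)) (geodesic_plane \<Gamma> x \<inter> core_interior \<Gamma>)"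
  shows "closedin (top_of_set (interior limit_hull)) {v \<in> interior limit_hull. \<exists>g\<in>\<Gamma>. act g v \<in> hyp_hull (circle x)}"
proof -
  interpret covering_action \<Gamma> H3 by (rule covering_action_H3)
  obtain T where T: "closedin (hyp_manifold \<Gamma>) T" "geodesic_plane \<Gamma> x \<inter> core_interior \<Gamma> = T \<inter> core_interior \<Gamma>"
    using assms unfolding closedin_subtopology by blast
  have "closedin (top_of_set H3) {u \<in> H3. orbit_map \<Gamma> u \<in> T}"
    using closedin_continuous_map_preimage[OF continuous_map_orbit_map T(1)[unfolded hyp_manifold_def]] by simp
  then obtain T' where T': "closed T'" "{u \<in> H3. orbit_map \<Gamma> u \<in> T} = T' \<inter> H3"
    unfolding closedin_closed by blast
  have "{v \<in> interior limit_hull. \<exists>g\<in>\<Gamma>. act g v \<in> hyp_hull (circle x)} = interior limit_hull \<inter> T'"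
  proof (rule Set.set_eqI)
    fix v :: "real^3"
    show "v \<in> {v \<in> interior limit_hull. \<exists>g\<in>\<Gamma>. act g v \<in> hyp_hull (circle x)} \<longleftrightarrow> v \<in> interior limit_hull \<inter> T'"
    proof (cases "v \<in> interior limit_hull")
      case True
      then have vH: "v \<in> H3" using interior_hull_subset by blast
      have "orbit_map \<Gamma> v \<in> core_interior \<Gamma>" using True orbit_mem_core_interior_iff[OF vH] by simp
      then have "orbit_map \<Gamma> v \<in> geodesic_plane \<Gamma> x \<longleftrightarrow> orbit_map \<Gamma> v \<in> T" using T(2) by blast
      moreover have "orbit_map \<Gamma> v \<in> T \<longleftrightarrow> v \<in> T'" using T'(2) vH by blast
      ultimately show ?thesis using True orbit_mem_geodesic_plane_iff[OF vH] by simp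
    qed simp
  qed
  then show ?thesis using T'(1) unfolding closedin_closed by blast
qed

lemma countable_group: "countable \<Gamma>"
proof -
  have "\<Gamma> = (\<Union>n::nat. {g \<in> \<Gamma>. norm (representative g) \<le> real n})"
    using real_arch_simple by auto
  moreover have "countable (\<Union>n::nat. {g \<in> \<Gamma>. norm (representative g) \<le> real n})"
    using countable_finite[OF finite_bounded_representatives] by (intro countable_UN) simp_all
  ultimately show ?thesis by simp
qed

end

section \<open>Limits of translates of a closed plane\<close>

text \<open>A pair stands for an affine function, and for a plane. Pairs of norm \<open>1\<close> form a
  compact set, in which limits of planes are taken.\<close>

definition affine_value :: "(real^3) \<times> real \<Rightarrow> real^3 \<Rightarrow> real" where
  "affine_value L w = fst L \<bullet> w + snd L"

lemma affine_value_segment: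
  "affine_value L ((1 - t) *\<^sub>R u + t *\<^sub>R v) = (1 - t) * affine_value L u + t * affine_value L v"
  by (simp add: affine_value_def inner_add_right algebra_simps)

lemma continuous_affine_value: "continuous_on S (affine_value L)"
  unfolding affine_value_def by (intro continuous_intros)

lemma tendsto_affine_value:
  "(f \<longlongrightarrow> L) F \<Longrightarrow> (u \<longlongrightarrow> v) F \<Longrightarrow> ((\<lambda>n. affine_value (f n) (u n)) \<longlongrightarrow> affine_value L v) F"
  unfolding affine_value_def by (intro tendsto_intros)

lemma closed_affine_zeros: "closed {w. affine_value L w = 0}"
  by (intro closed_Collect_eq continuous_affine_value continuous_on_const)

lemma gradient_nonzero:
  assumes "norm L = 1" "affine_value L u = 0" shows "fst L \<noteq> 0"
proof
  assume "fst L = 0"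
  then have "L = 0" using assms(2) by (simp add: affine_value_def prod_eq_iff)
  then show False using assms(1) by simp
qed

text \<open>The projections of \<open>u\<close> to the approximating planes tend to
  \<open>u\<close>.\<close>

lemma zeros_near_limit_zero:
  assumes L: "L \<longlonglongrightarrow> L'" and n: "norm L' = 1" and u: "affine_value L' u = 0"
  obtains v where "v \<longlonglongrightarrow> u" "eventually (\<lambda>n. affine_value (L n) (v n) = 0) sequentially"
proof -
  have f': "fst L' \<noteq> 0" by (rule gradient_nonzero[OF n u])
  define v where "v n = u - (affine_value (L n) u / (fst (L n) \<bullet> fst (L n))) *\<^sub>R fst (L n)" for n
  have f: "(\<lambda>n. fst (L n)) \<longlonglongrightarrow> fst L'" using L by (rule tendsto_fst)
  have "v \<longlonglongrightarrow> u - (affine_value L' u / (fst L' \<bullet> fst L')) *\<^sub>R fst L'"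
    unfolding v_def using f'
    by (intro tendsto_diff tendsto_const tendsto_scaleR tendsto_divide tendsto_inner f tendsto_affine_value L) simp
  then have "v \<longlonglongrightarrow> u" by (simp add: u)
  moreover have "eventually (\<lambda>n. fst (L n) \<noteq> 0) sequentially"
    using f f' by (rule tendsto_imp_eventually_ne)
  then have "eventually (\<lambda>n. affine_value (L n) (v n) = 0) sequentially"
    by (rule eventually_mono) (simp add: v_def affine_value_def inner_diff_right)
  ultimately show ?thesis by (rule that)
qed

lemma affine_zeros_eq_if_open_piece:
  assumes u: "affine_value M u = 0" "fst M \<noteq> 0" and d: "d > 0"
    and sub: "\<And>w. w \<in> ball u d \<Longrightarrow> affine_value M w = 0 \<Longrightarrow> affine_value N w = 0" and N: "norm N = 1"
  shows "affine_value N w = 0 \<longleftrightarrow> affine_value M w = 0"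
proof -
  have uN: "affine_value N u = 0" using sub[of u] u d by simp
  have orth: "fst N \<bullet> v = 0" if v: "fst M \<bullet> v = 0" for v
  proof -
    define m where "m = norm v + 1"
    have m: "m > 0" using norm_ge_zero[of v] unfolding m_def by linarith
    define e where "e = d / (2 * m)"
    have e: "e > 0" using d m by (simp add: e_def)
    have "norm (e *\<^sub>R v) = e * norm v" using e by simp
    also have "\<dots> \<le> e * m" using e by (simp add: m_def)
    also have "\<dots> = d / 2" using m by (simp add: e_def)
    also have "\<dots> < d" using d by simp
    finally have "u + e *\<^sub>R v \<in> ball u d" by (simp add: dist_norm)
    moreover have "affine_value M (u + e *\<^sub>R v) = 0"
      using u v by (simp add: affine_value_def inner_add_right)
    ultimately have "affine_value N (u + e *\<^sub>R v) = 0" by (rule sub)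
    moreover have "affine_value N (u + e *\<^sub>R v) = affine_value N u + e * (fst N \<bullet> v)"
      by (simp add: affine_value_def inner_add_right)
    ultimately have "e * (fst N \<bullet> v) = 0" using uN by simp
    then show ?thesis using e by simp
  qed
  define c where "c = (fst M \<bullet> fst N) / (fst M \<bullet> fst M)"
  define v where "v = fst N - c *\<^sub>R fst M"
  have "fst M \<bullet> v = 0" using u(2) by (simp add: v_def c_def inner_diff_right)
  then have "fst N \<bullet> v = 0" "fst M \<bullet> v = 0" using orth by auto
  then have "v \<bullet> v = 0" by (simp add: v_def inner_diff_left)
  then have fN: "fst N = c *\<^sub>R fst M" by (simp add: v_def)
  have "c \<noteq> 0" using gradient_nonzero[OF N uN] fN by auto
  have "affine_value N w = affine_value N w - affine_value N u" for w using uN by simp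
  also have "affine_value N w - affine_value N u = c * (affine_value M w - affine_value M u)" for w
    by (simp add: affine_value_def fN algebra_simps)
  finally show ?thesis using u(1) \<open>c \<noteq> 0\<close> by simp
qed

text \<open>Baire's theorem is applied to the closure of \<open>S\<close> in a small open ball. A piece of
  it found at the boundary of the ball contains points inside, and there it is open in
  \<open>S\<close>.\<close>

lemma Baire_closed_cover:
  fixes S :: "'a::{real_normed_vector,heine_borel} set"
  assumes S: "closed S" and W: "open W" "S \<inter> W \<noteq> {}" and I: "countable I"
    and T: "\<And>i. i \<in> I \<Longrightarrow> closed (T i)" "S \<inter> W \<subseteq> (\<Union>i\<in>I. T i)"
  obtains i x d where "i \<in> I" "x \<in> S" "d > 0" "ball x d \<subseteq> W" "S \<inter> ball x d \<subseteq> T i"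
proof (rule ccontr)
  note witness = that
  assume "\<not> thesis"
  then have no: False if "i \<in> I" "x \<in> S" "d > 0" "ball x d \<subseteq> W" "S \<inter> ball x d \<subseteq> T i" for i x d
    using witness that by blast
  obtain x0 where x0: "x0 \<in> S" "x0 \<in> W" using W(2) by blast
  obtain e where e: "e > 0" "cball x0 e \<subseteq> W" using W(1) x0(2) open_contains_cball by blast
  define S1 where "S1 = closure (S \<inter> ball x0 e)"
  have S1: "closed S1" "S1 \<subseteq> S" "S1 \<subseteq> cball x0 e" "x0 \<in> S1"
  proof -
    show "closed S1" by (simp add: S1_def)
    show "S1 \<subseteq> S" unfolding S1_def by (rule closure_minimal[OF _ S]) blast
    show "S1 \<subseteq> cball x0 e" unfolding S1_def by (rule closure_minimal) auto
    show "x0 \<in> S1" unfolding S1_def using x0 e closure_subset by fastforce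
  qed
  have cover: "S1 \<subseteq> (\<Union>i\<in>I. T i)" using S1 e(2) T(2) by blast
  have "S1 \<subseteq> closure (\<Inter>((\<lambda>i. S1 - T i) ` I))"
  proof (rule Baire[OF S1(1)])
    show "countable ((\<lambda>i. S1 - T i) ` I)" using I by simp
    fix G assume "G \<in> (\<lambda>i. S1 - T i) ` I"
    then obtain i where i: "i \<in> I" "G = S1 - T i" by blast
    have "openin (top_of_set S1) G"
      unfolding i(2) Diff_eq by (intro openin_open_Int open_Compl T(1) i(1))
    moreover have "S1 \<subseteq> closure G"
    proof (rule ccontr)
      assume "\<not> S1 \<subseteq> closure G"
      then obtain x where x: "x \<in> S1" "x \<notin> closure G" by blast
      then obtain d where d: "d > 0" "ball x d \<inter> G = {}"
        by (metis Int_commute closure_approachable disjoint_iff mem_ball dist_commute)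
      then have dT: "S1 \<inter> ball x d \<subseteq> T i" using i(2) by blast
      have "ball x d \<inter> (S \<inter> ball x0 e) \<noteq> {}"
        using x(1) d(1) unfolding S1_def closure_approachable by (metis IntI disjoint_iff dist_commute mem_ball)
      then obtain y where y: "y \<in> S" "y \<in> ball x d \<inter> ball x0 e" by blast
      obtain d' where d': "d' > 0" "ball y d' \<subseteq> ball x d \<inter> ball x0 e"
        using open_contains_ball[of "ball x d \<inter> ball x0 e"] y(2) by (metis open_Int open_ball)
      have "S \<inter> ball y d' \<subseteq> S1 \<inter> ball x d"
        using d'(2) closure_subset[of "S \<inter> ball x0 e"] unfolding S1_def by blast
      moreover have "ball y d' \<subseteq> W" using d'(2) e(2) ball_subset_cball[of x0 e] by blast
      ultimately show False using no[OF i(1) y(1) d'(1)] dT by blast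
    qed
    ultimately show "openin (top_of_set S1) G \<and> S1 \<subseteq> closure G" by blast
  qed
  moreover have "I \<noteq> {}" using cover S1(4) by blast
  then have "\<Inter>((\<lambda>i. S1 - T i) ` I) = {}" using cover by blast
  ultimately show False using S1(4) by simp
qed

text \<open>The plane \<open>a \<bullet> w + b = 0\<close> with the properties that a plane with trivial
  fundamental group inherits: its stabilizer is trivial and its orbit is closed in the interior of the hull,
  which it meets in \<open>p0\<close>. The translates of the ball of radius \<open>r\<close> cover the part
  of the hull in hyperbolic space.\<close>

locale closed_plane = kleinian_group +
  fixes a :: "real^3" and b :: real and p0 :: "real^3" and r :: real
  assumes stabilizer_trivial: "\<And>g. g \<in> \<Gamma> \<Longrightarrow>
      (\<And>w. w \<in> H3 \<Longrightarrow> a \<bullet> w + b = 0 \<Longrightarrow> a \<bullet> act g w + b = 0) \<Longrightarrow> g = \<one>\<^bsub>PSL2C\<^esub>"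
    and closed_orbit: "closedin (top_of_set (interior (convex hull limit_set \<Gamma>)))
      {u \<in> interior (convex hull limit_set \<Gamma>). \<exists>g\<in>\<Gamma>. a \<bullet> act g u + b = 0}"
    and a_nonzero: "a \<noteq> 0"
    and p0: "p0 \<in> interior (convex hull limit_set \<Gamma>)" "a \<bullet> p0 + b = 0"
    and r: "0 \<le> r" "r < 1"
    and cocompact: "\<And>p. p \<in> convex hull limit_set \<Gamma> \<Longrightarrow> p \<in> H3 \<Longrightarrow> \<exists>g\<in>\<Gamma>. norm (act g p) \<le> r"
begin

text \<open>The normalized equation of the preimage of the plane under \<open>g\<close>, with the same
  sides.\<close>

definition pullback :: "(complex^2^2) set \<Rightarrow> (real^3) \<times> real" where
  "pullback g = (SOME L. norm L = 1 \<and> (\<forall>w\<in>cball 0 1. sgn (affine_value L w) = sgn (a \<bullet> act g w + b)))"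

lemma p0_H3: "p0 \<in> H3"
  using p0 interior_hull_subset by blast

lemma pullback:
  assumes g: "g \<in> \<Gamma>"
  shows "norm (pullback g) = 1"
    "\<And>w. w \<in> cball 0 1 \<Longrightarrow> sgn (affine_value (pullback g) w) = sgn (a \<bullet> act g w + b)"
proof -
  note gc = in_PSL2C[OF g]
  obtain a' b' where ab: "\<And>w. w \<in> cball 0 1 \<Longrightarrow> a' \<bullet> w + b' = weight g w * (a \<bullet> act g w + b)"
    using act_pullback_affine[OF gc, of a b] by blast
  obtain e where e: "e > 0" "ball p0 e \<subseteq> H3" using p0_H3 open_contains_ball[of H3] by blast
  define w where "w = p0 + (e / (2 * norm a)) *\<^sub>R a"
  have "w \<in> ball p0 e" using e a_nonzero by (simp add: w_def dist_norm)
  then have wH: "w \<in> H3" using e by blast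
  have "a \<bullet> w + b = (e / (2 * norm a)) * (a \<bullet> a)" using p0 by (simp add: w_def inner_add_right)
  then have w0: "a \<bullet> w + b \<noteq> 0" using e a_nonzero by simp
  define u where "u = act (inv\<^bsub>PSL2C\<^esub> g) w"
  have uH: "u \<in> H3" unfolding u_def by (rule act_H3[OF in_PSL2C[OF inv_mem[OF g]] wH])
  have gu: "act g u = w" unfolding u_def using wH by (intro act_inv(2)[OF gc]) simp
  have "a' \<bullet> u + b' \<noteq> 0" using ab[of u] uH w0 gu weight_pos[OF gc, of u] by simp
  then have nz0: "(a', b') \<noteq> 0" by (auto simp: zero_prod_def)
  define M where "M = (a', b')"
  have nz: "norm M \<noteq> 0" using nz0 by (simp add: M_def)
  define L where "L = inverse (norm M) *\<^sub>R M"
  have "norm L = 1" using nz by (simp add: L_def)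
  moreover have "sgn (affine_value L w) = sgn (a \<bullet> act g w + b)" if "w \<in> cball 0 1" for w
  proof -
    have "affine_value L w = inverse (norm M) * affine_value M w"
      by (simp add: L_def affine_value_def algebra_simps)
    also have "affine_value M w = weight g w * (a \<bullet> act g w + b)"
      using ab[OF that] by (simp add: M_def affine_value_def)
    finally show ?thesis using nz weight_pos[OF gc that] by (simp add: sgn_mult)
  qed
  ultimately have "\<exists>L. norm L = 1 \<and> (\<forall>w\<in>cball 0 1. sgn (affine_value L w) = sgn (a \<bullet> act g w + b))" by blast
  from someI_ex[OF this] show "norm (pullback g) = 1"
    "\<And>w. w \<in> cball 0 1 \<Longrightarrow> sgn (affine_value (pullback g) w) = sgn (a \<bullet> act g w + b)"
    unfolding pullback_def by blast+
qed

lemma pullback_sign: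
  assumes "g \<in> \<Gamma>" "w \<in> cball 0 1"
  shows "affine_value (pullback g) w = 0 \<longleftrightarrow> a \<bullet> act g w + b = 0"
    "affine_value (pullback g) w > 0 \<longleftrightarrow> a \<bullet> act g w + b > 0"
    "affine_value (pullback g) w < 0 \<longleftrightarrow> a \<bullet> act g w + b < 0"
  using pullback(2)[OF assms] by (metis sgn_0_0, metis sgn_1_pos sgn_pos, metis sgn_1_neg sgn_neg)

definition plane_orbit :: "(real^3) set" where
  "plane_orbit = {u \<in> interior limit_hull. \<exists>g\<in>\<Gamma>. a \<bullet> act g u + b = 0}"

lemma in_cball_if_interior: "u \<in> interior limit_hull \<Longrightarrow> u \<in> cball 0 1"
  using interior_hull_subset ball_subset_cball by blast

lemma plane_orbit_closed:
  assumes "u \<in> interior limit_hull" "v \<longlonglongrightarrow> u" "eventually (\<lambda>n. v n \<in> plane_orbit) sequentially"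
  shows "u \<in> plane_orbit"
proof -
  obtain T where T: "closed T" "plane_orbit = interior limit_hull \<inter> T"
    using closed_orbit unfolding closedin_closed plane_orbit_def by blast
  have "eventually (\<lambda>n. v n \<in> T) sequentially" using assms(3) by (rule eventually_mono) (simp add: T(2))
  then have "u \<in> T" using Lim_in_closed_set[OF T(1) _ sequentially_bot assms(2)] by blast
  then show ?thesis using T(2) assms(1) by blast
qed

text \<open>Suppose that the limit plane meets the interior of the hull. There it is contained in the closed
  orbit, a countable union of translates, so by Baire's theorem it is itself a translate. By Baire's theorem
  again, the orbit consists of a single sheet near some point \<open>z1\<close>, and by homogeneity near
  some point \<open>w1\<close> of the limit plane. The approximating translates pass arbitrarily close to
  \<open>w1\<close>, so almost all of them coincide with the limit plane. As the stabilizer is trivial,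
  almost all \<open>\<beta>\<^sub>n\<close> are then equal.\<close>

theorem limit_plane_avoids_interior:
  assumes \<beta>: "\<And>n. \<beta> n \<in> \<Gamma>" and fin: "\<And>g. finite {n. \<beta> n = g}"
    and lim: "(\<lambda>n. pullback (\<beta> n)) \<longlonglongrightarrow> L" and u0: "u0 \<in> interior limit_hull"
  shows "affine_value L u0 \<noteq> 0"
proof
  assume L0: "affine_value L u0 = 0"
  have "(\<lambda>n. norm (pullback (\<beta> n))) \<longlonglongrightarrow> norm L" using lim by (rule tendsto_norm)
  then have nL: "norm L = 1" by (simp add: pullback(1)[OF \<beta>] LIMSEQ_const_iff)
  have fL: "fst L \<noteq> 0" by (rule gradient_nonzero[OF nL L0])
  have zeros: "g \<in> \<Gamma> \<Longrightarrow> u \<in> interior limit_hull \<Longrightarrow> affine_value (pullback g) u = 0 \<Longrightarrow> u \<in> plane_orbit" for g u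
    using pullback_sign(1) in_cball_if_interior unfolding plane_orbit_def by blast
  have limit_zero: "u \<in> plane_orbit" if u: "u \<in> interior limit_hull" "affine_value L u = 0" for u
  proof -
    obtain v where v: "v \<longlonglongrightarrow> u" "eventually (\<lambda>n. affine_value (pullback (\<beta> n)) (v n) = 0) sequentially"
      using zeros_near_limit_zero[OF lim nL u(2)] by blast
    have "eventually (\<lambda>n. v n \<in> interior limit_hull) sequentially"
      using topological_tendstoD[OF v(1) open_interior u(1)] .
    with v(2) have "eventually (\<lambda>n. v n \<in> plane_orbit) sequentially"
      by (rule eventually_elim2) (use zeros \<beta> in blast)
    then show ?thesis by (rule plane_orbit_closed[OF u(1) v(1)])
  qed
  \<comment> \<open>the limit plane is one of the translates\<close>
  obtain g u1 d1 where g: "g \<in> \<Gamma>" and u1: "affine_value L u1 = 0" "d1 > 0"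
    "\<And>w. w \<in> ball u1 d1 \<Longrightarrow> affine_value L w = 0 \<Longrightarrow> affine_value (pullback g) w = 0"
  proof (rule Baire_closed_cover[OF closed_affine_zeros open_interior _ countable_group, of L limit_hull "\<lambda>g. {w. affine_value (pullback g) w = 0}"])
    show "{w. affine_value L w = 0} \<inter> interior limit_hull \<noteq> {}" using L0 u0 by blast
    show "closed {w. affine_value (pullback g) w = 0}" for g by (rule closed_affine_zeros)
    show "{w. affine_value L w = 0} \<inter> interior limit_hull \<subseteq> (\<Union>g\<in>\<Gamma>. {w. affine_value (pullback g) w = 0})"
    proof
      fix w assume w: "w \<in> {w. affine_value L w = 0} \<inter> interior limit_hull"
      then have "w \<in> plane_orbit" using limit_zero by blast
      then obtain g where "g \<in> \<Gamma>" "a \<bullet> act g w + b = 0" by (auto simp: plane_orbit_def)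
      then show "w \<in> (\<Union>g\<in>\<Gamma>. {w. affine_value (pullback g) w = 0})"
        using pullback_sign(1)[of g w] in_cball_if_interior w by blast
    qed
  qed blast
  have Lg: "affine_value (pullback g) w = 0 \<longleftrightarrow> affine_value L w = 0" for w
    by (rule affine_zeros_eq_if_open_piece[OF u1(1) fL u1(2,3) pullback(1)[OF g]])
  \<comment> \<open>some piece of the orbit of the plane consists of a single sheet\<close>
  obtain g1 z1 d2 where g1: "g1 \<in> \<Gamma>" and z1: "z1 \<in> closure plane_orbit" "d2 > 0" "ball z1 d2 \<subseteq> interior limit_hull"
    and sheet: "closure plane_orbit \<inter> ball z1 d2 \<subseteq> {w. affine_value (pullback g1) w = 0}"
  proof (rule Baire_closed_cover[OF closed_closure open_interior _ countable_group, of plane_orbit limit_hull "\<lambda>g. {w. affine_value (pullback g) w = 0}"])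
    have "u0 \<in> plane_orbit" using limit_zero[OF u0 L0] .
    then show "closure plane_orbit \<inter> interior limit_hull \<noteq> {}" using u0 closure_subset by blast
    show "closed {w. affine_value (pullback g) w = 0}" for g by (rule closed_affine_zeros)
    show "closure plane_orbit \<inter> interior limit_hull \<subseteq> (\<Union>g\<in>\<Gamma>. {w. affine_value (pullback g) w = 0})"
    proof
      fix w assume w: "w \<in> closure plane_orbit \<inter> interior limit_hull"
      then have "\<exists>v. (\<forall>n. v n \<in> plane_orbit) \<and> v \<longlonglongrightarrow> w" unfolding closure_sequential[symmetric] by blast
      then obtain v where "\<And>n. v n \<in> plane_orbit" "v \<longlonglongrightarrow> w" by blast
      then have "w \<in> plane_orbit" using plane_orbit_closed[of w v] w by simp
      then obtain g where "g \<in> \<Gamma>" "a \<bullet> act g w + b = 0" by (auto simp: plane_orbit_def)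
      then show "w \<in> (\<Union>g\<in>\<Gamma>. {w. affine_value (pullback g) w = 0})"
        using pullback_sign(1)[of g w] in_cball_if_interior w by blast
    qed
  qed blast
  \<comment> \<open>the element \<open>\<phi>\<close> maps the limit plane to that sheet\<close>
  interpret PSL: group PSL2C by (rule PSL2C_group)
  define \<phi> where "\<phi> = inv\<^bsub>PSL2C\<^esub> g1 \<otimes>\<^bsub>PSL2C\<^esub> g"
  have \<phi>: "\<phi> \<in> \<Gamma>" unfolding \<phi>_def by (intro mult_mem inv_mem g g1)
  note c = in_PSL2C[OF g] in_PSL2C[OF g1] in_PSL2C[OF \<phi>] in_PSL2C[OF inv_mem[OF \<phi>]] in_PSL2C[OF inv_mem[OF g1]]
  have g1\<phi>: "act g1 (act \<phi> w) = act g w" if w: "w \<in> cball 0 1" for w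
    unfolding \<phi>_def act_mult[OF c(5,1) w] by (rule act_inv(2)[OF c(2) act_cball[OF c(1) w]])
  have z1i: "z1 \<in> interior limit_hull" using z1 by (meson centre_in_ball subsetD)
  have z1c: "z1 \<in> cball 0 1" by (rule in_cball_if_interior[OF z1i])
  define w1 where "w1 = act (inv\<^bsub>PSL2C\<^esub> \<phi>) z1"
  have w1i: "w1 \<in> interior limit_hull" unfolding w1_def by (rule act_mem_interior_hull[OF inv_mem[OF \<phi>] z1i])
  have w1c: "w1 \<in> cball 0 1" by (rule in_cball_if_interior[OF w1i])
  have \<phi>w1: "act \<phi> w1 = z1" unfolding w1_def by (rule act_inv(2)[OF c(3) z1c])
  have "z1 \<in> closure plane_orbit \<inter> ball z1 d2" using z1 by simp
  then have "affine_value (pullback g1) z1 = 0" using subsetD[OF sheet] by simp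
  then have "a \<bullet> act g w1 + b = 0" using pullback_sign(1)[OF g1 z1c] g1\<phi>[OF w1c] \<phi>w1 by simp
  then have Lw1: "affine_value L w1 = 0" by (intro iffD1[OF Lg] iffD2[OF pullback_sign(1)[OF g w1c]])
  define W where "W = interior limit_hull \<inter> act \<phi> -` ball z1 d2"
  have "open W"
    unfolding W_def
  proof (rule continuous_open_preimage[OF continuous_on_subset[OF act_continuous[OF c(3)]]])
    show "interior limit_hull \<subseteq> cball 0 1" using in_cball_if_interior by blast
  qed auto
  moreover have "w1 \<in> W" using w1i \<phi>w1 z1(2) by (simp add: W_def)
  ultimately obtain d3 where d3: "d3 > 0" "ball w1 d3 \<subseteq> W" using open_contains_ball by blast
  have piece: "affine_value (pullback g) y = 0" if y: "y \<in> ball w1 d3" "affine_value (pullback (\<beta> n)) y = 0" for n y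
  proof -
    have yW: "y \<in> interior limit_hull" "act \<phi> y \<in> ball z1 d2" using d3(2) y(1) by (auto simp: W_def)
    have yc: "y \<in> cball 0 1" by (rule in_cball_if_interior[OF yW(1)])
    have "a \<bullet> act (\<beta> n) y + b = 0" using pullback_sign(1)[OF \<beta> yc] y(2) by simp
    moreover have "act (\<beta> n \<otimes>\<^bsub>PSL2C\<^esub> inv\<^bsub>PSL2C\<^esub> \<phi>) (act \<phi> y) = act (\<beta> n) y"
      unfolding act_mult[OF in_PSL2C[OF \<beta>] c(4) act_cball[OF c(3) yc]] act_inv(1)[OF c(3) yc] ..
    ultimately have "\<exists>h\<in>\<Gamma>. a \<bullet> act h (act \<phi> y) + b = 0" using mult_mem[OF \<beta> inv_mem[OF \<phi>]] by metis
    then have "act \<phi> y \<in> plane_orbit"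
      unfolding plane_orbit_def using act_mem_interior_hull[OF \<phi> yW(1)] by blast
    then have "act \<phi> y \<in> closure plane_orbit" by (rule subsetD[OF closure_subset])
    then have "affine_value (pullback g1) (act \<phi> y) = 0"
      using subsetD[OF sheet IntI[OF _ yW(2)]] by simp
    then have "a \<bullet> act g y + b = 0"
      using pullback_sign(1)[OF g1 act_cball[OF c(3) yc]] g1\<phi>[OF yc] by simp
    then show ?thesis using pullback_sign(1)[OF g yc] by simp
  qed
  obtain v where v: "v \<longlonglongrightarrow> w1" "eventually (\<lambda>n. affine_value (pullback (\<beta> n)) (v n) = 0) sequentially"
    using zeros_near_limit_zero[OF lim nL Lw1] by blast
  have "eventually (\<lambda>n. v n \<in> ball w1 (d3 / 2)) sequentially"
    by (rule topological_tendstoD[OF v(1) open_ball]) (use d3(1) in simp)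
  with v(2) have "eventually (\<lambda>n. \<beta> n = g) sequentially"
  proof (rule eventually_elim2)
    fix n assume n: "affine_value (pullback (\<beta> n)) (v n) = 0" "v n \<in> ball w1 (d3 / 2)"
    have "ball (v n) (d3 / 2) \<subseteq> ball w1 d3"
    proof
      fix y assume "y \<in> ball (v n) (d3 / 2)"
      then show "y \<in> ball w1 d3" using n(2) dist_triangle[of w1 y "v n"] unfolding mem_ball by linarith
    qed
    then have sub: "affine_value (pullback g) y = 0"
      if "y \<in> ball (v n) (d3 / 2)" "affine_value (pullback (\<beta> n)) y = 0" for y
      using piece that by blast
    have eq: "affine_value (pullback g) w = 0 \<longleftrightarrow> affine_value (pullback (\<beta> n)) w = 0" for w
      by (rule affine_zeros_eq_if_open_piece[OF n(1) gradient_nonzero[OF pullback(1)[OF \<beta>] n(1)] half_gt_zero[OF d3(1)] sub pullback(1)[OF g]])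
    have "\<beta> n \<otimes>\<^bsub>PSL2C\<^esub> inv\<^bsub>PSL2C\<^esub> g = \<one>\<^bsub>PSL2C\<^esub>"
    proof (rule stabilizer_trivial[OF mult_mem[OF \<beta> inv_mem[OF g]]])
      fix w assume w: "w \<in> H3" "a \<bullet> w + b = 0"
      have wc: "w \<in> cball 0 1" using w(1) by simp
      define y where "y = act (inv\<^bsub>PSL2C\<^esub> g) w"
      have yc: "y \<in> cball 0 1" unfolding y_def by (rule act_cball[OF in_PSL2C[OF inv_mem[OF g]] wc])
      have "act g y = w" unfolding y_def by (rule act_inv(2)[OF c(1) wc])
      then have "affine_value (pullback g) y = 0" using pullback_sign(1)[OF g yc] w(2) by simp
      then have "a \<bullet> act (\<beta> n) y + b = 0"
        by (intro iffD1[OF pullback_sign(1)[OF \<beta> yc]] iffD1[OF eq])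
      then show "a \<bullet> act (\<beta> n \<otimes>\<^bsub>PSL2C\<^esub> inv\<^bsub>PSL2C\<^esub> g) w + b = 0"
        unfolding act_mult[OF in_PSL2C[OF \<beta>] in_PSL2C[OF inv_mem[OF g]] wc] y_def .
    qed
    then show "\<beta> n = g" using PSL.inv_equality[of "\<beta> n" "inv\<^bsub>PSL2C\<^esub> g"] c(1) in_PSL2C[OF \<beta>] by simp
  qed
  then obtain m where "\<And>n. n \<ge> m \<Longrightarrow> \<beta> n = g" unfolding eventually_sequentially by blast
  then have "{m..} \<subseteq> {n. \<beta> n = g}" by auto
  then show False using fin[of g] infinite_Ici finite_subset by blast
qed

lemma finitely_often_if_escaping:
  assumes "\<And>n. \<beta> n \<in> \<Gamma>" "\<And>n. norm (u n) \<le> r" "(\<lambda>n. norm (act (\<beta> n) (u n))) \<longlonglongrightarrow> 1"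
  shows "finite {n. \<beta> n = g}"
proof (cases "g \<in> \<Gamma>")
  case True
  note gc = in_PSL2C[OF True]
  have "compact (act g ` cball 0 r)"
    using r by (intro compact_continuous_image continuous_on_subset[OF act_continuous[OF gc]]) auto
  moreover have "act g ` cball 0 r \<noteq> {}" using r by simp
  ultimately obtain y where y: "y \<in> act g ` cball 0 r" "\<And>z. z \<in> act g ` cball 0 r \<Longrightarrow> dist 0 z \<le> dist 0 y"
    using distance_attains_sup by metis
  have "y \<in> H3" using y(1) r act_H3[OF gc] by auto
  then have "norm y < 1" by simp
  then have "eventually (\<lambda>n. norm y < norm (act (\<beta> n) (u n))) sequentially"
    using order_tendstoD(1)[OF assms(3)] by blast
  moreover have "\<beta> n \<noteq> g" if "norm y < norm (act (\<beta> n) (u n))" for n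
    using y(2)[of "act g (u n)"] assms(2)[of n] that by auto
  ultimately have "eventually (\<lambda>n. \<not> \<beta> n = g) sequentially" by (rule eventually_mono)
  then show ?thesis unfolding cofinite_eq_sequentially[symmetric] eventually_cofinite by simp
next
  case False
  then have "{n. \<beta> n = g} = {}" using assms(1) by blast
  then show ?thesis by simp
qed

lemma tendsto_pullback_subsequence:
  assumes "\<And>n. \<beta> n \<in> \<Gamma>"
  obtains k L where "strict_mono (k :: nat \<Rightarrow> nat)" "(\<lambda>n. pullback (\<beta> (k n))) \<longlonglongrightarrow> L"
proof -
  have "pullback (\<beta> n) \<in> sphere 0 1" for n using pullback(1)[OF assms] by simp
  then obtain L k where "strict_mono (k :: nat \<Rightarrow> nat)" "((\<lambda>n. pullback (\<beta> n)) \<circ> k) \<longlonglongrightarrow> L"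
    using compact_sphere unfolding compact_def by metis
  then show ?thesis using that by (simp add: comp_def)
qed

lemma finite_subsequence:
  assumes "strict_mono (k :: nat \<Rightarrow> nat)" "finite {n. \<beta> n = g}"
  shows "finite {n. \<beta> (k n) = g}"
  using finite_vimageI[OF assms(2) strict_mono_imp_inj_on[OF assms(1)]] by (simp add: vimage_def)

end

section \<open>Ends of the slice and separation of the limit set\<close>

text \<open>The exponential of the Busemann function: its level sets are the horospheres at
  \<open>\<zeta>\<close>.\<close>

definition horofunction :: "real^3 \<Rightarrow> real^3 \<Rightarrow> real" where
  "horofunction \<zeta> v = (1 - \<zeta> \<bullet> v) / sqrt (1 - (norm v)\<^sup>2)"

lemma sq_norm_less_1: "v \<in> H3 \<Longrightarrow> (norm v)\<^sup>2 < 1" for v :: "real^3"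
  by (simp add: power_less_one_iff)

lemma inner_le_norm_sphere: "\<zeta> \<in> S2 \<Longrightarrow> \<zeta> \<bullet> v \<le> norm v" for v \<zeta> :: "real^3"
  using norm_cauchy_schwarz[of \<zeta> v] by simp

lemma horofunction_ge:
  assumes "\<zeta> \<in> S2" "v \<in> H3"
  shows "1 - \<zeta> \<bullet> v \<le> horofunction \<zeta> v"
proof -
  have s: "0 < sqrt (1 - (norm v)\<^sup>2)" "sqrt (1 - (norm v)\<^sup>2) \<le> 1"
    using sq_norm_less_1[OF assms(2)] by auto
  have "0 \<le> 1 - \<zeta> \<bullet> v" using inner_le_norm_sphere[OF assms(1), of v] assms(2) by simp
  then have "(1 - \<zeta> \<bullet> v) * sqrt (1 - (norm v)\<^sup>2) \<le> 1 - \<zeta> \<bullet> v"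
    using s(2) by (rule mult_left_le[rotated])
  then show ?thesis using s(1) by (simp add: horofunction_def pos_le_divide_eq)
qed

lemma dist_le_horofunction:
  assumes "\<zeta> \<in> S2" "v \<in> H3"
  shows "(norm (\<zeta> - v))\<^sup>2 \<le> 2 * horofunction \<zeta> v"
proof -
  have "(norm (\<zeta> - v))\<^sup>2 = 1 - 2 * (\<zeta> \<bullet> v) + (norm v)\<^sup>2"
    using assms(1) unfolding power2_norm_eq_inner
    by (simp add: inner_diff_left inner_diff_right inner_commute norm_eq_1)
  also have "\<dots> \<le> 2 * (1 - \<zeta> \<bullet> v)" using sq_norm_less_1[OF assms(2)] by simp
  finally show ?thesis using horofunction_ge[OF assms] by simp
qed

text \<open>All values at \<open>\<zeta>\<close> are multiplied by the same factor, so comparisons between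
  them are invariant.\<close>

lemma horofunction_act:
  assumes g: "g \<in> carrier PSL2C" and \<zeta>: "\<zeta> \<in> S2" and v: "v \<in> H3"
  shows "horofunction (act g \<zeta>) (act g v) = horofunction \<zeta> v / weight g \<zeta>"
proof -
  have c: "\<zeta> \<in> cball 0 1" "v \<in> cball 0 1" using \<zeta> v by auto
  define p q where "p = weight g \<zeta>" and "q = weight g v"
  have pq: "p > 0" "q > 0" using weight_pos[OF g] c by (simp_all add: p_def q_def)
  have e: "p * q * (1 - act g \<zeta> \<bullet> act g v) = 1 - \<zeta> \<bullet> v" using act_inner[OF g c] by (simp add: p_def q_def)
  have "sqrt (1 - (norm v)\<^sup>2) = q * sqrt (1 - (norm (act g v))\<^sup>2)"
    unfolding act_norm[OF g c(2), symmetric] real_sqrt_mult using pq by (simp add: q_def)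
  then have "horofunction \<zeta> v / p = (p * q * (1 - act g \<zeta> \<bullet> act g v)) / (p * q * sqrt (1 - (norm (act g v))\<^sup>2))"
    by (simp add: horofunction_def e mult.commute)
  also have "\<dots> = horofunction (act g \<zeta>) (act g v)"
    using pq unfolding horofunction_def by (intro mult_divide_mult_cancel_left) simp
  finally show ?thesis by (simp add: p_def)
qed

lemma norm_segment_to_sphere:
  assumes u: "u \<in> H3" and \<zeta>: "\<zeta> \<in> S2" and t: "0 \<le> t" "t < 1"
  shows "(1 - t) *\<^sub>R u + t *\<^sub>R \<zeta> \<in> H3"
    "(1 - t) * (1 - norm u) \<le> 1 - (norm ((1 - t) *\<^sub>R u + t *\<^sub>R \<zeta>))\<^sup>2"
proof -
  define y where "y = (1 - t) *\<^sub>R u + t *\<^sub>R \<zeta>"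
  have "norm y \<le> (1 - t) * norm u + t"
    unfolding y_def using t \<zeta> norm_triangle_ineq[of "(1 - t) *\<^sub>R u" "t *\<^sub>R \<zeta>"] by simp
  then have y: "norm y \<le> 1 - (1 - t) * (1 - norm u)" by (simp add: algebra_simps)
  have pos: "(1 - t) * (1 - norm u) > 0" using t u by simp
  then have n: "norm y < 1" using y by linarith
  then show "(1 - t) *\<^sub>R u + t *\<^sub>R \<zeta> \<in> H3" by (simp add: y_def)
  have "(norm y)\<^sup>2 \<le> norm y" using n by (simp add: power2_eq_square mult_left_le)
  then show "(1 - t) * (1 - norm u) \<le> 1 - (norm ((1 - t) *\<^sub>R u + t *\<^sub>R \<zeta>))\<^sup>2"
    using y unfolding y_def by linarith
qed

text \<open>On a geodesic that ends at \<open>\<zeta>\<close> the horofunction tends to \<open>0\<close>,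
  uniformly in \<open>\<zeta>\<close>.\<close>

lemma horofunction_segment:
  assumes u: "u \<in> H3" and \<zeta>: "\<zeta> \<in> S2" and t: "0 \<le> t" "t < 1"
  shows "(horofunction \<zeta> ((1 - t) *\<^sub>R u + t *\<^sub>R \<zeta>))\<^sup>2 \<le> 4 * (1 - t) / (1 - norm u)"
proof -
  define y where "y = (1 - t) *\<^sub>R u + t *\<^sub>R \<zeta>"
  have yH: "y \<in> H3" and y2: "(1 - t) * (1 - norm u) \<le> 1 - (norm y)\<^sup>2"
    using norm_segment_to_sphere[OF assms] by (simp_all only: y_def)
  have pos: "(1 - t) * (1 - norm u) > 0" using t u by simp
  have "\<zeta> \<bullet> \<zeta> = 1" using \<zeta> by (simp add: norm_eq_1)
  then have e: "1 - \<zeta> \<bullet> y = (1 - t) * (1 - \<zeta> \<bullet> u)" by (simp add: y_def inner_add_right algebra_simps)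
  have "\<bar>\<zeta> \<bullet> u\<bar> \<le> 1" using Cauchy_Schwarz_ineq2[of \<zeta> u] \<zeta> u by simp
  then have b: "0 \<le> 1 - \<zeta> \<bullet> u" "1 - \<zeta> \<bullet> u \<le> 2" by linarith+
  have "(horofunction \<zeta> y)\<^sup>2 = (1 - \<zeta> \<bullet> y)\<^sup>2 / (1 - (norm y)\<^sup>2)"
    using sq_norm_less_1[OF yH] by (simp add: horofunction_def power_divide)
  also have "\<dots> \<le> (1 - \<zeta> \<bullet> y)\<^sup>2 / ((1 - t) * (1 - norm u))"
    using y2 pos by (intro divide_left_mono) auto
  also have "\<dots> = (1 - t) * (1 - \<zeta> \<bullet> u)\<^sup>2 / (1 - norm u)"
    using t unfolding e by (simp add: power_mult_distrib power2_eq_square)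
  also have "\<dots> \<le> (1 - t) * 2\<^sup>2 / (1 - norm u)"
    using b t u by (intro divide_right_mono mult_left_mono power_mono) auto
  finally show ?thesis by (simp add: y_def mult.commute)
qed

lemma segment_tendsto: "((\<lambda>t. (1 - t) *\<^sub>R u + t *\<^sub>R \<xi>) \<longlongrightarrow> \<xi>) (at_left (1::real))" for u \<xi> :: "real^3"
proof -
  have "((\<lambda>t. (1 - t) *\<^sub>R u + t *\<^sub>R \<xi>) \<longlongrightarrow> (1 - 1) *\<^sub>R u + 1 *\<^sub>R \<xi>) (at_left (1::real))"
    by (intro tendsto_intros)
  then show ?thesis by simp
qed

context closed_plane
begin

definition slice :: "(real^3) set" where
  "slice = {w \<in> limit_hull \<inter> H3. a \<bullet> w + b = 0}"

text \<open>Let \<open>p\<close> be a point of the slice near the sphere. An element whose inverse brings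
  \<open>p\<close> back to the ball of radius \<open>r\<close> maps \<open>p0\<close> to the side of the
  plane on which most of the hull lies, as seen from \<open>p\<close>. The sign \<open>\<sigma>\<close> is
  \<open>1\<close> or \<open>-1\<close>.\<close>

definition side :: "real \<Rightarrow> (real^3) set" where
  "side \<sigma> = {p \<in> slice. \<exists>g\<in>\<Gamma>. \<exists>u. norm u \<le> r \<and> p = act g u \<and> \<sigma> * (a \<bullet> act g p0 + b) > 0}"

lemma convex_slice: "convex slice"
proof -
  have "slice = limit_hull \<inter> H3 \<inter> {w. a \<bullet> w = - b}" by (auto simp: slice_def)
  then show ?thesis by (simp add: convex_Int convex_ball convex_hyperplane)
qed

lemma p0_slice: "p0 \<in> slice"
  using p0 p0_H3 interior_subset by (auto simp: slice_def)

lemma slice_H3: "p \<in> slice \<Longrightarrow> p \<in> H3"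
  by (simp add: slice_def)

lemma slice_representation:
  assumes p: "p \<in> slice"
  obtains g u where "g \<in> \<Gamma>" "norm u \<le> r" "p = act g u"
proof -
  have "p \<in> limit_hull" "p \<in> H3" using p by (auto simp: slice_def)
  then obtain h where h: "h \<in> \<Gamma>" "norm (act h p) \<le> r" using cocompact by blast
  interpret PSL: group PSL2C by (rule PSL2C_group)
  have "p = act (inv\<^bsub>PSL2C\<^esub> h) (act h p)"
    using act_inv(1)[OF in_PSL2C[OF h(1)], of p] \<open>p \<in> H3\<close> by simp
  then show ?thesis using that[OF inv_mem[OF h(1)] h(2)] by simp
qed

lemma slice_segment:
  assumes \<xi>: "\<xi> \<in> limit_set \<Gamma>" "a \<bullet> \<xi> + b = 0" and t: "0 \<le> t" "t < 1"
  shows "(1 - t) *\<^sub>R p0 + t *\<^sub>R \<xi> \<in> slice"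
proof -
  have "p0 \<in> limit_hull" "\<xi> \<in> limit_hull" using p0(1) interior_subset \<xi>(1) by (auto intro: hull_inc)
  then have "(1 - t) *\<^sub>R p0 + t *\<^sub>R \<xi> \<in> limit_hull"
    using convexD_alt[OF convex_convex_hull, of p0 "limit_set \<Gamma>" \<xi> t] t by simp
  moreover have "(1 - t) *\<^sub>R p0 + t *\<^sub>R \<xi> \<in> H3"
    using norm_segment_to_sphere(1)[OF p0_H3 _ t] \<xi>(1) limit_set_subset by blast
  moreover have "a \<bullet> ((1 - t) *\<^sub>R p0 + t *\<^sub>R \<xi>) + b = (1 - t) * (a \<bullet> p0 + b) + t * (a \<bullet> \<xi> + b)"
    by (simp add: inner_add_right algebra_simps)
  ultimately show ?thesis using p0(2) \<xi>(2) by (simp add: slice_def)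
qed

text \<open>The side does not depend on the element that brings the point back. Otherwise the preimages of
  the plane under elements \<open>g\<^sub>n\<close> would tend to a plane that weakly separates
  \<open>p0\<close> from another interior point \<open>q\<close> of the hull (the same one for infinitely
  many \<open>n\<close>, by proper discontinuity), and this plane would meet the interior.\<close>

lemma far_sides:
  obtains R where "R < 1"
    "\<And>g h u v. g \<in> \<Gamma> \<Longrightarrow> h \<in> \<Gamma> \<Longrightarrow> norm u \<le> r \<Longrightarrow> norm v \<le> r \<Longrightarrow> act g u = act h v \<Longrightarrow>
      R < norm (act g u) \<Longrightarrow> a \<bullet> act g p0 + b \<ge> 0 \<Longrightarrow> a \<bullet> act h p0 + b > 0"
proof (rule ccontr)
  note witness = that
  assume contra: "\<not> thesis"
  have "\<exists>g h u v. g \<in> \<Gamma> \<and> h \<in> \<Gamma> \<and> norm u \<le> r \<and> norm v \<le> r \<and> act g u = act h v \<and>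
      R < norm (act g u) \<and> a \<bullet> act g p0 + b \<ge> 0 \<and> a \<bullet> act h p0 + b \<le> 0" if "R < 1" for R
    using contra witness[OF that] by (metis not_le)
  then have "\<forall>n. \<exists>g h u v. g \<in> \<Gamma> \<and> h \<in> \<Gamma> \<and> norm u \<le> r \<and> norm v \<le> r \<and> act g u = act h v \<and>
      1 - inverse (real (Suc n)) < norm (act g u) \<and> a \<bullet> act g p0 + b \<ge> 0 \<and> a \<bullet> act h p0 + b \<le> 0" by simp
  then obtain g h u v where gh: "\<And>n. g n \<in> \<Gamma>" "\<And>n. h n \<in> \<Gamma>" and uv: "\<And>n. norm (u n) \<le> r" "\<And>n. norm (v n) \<le> r"
    and eq: "\<And>n. act (g n) (u n) = act (h n) (v n)"
    and far: "\<And>n. 1 - inverse (real (Suc n)) < norm (act (g n) (u n))"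
    and sg: "\<And>n. a \<bullet> act (g n) p0 + b \<ge> 0" and sh: "\<And>n. a \<bullet> act (h n) p0 + b \<le> 0"
    by metis
  have uc: "u n \<in> cball 0 1" "v n \<in> cball 0 1" for n using uv[of n] r by auto
  have lim: "(\<lambda>n. norm (act (g n) (u n))) \<longlonglongrightarrow> 1"
  proof (rule tendsto_sandwich[of "\<lambda>n. 1 - inverse (real (Suc n))" _ _ "\<lambda>_. 1"])
    have "(\<lambda>n. 1 - inverse (real (Suc n))) \<longlonglongrightarrow> 1 - 0" by (intro tendsto_diff tendsto_const LIMSEQ_inverse_real_of_nat)
    then show "(\<lambda>n. 1 - inverse (real (Suc n))) \<longlonglongrightarrow> 1" by simp
    show "eventually (\<lambda>n. norm (act (g n) (u n)) \<le> 1) sequentially"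
      using act_cball[OF in_PSL2C[OF gh(1)] uc(1)] by simp
    show "eventually (\<lambda>n. 1 - inverse (real (Suc n)) \<le> norm (act (g n) (u n))) sequentially"
      using far by (simp add: less_imp_le)
  qed simp
  have fin: "finite {n. g n = k}" for k by (rule finitely_often_if_escaping[OF gh(1) uv(1) lim])
  define d where "d n = inv\<^bsub>PSL2C\<^esub> (h n) \<otimes>\<^bsub>PSL2C\<^esub> g n" for n
  have dG: "d n \<in> \<Gamma>" for n unfolding d_def by (intro mult_mem inv_mem gh)
  have "act (d n) (u n) = v n" for n
    unfolding d_def act_mult[OF in_PSL2C[OF inv_mem[OF gh(2)]] in_PSL2C[OF gh(1)] uc(1)] eq
    by (rule act_inv(1)[OF in_PSL2C[OF gh(2)] uc(2)])
  then have "d n \<in> {k \<in> \<Gamma>. \<exists>u. norm u \<le> r \<and> norm (act k u) \<le> r}" for n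
    using dG uv by (intro CollectI conjI exI[of _ "u n"]) auto
  then have "finite (range d)" using finite_returns[OF r(2)] by (meson finite_subset image_subsetI)
  then obtain k0 where "infinite {n. d n = k0}"
    using pigeonhole_infinite[of "UNIV :: nat set" d] by auto
  then obtain l where l: "strict_mono (l :: nat \<Rightarrow> nat)" "\<And>n. d (l n) = k0"
    using infinite_enumerate[of "{n. d n = k0}"] by auto
  have k0: "k0 \<in> \<Gamma>" using dG[of "l 0"] l(2) by simp
  obtain m L where m: "strict_mono (m :: nat \<Rightarrow> nat)" and L: "(\<lambda>n. pullback (g (l (m n)))) \<longlonglongrightarrow> L"
    by (rule tendsto_pullback_subsequence[of "\<lambda>n. g (l n)"]) (use gh in auto)
  have finm: "finite {n. g (l (m n)) = k}" for k
    by (rule finite_subsequence[OF m finite_subsequence[OF l(1) fin]])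
  have nonzero: "affine_value L w \<noteq> 0" if "w \<in> interior limit_hull" for w
    by (rule limit_plane_avoids_interior[OF gh(1) finm L that])
  define q where "q = act (inv\<^bsub>PSL2C\<^esub> k0) p0"
  have q: "q \<in> interior limit_hull" unfolding q_def by (rule act_mem_interior_hull[OF inv_mem[OF k0] p0(1)])
  have p0c: "p0 \<in> cball 0 1" by (rule in_cball_if_interior[OF p0(1)])
  have "affine_value (pullback (g n)) p0 \<ge> 0" for n
    using pullback_sign(3)[OF gh(1) p0c] sg by (simp add: not_less[symmetric])
  then have Lp: "affine_value L p0 \<ge> 0"
    by (intro LIMSEQ_le_const[OF tendsto_affine_value[OF L tendsto_const]]) blast
  have "act (g (l n)) q = act (h (l n)) p0" for n
  proof -
    interpret PSL: group PSL2C by (rule PSL2C_group)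
    note c = in_PSL2C[OF gh(1)[of "l n"]] in_PSL2C[OF gh(2)[of "l n"]] in_PSL2C[OF k0]
    have "h (l n) \<otimes>\<^bsub>PSL2C\<^esub> k0 = g (l n)"
      unfolding l(2)[of n, symmetric] d_def using c by (simp add: PSL.inv_solve_left' PSL.m_assoc[symmetric])
    then have "act (g (l n)) q = act (h (l n)) (act k0 q)"
      using act_mult[OF c(2,3), of q] in_cball_if_interior[OF q] by simp
    also have "act k0 q = p0" unfolding q_def by (rule act_inv(2)[OF c(3) p0c])
    finally show ?thesis .
  qed
  then have "affine_value (pullback (g (l n))) q \<le> 0" for n
    using pullback_sign(2)[OF gh(1) in_cball_if_interior[OF q]] sh by (simp add: not_less[symmetric])
  then have Lq: "affine_value L q \<le> 0"
    by (intro LIMSEQ_le_const2[OF tendsto_affine_value[OF L tendsto_const]]) blast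
  have "\<exists>w\<in>closed_segment p0 q. affine_value L w = 0"
  proof -
    have "connected (affine_value L ` closed_segment p0 q)"
      by (intro connected_continuous_image continuous_affine_value connected_segment)
    moreover have "affine_value L q \<in> affine_value L ` closed_segment p0 q" "affine_value L p0 \<in> affine_value L ` closed_segment p0 q"
      by auto
    ultimately have "0 \<in> affine_value L ` closed_segment p0 q"
      using connectedD_interval[OF _ _ _ Lq Lp] by blast
    then show ?thesis by (auto simp: image_iff)
  qed
  moreover have "closed_segment p0 q \<subseteq> interior limit_hull"
    by (intro closed_segment_subset p0(1) q convex_interior convex_convex_hull)
  ultimately show False using nonzero by blast
qed

lemma pullback_sign_mult:
  assumes "g \<in> \<Gamma>" "w \<in> cball 0 1"
  shows "\<sigma> * affine_value (pullback g) w > 0 \<longleftrightarrow> \<sigma> * (a \<bullet> act g w + b) > 0"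
proof -
  have "sgn (\<sigma> * affine_value (pullback g) w) = sgn (\<sigma> * (a \<bullet> act g w + b))"
    by (simp only: sgn_mult pullback(2)[OF assms])
  then show ?thesis by (metis sgn_1_pos sgn_pos)
qed

lemma exactly_one_side:
  obtains R where "R < 1"
    "\<forall>p\<in>slice. R < norm p \<longrightarrow> (p \<in> side 1 \<longleftrightarrow> p \<notin> side (-1))"
proof -
  obtain R where R: "R < 1"
    and far: "\<And>g h u v. g \<in> \<Gamma> \<Longrightarrow> h \<in> \<Gamma> \<Longrightarrow> norm u \<le> r \<Longrightarrow> norm v \<le> r \<Longrightarrow> act g u = act h v \<Longrightarrow>
      R < norm (act g u) \<Longrightarrow> a \<bullet> act g p0 + b \<ge> 0 \<Longrightarrow> a \<bullet> act h p0 + b > 0"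
    using far_sides by blast
  have "p \<in> side 1 \<longleftrightarrow> p \<notin> side (-1)" if p: "p \<in> slice" "R < norm p" for p
  proof
    assume "p \<in> side 1"
    then obtain g u where g: "g \<in> \<Gamma>" "norm u \<le> r" "p = act g u" "a \<bullet> act g p0 + b > 0"
      by (auto simp: side_def)
    show "p \<notin> side (-1)"
    proof
      assume "p \<in> side (-1)"
      then obtain h v where h: "h \<in> \<Gamma>" "norm v \<le> r" "p = act h v" "a \<bullet> act h p0 + b < 0"
        by (auto simp: side_def)
      have "a \<bullet> act h p0 + b > 0"
        by (rule far[OF g(1) h(1) g(2) h(2)]) (use g h p in auto)
      then show False using h(4) by simp
    qed
  next
    assume no: "p \<notin> side (-1)"
    obtain g u where g: "g \<in> \<Gamma>" "norm u \<le> r" "p = act g u" using slice_representation[OF p(1)] by blast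
    have "\<not> - 1 * (a \<bullet> act g p0 + b) > 0" using no g p(1) unfolding side_def by blast
    then have "a \<bullet> act g p0 + b \<ge> 0" by simp
    then have "a \<bullet> act g p0 + b > 0"
      using far[OF g(1) g(1) g(2) g(2) refl] p(2) g(3) by simp
    then show "p \<in> side 1" using g p(1) unfolding side_def by (auto intro!: exI[of _ u] bexI[of _ g])
  qed
  then show ?thesis using that R by blast
qed

text \<open>Only finitely many elements bring points of the segment back to the ball of radius
  \<open>r\<close>.\<close>

lemma closed_side_on_segment:
  assumes S: "closed_segment p q \<subseteq> slice"
  shows "closed (closed_segment p q \<inter> side \<tau>)"
proof -
  let ?S = "closed_segment p q"
  have "compact ?S" "?S \<noteq> {}" by auto
  then obtain y where y: "y \<in> ?S" "\<And>z. z \<in> ?S \<Longrightarrow> dist 0 z \<le> dist 0 y"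
    using distance_attains_sup by metis
  define \<rho> where "\<rho> = max r (norm y)"
  have \<rho>: "\<rho> < 1" "r \<le> \<rho>" "\<And>z. z \<in> ?S \<Longrightarrow> norm z \<le> \<rho>"
    using y S slice_H3[of y] r by (auto simp: \<rho>_def le_max_iff_disj)
  define F where "F = {g \<in> \<Gamma>. \<tau> * (a \<bullet> act g p0 + b) > 0 \<and> (\<exists>u. norm u \<le> \<rho> \<and> norm (act g u) \<le> \<rho>)}"
  have "finite F"
    by (rule finite_subset[OF _ finite_returns[OF \<rho>(1)]]) (auto simp: F_def)
  moreover have "closed (?S \<inter> (\<lambda>w. norm (act (inv\<^bsub>PSL2C\<^esub> g) w)) -` {..r})" if "g \<in> F" for g
  proof (rule continuous_closed_preimage)
    have "g \<in> \<Gamma>" using that by (simp add: F_def)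
    then have "continuous_on (cball 0 1) (act (inv\<^bsub>PSL2C\<^esub> g))" by (intro act_continuous in_PSL2C inv_mem)
    moreover have "?S \<subseteq> cball 0 1" using \<rho> by fastforce
    ultimately show "continuous_on ?S (\<lambda>w. norm (act (inv\<^bsub>PSL2C\<^esub> g) w))"
      by (intro continuous_on_norm) (rule continuous_on_subset)
  qed auto
  ultimately have "closed (\<Union>g\<in>F. ?S \<inter> (\<lambda>w. norm (act (inv\<^bsub>PSL2C\<^esub> g) w)) -` {..r})" by blast
  moreover have "?S \<inter> side \<tau> = (\<Union>g\<in>F. ?S \<inter> (\<lambda>w. norm (act (inv\<^bsub>PSL2C\<^esub> g) w)) -` {..r})"
  proof (intro equalityI subsetI)
    fix w assume w: "w \<in> ?S \<inter> side \<tau>"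
    then obtain g u where g: "g \<in> \<Gamma>" "norm u \<le> r" "w = act g u" "\<tau> * (a \<bullet> act g p0 + b) > 0"
      by (auto simp: side_def)
    have "act (inv\<^bsub>PSL2C\<^esub> g) w = u" unfolding g(3) using g(2) r by (intro act_inv(1)[OF in_PSL2C[OF g(1)]]) simp
    moreover have "norm u \<le> \<rho>" "norm (act g u) \<le> \<rho>" using g(2,3) \<rho>(2) \<rho>(3)[of w] w by auto
    then have "g \<in> F" using g(1,4) unfolding F_def by blast
    ultimately show "w \<in> (\<Union>g\<in>F. ?S \<inter> (\<lambda>w. norm (act (inv\<^bsub>PSL2C\<^esub> g) w)) -` {..r})" using w g(2) by auto
  next
    fix w assume "w \<in> (\<Union>g\<in>F. ?S \<inter> (\<lambda>w. norm (act (inv\<^bsub>PSL2C\<^esub> g) w)) -` {..r})"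
    then obtain g where g: "g \<in> \<Gamma>" "\<tau> * (a \<bullet> act g p0 + b) > 0" "norm (act (inv\<^bsub>PSL2C\<^esub> g) w) \<le> r" "w \<in> ?S"
      by (auto simp: F_def)
    have "w \<in> cball 0 1" using \<rho>(1) \<rho>(3)[OF g(4)] by simp
    then have "w = act g (act (inv\<^bsub>PSL2C\<^esub> g) w)" using act_inv(2)[OF in_PSL2C[OF g(1)]] by simp
    then show "w \<in> ?S \<inter> side \<tau>" using g S unfolding side_def by blast
  qed
  ultimately show ?thesis by simp
qed

lemma same_side_along_segment:
  assumes R: "\<forall>p\<in>slice. R < norm p \<longrightarrow> (p \<in> side 1 \<longleftrightarrow> p \<notin> side (-1))"
    and p: "p \<in> side 1" and q: "q \<in> side (-1)" and far: "\<And>w. w \<in> closed_segment p q \<Longrightarrow> R < norm w"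
  shows False
proof -
  have "p \<in> slice" "q \<in> slice" using p q by (auto simp: side_def)
  then have S: "closed_segment p q \<subseteq> slice" by (intro closed_segment_subset convex_slice)
  let ?S = "closed_segment p q"
  have "(?S \<inter> side 1) \<inter> ?S = {} \<or> (?S \<inter> side (-1)) \<inter> ?S = {}"
  proof (rule connected_closedD[OF connected_segment])
    show "?S \<inter> side 1 \<inter> (?S \<inter> side (- 1)) \<inter> ?S = {}" using R S far by blast
    show "?S \<subseteq> ?S \<inter> side 1 \<union> ?S \<inter> side (- 1)" using R S far by blast
  qed (intro closed_side_on_segment S)+
  then show False using p q by auto
qed

text \<open>The infimum is positive because \<open>\<eta>\<close> is off the plane. The factor
  \<open>2\<close> saves proving that it is attained.\<close>

lemma near_minimiser:
  assumes \<eta>: "\<eta> \<in> S2" "a \<bullet> \<eta> + b \<noteq> 0"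
  shows "\<exists>p. p \<in> slice \<and> (\<forall>z\<in>slice. horofunction \<eta> p \<le> 2 * horofunction \<eta> z)"
proof -
  define \<delta> where "\<delta> = (\<bar>a \<bullet> \<eta> + b\<bar> / norm a)\<^sup>2 / 2"
  have \<delta>: "\<delta> > 0" using \<eta>(2) a_nonzero by (simp add: \<delta>_def)
  have low: "\<delta> \<le> horofunction \<eta> z" if z: "z \<in> slice" for z
  proof -
    have zH: "z \<in> H3" "a \<bullet> z + b = 0" using z by (auto simp: slice_def)
    have "\<bar>a \<bullet> \<eta> + b\<bar> = \<bar>a \<bullet> (\<eta> - z)\<bar>" using zH(2) by (simp add: inner_diff_right algebra_simps)
    also have "\<dots> \<le> norm a * norm (\<eta> - z)" by (rule Cauchy_Schwarz_ineq2)
    finally have "\<bar>a \<bullet> \<eta> + b\<bar> / norm a \<le> norm (\<eta> - z)" using a_nonzero by (simp add: divide_le_eq mult.commute)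
    then have "(\<bar>a \<bullet> \<eta> + b\<bar> / norm a)\<^sup>2 \<le> (norm (\<eta> - z))\<^sup>2" by (intro power_mono) auto
    also have "\<dots> \<le> 2 * horofunction \<eta> z" by (rule dist_le_horofunction[OF \<eta>(1) zH(1)])
    finally show ?thesis unfolding \<delta>_def by linarith
  qed
  define m where "m = Inf (horofunction \<eta> ` slice)"
  have ne: "horofunction \<eta> ` slice \<noteq> {}" using p0_slice by blast
  have bdd: "bdd_below (horofunction \<eta> ` slice)" using low by (intro bdd_belowI2[of _ \<delta>])
  have "\<delta> \<le> m" unfolding m_def using ne low by (intro cInf_greatest) auto
  then have "m < 2 * m" using \<delta> by simp
  then obtain p where p: "p \<in> slice" "horofunction \<eta> p < 2 * m"
    using cInf_lessD[OF ne, of "2 * m"] unfolding m_def by blast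
  have "m \<le> horofunction \<eta> z" if "z \<in> slice" for z unfolding m_def using cInf_lower[OF _ bdd] that by blast
  then have "\<forall>z\<in>slice. horofunction \<eta> p \<le> 2 * horofunction \<eta> z" using p(2) by force
  then show ?thesis using p(1) by blast
qed

text \<open>On a segment in the slice that ends at \<open>\<xi>\<close> the horofunction of
  \<open>\<xi>\<close> has small values, and so has that of \<open>\<eta>\<^sub>n\<close> for large
  \<open>n\<close>. Points with small horofunction are close to the centre of the horospheres.\<close>

lemma near_minimisers_converge:
  assumes \<eta>: "\<And>n. \<eta> n \<in> S2" "\<eta> \<longlonglongrightarrow> \<xi>" and \<xi>: "\<xi> \<in> limit_set \<Gamma>" "a \<bullet> \<xi> + b = 0"
    and p: "\<And>n. p n \<in> slice" "\<And>n z. z \<in> slice \<Longrightarrow> horofunction (\<eta> n) (p n) \<le> 2 * horofunction (\<eta> n) z"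
  shows "p \<longlonglongrightarrow> \<xi>"
proof -
  have \<xi>S: "\<xi> \<in> S2" using \<xi>(1) limit_set_subset by blast
  have n0: "1 - norm p0 > 0" using p0_H3 by simp
  have horo0: "(\<lambda>n. horofunction (\<eta> n) (p n)) \<longlonglongrightarrow> 0"
  proof (rule order_tendstoI)
    fix c :: real assume "c < 0"
    moreover have "0 \<le> horofunction (\<eta> n) (p n)" for n
    proof -
      have "0 \<le> 2 * horofunction (\<eta> n) (p n)"
        by (rule order_trans[OF zero_le_power2 dist_le_horofunction[OF \<eta>(1) slice_H3[OF p(1)]]])
      then show ?thesis by simp
    qed
    ultimately show "eventually (\<lambda>n. c < horofunction (\<eta> n) (p n)) sequentially"
      by (intro always_eventually allI) (rule less_le_trans)
  next
    fix c :: real assume c: "0 < c"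
    \<comment> \<open>\<open>s\<close> is so small that \<open>horofunction_segment\<close> makes the horofunction of \<open>\<xi>\<close> at \<open>v\<close> less than \<open>c / 2\<close>\<close>
    define s where "s = min 1 ((c / 2)\<^sup>2 * (1 - norm p0) / 8)"
    have s: "0 < s" "s \<le> 1" using c n0 by (auto simp: s_def)
    define v where "v = (1 - (1 - s)) *\<^sub>R p0 + (1 - s) *\<^sub>R \<xi>"
    have v: "v \<in> slice" unfolding v_def by (rule slice_segment[OF \<xi>]) (use s in auto)
    have "(horofunction \<xi> v)\<^sup>2 \<le> 4 * (1 - (1 - s)) / (1 - norm p0)"
      unfolding v_def by (rule horofunction_segment[OF p0_H3 \<xi>S]) (use s in auto)
    also have "\<dots> \<le> 4 * ((c / 2)\<^sup>2 * (1 - norm p0) / 8) / (1 - norm p0)"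
      using n0 by (intro divide_right_mono mult_left_mono) (auto simp: s_def)
    also have "\<dots> = (c / 2)\<^sup>2 / 2"
    proof -
      have "4 * (y * m / 8) / m = y / 2" if "m > 0" for y m :: real using that by simp
      then show ?thesis using n0 by blast
    qed
    also have "\<dots> < (c / 2)\<^sup>2" using c by simp
    finally have "horofunction \<xi> v < c / 2" using c by (intro power2_less_imp_less[of _ "c / 2"]) auto
    moreover have "(\<lambda>n. horofunction (\<eta> n) v) \<longlonglongrightarrow> horofunction \<xi> v"
      unfolding horofunction_def using sq_norm_less_1[OF slice_H3[OF v]]
      by (intro tendsto_divide tendsto_diff tendsto_inner tendsto_const \<eta>(2)) auto
    ultimately have "eventually (\<lambda>n. horofunction (\<eta> n) v < c / 2) sequentially" by (rule order_tendstoD(2)[rotated])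
    then show "eventually (\<lambda>n. horofunction (\<eta> n) (p n) < c) sequentially"
    proof (rule eventually_mono)
      fix n assume "horofunction (\<eta> n) v < c / 2"
      then show "horofunction (\<eta> n) (p n) < c" using p(2)[OF v, of n] by linarith
    qed
  qed
  have "(\<lambda>n. (norm (\<eta> n - p n))\<^sup>2) \<longlonglongrightarrow> 0"
  proof (rule tendsto_sandwich[of "\<lambda>_. 0" _ _ "\<lambda>n. 2 * horofunction (\<eta> n) (p n)"])
    show "(\<lambda>n. 2 * horofunction (\<eta> n) (p n)) \<longlonglongrightarrow> 0" using tendsto_mult_right_zero[OF horo0] by simp
    show "eventually (\<lambda>n. (norm (\<eta> n - p n))\<^sup>2 \<le> 2 * horofunction (\<eta> n) (p n)) sequentially"
      using dist_le_horofunction[OF \<eta>(1) slice_H3[OF p(1)]] by simp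
  qed auto
  then have "(\<lambda>n. norm (\<eta> n - p n)) \<longlonglongrightarrow> 0" by simp
  then have "(\<lambda>n. \<eta> n - p n) \<longlonglongrightarrow> 0" by (rule tendsto_norm_zero_cancel)
  then have "(\<lambda>n. \<eta> n - (\<eta> n - p n)) \<longlonglongrightarrow> \<xi> - 0" by (intro tendsto_diff \<eta>(2))
  then show ?thesis by simp
qed

text \<open>Near-minimizers \<open>p\<^sub>n = g\<^sub>n u\<^sub>n\<close> of the horofunctions of
  \<open>\<eta>\<^sub>n = g\<^sub>n \<zeta>\<^sub>n\<close> tend to \<open>\<xi>\<close>, and the preimages
  of the plane under \<open>g\<^sub>n\<close> tend to a plane \<open>L\<close> that avoids the interior of
  the hull. Suppose that \<open>p0\<close> is on the other side of \<open>L\<close> than the points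
  \<open>\<zeta>\<^sub>n\<close>. Then the segment from \<open>p0\<close> to \<open>\<zeta>\<^sub>n\<close>
  crosses the preimage of the plane at a parameter \<open>t\<^sub>n\<close>. The horofunction of
  \<open>\<zeta>\<^sub>n\<close> at the crossing is at least half of its value at \<open>u\<^sub>n\<close>,
  which is bounded below as \<open>u\<^sub>n\<close> stays in the ball of radius \<open>r\<close>; so
  \<open>t\<^sub>n\<close> stays away from \<open>1\<close>. The limit of the crossings is therefore an
  interior point of the hull on \<open>L\<close>.\<close>

theorem accumulation_on_same_side:
  assumes \<sigma>: "\<sigma> \<noteq> 0" and \<eta>: "\<And>n. \<eta> n \<in> limit_set \<Gamma>" "\<And>n. \<sigma> * (a \<bullet> \<eta> n + b) > 0" "\<eta> \<longlonglongrightarrow> \<xi>" and \<xi>: "a \<bullet> \<xi> + b = 0"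
  shows "\<xi> \<in> closure (side \<sigma>)"
proof -
  have \<eta>S: "\<eta> n \<in> S2" for n using \<eta>(1) limit_set_subset by blast
  have \<xi>L: "\<xi> \<in> limit_set \<Gamma>" using closed_sequentially[OF compact_imp_closed[OF compact_limit_set] \<eta>(1,3)] .
  have \<xi>S: "\<xi> \<in> S2" using \<xi>L limit_set_subset by blast
  have "a \<bullet> \<eta> n + b \<noteq> 0" for n using \<eta>(2)[of n] by auto
  then have "\<forall>n. \<exists>p. p \<in> slice \<and> (\<forall>z\<in>slice. horofunction (\<eta> n) p \<le> 2 * horofunction (\<eta> n) z)"
    using near_minimiser \<eta>S by blast
  then obtain p where p: "\<And>n. p n \<in> slice" "\<And>n z. z \<in> slice \<Longrightarrow> horofunction (\<eta> n) (p n) \<le> 2 * horofunction (\<eta> n) z"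
    using choice[of "\<lambda>n p. p \<in> slice \<and> (\<forall>z\<in>slice. horofunction (\<eta> n) p \<le> 2 * horofunction (\<eta> n) z)"] by blast
  have p\<xi>: "p \<longlonglongrightarrow> \<xi>" by (rule near_minimisers_converge[OF \<eta>S \<eta>(3) \<xi>L \<xi> p])
  have "\<forall>n. \<exists>gu. fst gu \<in> \<Gamma> \<and> norm (snd gu) \<le> r \<and> p n = act (fst gu) (snd gu)"
    using slice_representation[OF p(1)] by (metis fst_conv snd_conv)
  then obtain gu where gu: "\<And>n. fst (gu n) \<in> \<Gamma> \<and> norm (snd (gu n)) \<le> r \<and> p n = act (fst (gu n)) (snd (gu n))"
    using choice[of "\<lambda>n gu. fst gu \<in> \<Gamma> \<and> norm (snd gu) \<le> r \<and> p n = act (fst gu) (snd gu)"] by blast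
  define g u where "g n = fst (gu n)" and "u n = snd (gu n)" for n
  have g: "\<And>n. g n \<in> \<Gamma>" and u: "\<And>n. norm (u n) \<le> r" and pg: "\<And>n. p n = act (g n) (u n)"
    using gu by (simp_all add: g_def u_def)
  have "(\<lambda>n. norm (p n)) \<longlonglongrightarrow> norm \<xi>" by (intro tendsto_norm p\<xi>)
  then have "(\<lambda>n. norm (act (g n) (u n))) \<longlonglongrightarrow> 1" using \<xi>S by (simp add: pg)
  then have fin: "finite {n. g n = h}" for h by (rule finitely_often_if_escaping[OF g u])
  define \<zeta> where "\<zeta> n = act (inv\<^bsub>PSL2C\<^esub> (g n)) (\<eta> n)" for n
  have \<zeta>: "\<zeta> n \<in> limit_set \<Gamma>" for n unfolding \<zeta>_def by (intro act_mem_limit_set inv_mem g \<eta>(1))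
  have \<zeta>S: "\<zeta> n \<in> S2" for n using \<zeta> limit_set_subset by blast
  have \<zeta>c: "\<zeta> n \<in> cball 0 1" for n using \<zeta>S[of n] by auto
  have g\<zeta>: "act (g n) (\<zeta> n) = \<eta> n" for n
    unfolding \<zeta>_def using \<eta>S[of n] by (intro act_inv(2)[OF in_PSL2C[OF g]]) auto
  obtain k1 L where k1: "strict_mono (k1 :: nat \<Rightarrow> nat)" and L1: "(\<lambda>n. pullback (g (k1 n))) \<longlonglongrightarrow> L"
    by (rule tendsto_pullback_subsequence[OF g])
  obtain z k2 where k2: "strict_mono (k2 :: nat \<Rightarrow> nat)" and z: "z \<in> limit_set \<Gamma>" and Z1: "((\<lambda>n. \<zeta> (k1 n)) \<circ> k2) \<longlonglongrightarrow> z"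
    using compact_limit_set \<zeta> unfolding compact_def by metis
  define k where "k = k1 \<circ> k2"
  have k: "strict_mono k" unfolding k_def by (rule strict_mono_o[OF k1 k2])
  have L: "(\<lambda>n. pullback (g (k n))) \<longlonglongrightarrow> L"
    using LIMSEQ_subseq_LIMSEQ[OF L1 k2] by (simp add: k_def comp_def)
  have Z: "(\<lambda>n. \<zeta> (k n)) \<longlonglongrightarrow> z" using Z1 by (simp add: k_def comp_def)
  have nonzero: "affine_value L w \<noteq> 0" if "w \<in> interior limit_hull" for w
    by (rule limit_plane_avoids_interior[OF g finite_subsequence[OF k fin] L that])
  define A B where "A n = \<sigma> * affine_value (pullback (g (k n))) p0"
    and "B n = \<sigma> * affine_value (pullback (g (k n))) (\<zeta> (k n))" for n
  define A' B' where "A' = \<sigma> * affine_value L p0" and "B' = \<sigma> * affine_value L z"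
  have A: "A \<longlonglongrightarrow> A'" and B: "B \<longlonglongrightarrow> B'"
    unfolding A_def B_def A'_def B'_def by (intro tendsto_intros tendsto_affine_value L Z)+
  have Bpos: "B n > 0" for n
    unfolding B_def using pullback_sign_mult[OF g \<zeta>c] \<eta>(2) by (simp add: g\<zeta>)
  have B': "B' \<ge> 0" using LIMSEQ_le_const[OF B, of 0] Bpos by (meson less_imp_le)
  have A0: "A' \<noteq> 0" using nonzero[OF p0(1)] \<sigma> by (simp add: A'_def)
  have n0: "1 - norm p0 > 0" using p0_H3 by simp
  have "\<not> A' < 0"
  proof
    assume neg: "A' < 0"
    \<comment> \<open>the parameter at which the segment from \<open>p0\<close> to \<open>\<zeta> (k n)\<close> crosses the preimage of the plane under \<open>g (k n)\<close>\<close>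
    define t where "t n = - A n / (B n - A n)" for n
    define t' where "t' = - A' / (B' - A')"
    have t: "t \<longlonglongrightarrow> t'"
      unfolding t_def t'_def using neg B' by (intro tendsto_intros A B) auto
    have "eventually (\<lambda>n. A n < 0) sequentially" using order_tendstoD(2)[OF A neg] .
    then have "eventually (\<lambda>n. (1 - r)\<^sup>2 * (1 - norm p0) \<le> 16 * (1 - t n)) sequentially"
    proof (rule eventually_mono)
      fix n assume An: "A n < 0"
      have t01: "0 \<le> t n" "t n < 1" using An Bpos[of n] by (auto simp: t_def divide_simps)
      define y where "y = (1 - t n) *\<^sub>R p0 + t n *\<^sub>R \<zeta> (k n)"
      have yH: "y \<in> H3" unfolding y_def by (rule norm_segment_to_sphere(1)[OF p0_H3 \<zeta>S t01])
      have yX: "y \<in> limit_hull"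
        unfolding y_def using convexD_alt[OF convex_convex_hull, of p0 "limit_set \<Gamma>" "\<zeta> (k n)" "t n"] p0(1) interior_subset
          hull_inc[OF \<zeta>] t01 by auto
      have "\<sigma> * affine_value (pullback (g (k n))) y = (1 - t n) * A n + t n * B n"
        unfolding y_def affine_value_segment A_def B_def by (simp add: algebra_simps)
      also have "\<dots> = 0" using An Bpos[of n] by (simp add: t_def field_simps)
      finally have "affine_value (pullback (g (k n))) y = 0" using \<sigma> by simp
      then have "a \<bullet> act (g (k n)) y + b = 0" using pullback_sign(1)[OF g, of y] yH by simp
      then have "act (g (k n)) y \<in> slice"
        using act_mem_hull[OF g yX] act_H3[OF in_PSL2C[OF g] yH] by (simp add: slice_def)
      then have "horofunction (\<eta> (k n)) (p (k n)) \<le> 2 * horofunction (\<eta> (k n)) (act (g (k n)) y)" by (rule p(2))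
      moreover have uH: "u (k n) \<in> H3" using u[of "k n"] r by simp
      moreover have "weight (g (k n)) (\<zeta> (k n)) > 0" by (rule weight_pos[OF in_PSL2C[OF g] \<zeta>c])
      ultimately have le: "horofunction (\<zeta> (k n)) (u (k n)) \<le> 2 * horofunction (\<zeta> (k n)) y"
        unfolding g\<zeta>[symmetric] pg horofunction_act[OF in_PSL2C[OF g] \<zeta>S uH] horofunction_act[OF in_PSL2C[OF g] \<zeta>S yH]
        by (simp add: divide_le_cancel)
      have "1 - r \<le> 1 - \<zeta> (k n) \<bullet> u (k n)" using inner_le_norm_sphere[OF \<zeta>S, of "k n" "u (k n)"] u[of "k n"] by simp
      also have "\<dots> \<le> 2 * horofunction (\<zeta> (k n)) y" using horofunction_ge[OF \<zeta>S uH] le by (rule order_trans)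
      finally have "(1 - r)\<^sup>2 \<le> (2 * horofunction (\<zeta> (k n)) y)\<^sup>2" using r by (intro power_mono) auto
      also have "\<dots> \<le> 4 * (4 * (1 - t n) / (1 - norm p0))"
      proof -
        have "(horofunction (\<zeta> (k n)) y)\<^sup>2 \<le> 4 * (1 - t n) / (1 - norm p0)"
          unfolding y_def by (rule horofunction_segment[OF p0_H3 \<zeta>S t01])
        moreover have "(2 * horofunction (\<zeta> (k n)) y)\<^sup>2 = 4 * (horofunction (\<zeta> (k n)) y)\<^sup>2"
          by (simp add: power_mult_distrib)
        ultimately show ?thesis by linarith
      qed
      finally show "(1 - r)\<^sup>2 * (1 - norm p0) \<le> 16 * (1 - t n)" using n0 by (simp add: field_simps)
    qed
    then have "(1 - r)\<^sup>2 * (1 - norm p0) \<le> 16 * (1 - t')"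
      by (intro tendsto_lowerbound[of "\<lambda>n. 16 * (1 - t n)" _ sequentially]) (intro tendsto_intros t, auto)
    moreover have "0 < (1 - r)\<^sup>2 * (1 - norm p0)" using r n0 by simp
    ultimately have "0 < 16 * (1 - t')" by (rule less_le_trans[rotated])
    then have t'1: "t' < 1" by simp
    have "z - (1 - t') *\<^sub>R (z - p0) \<in> interior limit_hull"
    proof (rule mem_interior_convex_shrink[OF convex_convex_hull p0(1) hull_inc[OF z]])
      show "0 < 1 - t'" using t'1 by simp
      show "1 - t' \<le> 1" using neg B' by (simp add: t'_def divide_simps)
    qed
    moreover have "z - (1 - t') *\<^sub>R (z - p0) = (1 - t') *\<^sub>R p0 + t' *\<^sub>R z" by (simp add: algebra_simps)
    moreover have "\<sigma> * affine_value L ((1 - t') *\<^sub>R p0 + t' *\<^sub>R z) = (1 - t') * A' + t' * B'"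
      unfolding affine_value_segment A'_def B'_def by (simp add: algebra_simps)
    moreover have "(1 - t') * A' + t' * B' = 0" using neg B' by (simp add: t'_def field_simps)
    ultimately show False using nonzero \<sigma> by (metis mult_eq_0_iff)
  qed
  then have "A' > 0" using A0 by linarith
  then have "eventually (\<lambda>n. A n > 0) sequentially" using order_tendstoD(1)[OF A] by blast
  then have "eventually (\<lambda>n. p (k n) \<in> closure (side \<sigma>)) sequentially"
  proof (rule eventually_mono)
    fix n assume "A n > 0"
    then have "\<sigma> * (a \<bullet> act (g (k n)) p0 + b) > 0"
      unfolding A_def using pullback_sign_mult[OF g in_cball_if_interior[OF p0(1)]] by simp
    then have "p (k n) \<in> side \<sigma>" unfolding side_def using p(1) g u pg by blast
    then show "p (k n) \<in> closure (side \<sigma>)" by (rule subsetD[OF closure_subset])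
  qed
  moreover have "(\<lambda>n. p (k n)) \<longlonglongrightarrow> \<xi>" using LIMSEQ_subseq_LIMSEQ[OF p\<xi> k] by (simp add: comp_def)
  ultimately show ?thesis by (rule Lim_in_closed_set[OF closed_closure _ sequentially_bot])
qed

text \<open>The limit set splits into two closed sets: the points \<open>V \<sigma>\<close> on one side of
  the plane, together with the points \<open>E \<sigma>\<close> of the circle at which the slice has this
  side.\<close>

theorem limit_set_disconnected: "\<not> connected (limit_set \<Gamma>)"
proof
  assume conn: "connected (limit_set \<Gamma>)"
  obtain R where R: "R < 1" "\<forall>p\<in>slice. R < norm p \<longrightarrow> (p \<in> side 1 \<longleftrightarrow> p \<notin> side (-1))"
    by (rule exactly_one_side)
  define E where "E \<sigma> = {\<xi> \<in> limit_set \<Gamma>. a \<bullet> \<xi> + b = 0} \<inter> closure (side \<sigma>)" for \<sigma>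
  define V where "V \<sigma> = {\<xi> \<in> limit_set \<Gamma>. \<sigma> * (a \<bullet> \<xi> + b) > 0}" for \<sigma>
  have cl: "closed (V \<sigma> \<union> E \<sigma>)" if \<sigma>: "\<sigma> \<noteq> 0" for \<sigma>
    unfolding closed_sequential_limits
  proof (intro allI impI)
    fix x \<xi> assume x: "(\<forall>n. x n \<in> V \<sigma> \<union> E \<sigma>) \<and> x \<longlonglongrightarrow> \<xi>"
    have xL: "x n \<in> limit_set \<Gamma>" "\<sigma> * (a \<bullet> x n + b) \<ge> 0" for n
    proof -
      have "x n \<in> V \<sigma> \<union> E \<sigma>" using x by blast
      then show "x n \<in> limit_set \<Gamma>" "\<sigma> * (a \<bullet> x n + b) \<ge> 0" by (auto simp: V_def E_def)
    qed
    have lim: "x \<longlonglongrightarrow> \<xi>" using x by blast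
    have \<xi>L: "\<xi> \<in> limit_set \<Gamma>" using closed_sequentially[OF compact_imp_closed[OF compact_limit_set] xL(1) lim] .
    have "(\<lambda>n. \<sigma> * (a \<bullet> x n + b)) \<longlonglongrightarrow> \<sigma> * (a \<bullet> \<xi> + b)" by (intro tendsto_intros lim)
    then have ge: "\<sigma> * (a \<bullet> \<xi> + b) \<ge> 0" using xL(2) by (intro LIMSEQ_le_const) auto
    show "\<xi> \<in> V \<sigma> \<union> E \<sigma>"
    proof (cases "\<sigma> * (a \<bullet> \<xi> + b) = 0")
      case False
      then have "\<sigma> * (a \<bullet> \<xi> + b) > 0" using ge by linarith
      then show ?thesis using \<xi>L by (simp add: V_def)
    next
      case True
      then have \<xi>0: "a \<bullet> \<xi> + b = 0" using \<sigma> by simp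
      have "\<xi> \<in> closure (side \<sigma>)"
      proof (cases "finite {n. x n \<in> V \<sigma>}")
        case True
        then have "eventually (\<lambda>n. x n \<notin> V \<sigma>) sequentially"
          unfolding cofinite_eq_sequentially[symmetric] eventually_cofinite by simp
        then have "eventually (\<lambda>n. x n \<in> closure (side \<sigma>)) sequentially"
          by (rule eventually_mono) (use x in \<open>auto simp: E_def\<close>)
        then show ?thesis by (rule Lim_in_closed_set[OF closed_closure _ sequentially_bot lim])
      next
        case False
        then obtain l where l: "strict_mono (l :: nat \<Rightarrow> nat)" "\<And>n. x (l n) \<in> V \<sigma>"
          using infinite_enumerate[of "{n. x n \<in> V \<sigma>}"] by auto
        have "(\<lambda>n. x (l n)) \<longlonglongrightarrow> \<xi>" using LIMSEQ_subseq_LIMSEQ[OF lim l(1)] by (simp add: comp_def)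
        then show ?thesis
          using accumulation_on_same_side[OF \<sigma> _ _ _ \<xi>0, of "\<lambda>n. x (l n)"] l(2) by (simp add: V_def)
      qed
      then show ?thesis using \<xi>L \<xi>0 by (simp add: E_def)
    qed
  qed
  have cover: "limit_set \<Gamma> \<subseteq> (V 1 \<union> E 1) \<union> (V (-1) \<union> E (-1))"
  proof
    fix \<xi> assume \<xi>: "\<xi> \<in> limit_set \<Gamma>"
    have \<xi>S: "\<xi> \<in> S2" using \<xi> limit_set_subset by blast
    show "\<xi> \<in> (V 1 \<union> E 1) \<union> (V (-1) \<union> E (-1))"
    proof (cases "a \<bullet> \<xi> + b = 0")
      case False
      then show ?thesis using \<xi> by (auto simp: V_def)
    next
      case True
      define w where "w t = (1 - t) *\<^sub>R p0 + t *\<^sub>R \<xi>" for t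
      have lim: "(w \<longlongrightarrow> \<xi>) (at_left 1)" unfolding w_def by (rule segment_tendsto)
      have "eventually (\<lambda>t. norm (w t) > R) (at_left 1)"
        using order_tendstoD(1)[OF tendsto_norm[OF lim], of R] \<xi>S R(1) by simp
      moreover have "eventually (\<lambda>t :: real. 0 < t \<and> t < 1) (at_left 1)"
        unfolding eventually_at_left_field by (intro exI[of _ 0]) auto
      ultimately have "eventually (\<lambda>t. w t \<in> closure (side 1 \<union> side (-1))) (at_left 1)"
      proof (rule eventually_elim2)
        fix t :: real assume t: "norm (w t) > R" "0 < t \<and> t < 1"
        have "w t \<in> slice" unfolding w_def by (rule slice_segment[OF \<xi> True]) (use t in auto)
        then have "w t \<in> side 1 \<union> side (-1)" using R(2) t(1) by blast
        then show "w t \<in> closure (side 1 \<union> side (-1))" by (rule subsetD[OF closure_subset])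
      qed
      then have "\<xi> \<in> closure (side 1 \<union> side (-1))"
        by (rule Lim_in_closed_set[OF closed_closure _ trivial_limit_at_left_real lim])
      then have "\<xi> \<in> E 1 \<or> \<xi> \<in> E (-1)" using \<xi> True by (simp add: E_def)
      then show ?thesis by blast
    qed
  qed
  have disj: "(V 1 \<union> E 1) \<inter> (V (-1) \<union> E (-1)) \<inter> limit_set \<Gamma> = {}"
  proof -
    have "False" if \<xi>: "\<xi> \<in> E 1" "\<xi> \<in> E (-1)" for \<xi>
    proof -
      have n: "norm \<xi> = 1" using \<xi>(1) limit_set_subset by (auto simp: E_def)
      have e: "0 < 1 - R" using R(1) by simp
      have "\<xi> \<in> closure (side 1)" "\<xi> \<in> closure (side (-1))" using \<xi> by (simp_all add: E_def)
      then obtain p q where p: "p \<in> side 1" "dist p \<xi> < 1 - R" and q: "q \<in> side (-1)" "dist q \<xi> < 1 - R"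
        using e unfolding closure_approachable by meson
      have "closed_segment p q \<subseteq> ball \<xi> (1 - R)"
        using p(2) q(2) by (intro closed_segment_subset convex_ball) (auto simp: dist_commute)
      then have "R < norm w" if "w \<in> closed_segment p q" for w
      proof -
        have "norm (\<xi> - w) < 1 - R" using that \<open>closed_segment p q \<subseteq> ball \<xi> (1 - R)\<close> by (auto simp: dist_norm)
        then show ?thesis using norm_triangle_ineq2[of \<xi> w] n by linarith
      qed
      then show False by (rule same_side_along_segment[OF R(2) p(1) q(1)])
    qed
    then show ?thesis by (auto simp: V_def E_def)
  qed
  have "(V 1 \<union> E 1) \<inter> limit_set \<Gamma> = {} \<or> (V (-1) \<union> E (-1)) \<inter> limit_set \<Gamma> = {}"
    by (rule connected_closedD[OF conn disj cover]) (intro cl; simp)+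
  moreover have "V \<sigma> \<noteq> {}" if \<sigma>: "\<sigma> \<noteq> 0" for \<sigma>
  proof
    assume "V \<sigma> = {}"
    then have "limit_set \<Gamma> \<subseteq> {w. (\<sigma> *\<^sub>R a) \<bullet> w \<le> - \<sigma> * b}" by (auto simp: V_def algebra_simps not_less)
    then have sub: "limit_hull \<subseteq> {w. (\<sigma> *\<^sub>R a) \<bullet> w \<le> - \<sigma> * b}" by (intro hull_minimal convex_halfspace_le)
    have "p0 \<in> interior {w. (\<sigma> *\<^sub>R a) \<bullet> w \<le> - \<sigma> * b}" using p0(1) interior_mono[OF sub] by blast
    also have "interior {w. (\<sigma> *\<^sub>R a) \<bullet> w \<le> - \<sigma> * b} = {w. (\<sigma> *\<^sub>R a) \<bullet> w < - \<sigma> * b}"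
      using \<sigma> a_nonzero by (intro interior_halfspace_le) simp
    finally have "\<sigma> * (a \<bullet> p0 + b) < 0" by (simp add: algebra_simps)
    then show False using p0(2) by simp
  qed
  then have "V 1 \<noteq> {}" "V (-1) \<noteq> {}" by simp_all
  then have "(V 1 \<union> E 1) \<inter> limit_set \<Gamma> \<noteq> {}" "(V (-1) \<union> E (-1)) \<inter> limit_set \<Gamma> \<noteq> {}"
    by (auto simp: V_def)
  ultimately show False by blast
qed

end

section \<open>Closed planes in the core\<close>

theorem theorem2p1:
  fixes \<Gamma> :: "(complex^2^2) set set" and x :: "(complex^2^2) set"
    and Pstar :: "(real^3) set set" and s :: "(real^3) set"
  assumes "torsion_free_discrete_subgroup \<Gamma>"
    and "convex_cocompact \<Gamma>"
    and "incompressible_boundary (Mbar \<Gamma>) (boundary_Mbar \<Gamma>)"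
    and "x \<in> carrier PSL2C"
    and "Pstar = geodesic_plane \<Gamma> x \<inter> core_interior \<Gamma>"
    and "Pstar \<noteq> {}"
    and "closedin (subtopology (hyp_manifold \<Gamma>) (core_interior \<Gamma>)) Pstar"
    and "s \<in> topspace (plane_surface \<Gamma> x)"
  shows "carrier (fundamental_group (plane_surface \<Gamma> x) s)
           \<noteq> {\<one>\<^bsub>fundamental_group (plane_surface \<Gamma> x) s\<^esub>}"
proof
  assume triv: "carrier (fundamental_group (plane_surface \<Gamma> x) s)
           = {\<one>\<^bsub>fundamental_group (plane_surface \<Gamma> x) s\<^esub>}"
  interpret kleinian_group \<Gamma> by unfold_locales (rule assms(1))
  interpret PSL: group PSL2C by (rule PSL2C_group)
  note x = assms(4)
  have ix: "inv\<^bsub>PSL2C\<^esub> x \<in> carrier PSL2C" using x by simp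
  have stab: "\<Gamma> \<inter> circle_stabilizer x = {\<one>\<^bsub>PSL2C\<^esub>}"
    by (rule trivial_fundamental_group_imp_trivial_stabilizer[OF x assms(8) triv])
  obtain a b where ab: "\<And>w. w \<in> cball 0 1 \<Longrightarrow>
      a \<bullet> w + b = weight (inv\<^bsub>PSL2C\<^esub> x) w * (axis 2 1 \<bullet> act (inv\<^bsub>PSL2C\<^esub> x) w + 0)"
    using act_pullback_affine[OF ix, of "axis 2 1" 0] by blast
  have sgn: "a \<bullet> w + b = weight (inv\<^bsub>PSL2C\<^esub> x) w * act (inv\<^bsub>PSL2C\<^esub> x) w $ 2" "weight (inv\<^bsub>PSL2C\<^esub> x) w > 0"
    if "w \<in> cball 0 1" for w
    using ab[OF that] weight_pos[OF ix that] by (simp_all add: inner_axis')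
  have plane: "w \<in> hyp_hull (circle x) \<longleftrightarrow> a \<bullet> w + b = 0" if "w \<in> H3" for w
    using sgn[of w] that by (simp add: mem_hyp_hull_circle_iff[OF x])
  obtain q where q: "q \<in> geodesic_plane \<Gamma> x" "q \<in> core_interior \<Gamma>" using assms(5,6) by blast
  then obtain p0 where p0: "p0 \<in> hyp_hull (circle x)" "q = orbit_map \<Gamma> p0" by (auto simp: geodesic_plane_def)
  have p0H: "p0 \<in> H3" using p0(1) by (simp add: hyp_hull_def)
  obtain r where r: "0 \<le> r" "r < 1" "\<forall>p\<in>limit_hull \<inter> H3. \<exists>g\<in>\<Gamma>. norm (act g p) \<le> r"
    using assms(2) cocompact_on_hull unfolding convex_cocompact_def by blast
  interpret closed_plane \<Gamma> a b p0 r
  proof unfold_locales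
    fix g assume g: "g \<in> \<Gamma>" and inv: "\<And>w. w \<in> H3 \<Longrightarrow> a \<bullet> w + b = 0 \<Longrightarrow> a \<bullet> act g w + b = 0"
    show "g = \<one>\<^bsub>PSL2C\<^esub>"
    proof (rule plane_stabilizer_trivial[OF x stab g])
      fix w assume w: "w \<in> hyp_hull (circle x)"
      then have wH: "w \<in> H3" by (simp add: hyp_hull_def)
      have "a \<bullet> act g w + b = 0" using inv[OF wH] plane[OF wH] w by blast
      then show "act g w \<in> hyp_hull (circle x)" using plane[OF act_H3[OF in_PSL2C[OF g] wH]] by blast
    qed
  next
    have "{v \<in> interior limit_hull. \<exists>g\<in>\<Gamma>. act g v \<in> hyp_hull (circle x)} =
        {u \<in> interior limit_hull. \<exists>g\<in>\<Gamma>. a \<bullet> act g u + b = 0}"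
      using plane act_H3[OF in_PSL2C] interior_hull_subset by blast
    then show "closedin (top_of_set (interior limit_hull)) {u \<in> interior limit_hull. \<exists>g\<in>\<Gamma>. a \<bullet> act g u + b = 0}"
      using closedin_plane_orbit[of x] assms(5,7) by simp
  next
    show "a \<noteq> 0"
    proof
      assume a: "a = 0"
      then have "b = 0" using plane[OF p0H] p0(1) by simp
      define v :: "real^3" where "v = vector [0, 1/2, 0]"
      have "(norm v)\<^sup>2 < 1" unfolding norm_sq_3 v_def by (simp add: power2_eq_square)
      then have vH: "v \<in> H3" by (simp add: power_less_one_iff)
      have xv: "act x v \<in> H3" by (rule act_H3[OF x vH])
      then have "act x v \<in> hyp_hull (circle x)" using plane a \<open>b = 0\<close> by simp
      then have "act (inv\<^bsub>PSL2C\<^esub> x) (act x v) $ 2 = 0" by (simp add: mem_hyp_hull_circle_iff[OF x])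
      moreover have "act (inv\<^bsub>PSL2C\<^esub> x) (act x v) = v" using vH by (intro act_inv(1)[OF x]) simp
      ultimately show False by (simp add: v_def)
    qed
    show "p0 \<in> interior limit_hull" using q(2) orbit_mem_core_interior_iff[OF p0H] p0(2) by simp
    show "a \<bullet> p0 + b = 0" using plane[OF p0H] p0(1) by simp
    show "0 \<le> r" "r < 1" by (rule r)+
    show "\<exists>g\<in>\<Gamma>. norm (act g p) \<le> r" if "p \<in> limit_hull" "p \<in> H3" for p using r(3) that by blast
  qed
  show False
    using limit_set_disconnected incompressible_imp_connected_limit_set[OF assms(3)] by blast
qed

end
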